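(* Let $G$ be a finite group, $k$ a field of characteristic dividing $|G|$, and $W$ a nonzero finite-dimensional $kG$-module. A finite-dimensional $kG$-module $X$ is virtually $W$-projective if and only if for every finite-dimensional $kG$-module $Y$ one has $(\Omega_{kG}^n(X),Y)_W=0$ for all $n$ sufficiently large.
   Context: Modules are finite-dimensional, $\otimes=\otimes_k$ with diagonal $G$-action, and $W^*$ is the $k$-dual. A module is $W$-projective if it is a direct summand of $W^*\otimes Y$ for some module $Y$. The $W$-stable category has the objects of $\mathrm{mod}(kG)$, and its morphism sets, written $(M,N)_W$, are $\mathrm{Hom}_{kG}(M,N)$ modulo the homomorphisms factoring through a $W$-projective module. $\Omega_{kG}(X)$ is the kernel of the surjection $(kG)^*\otimes kG\otimes X\to X$ given by evaluation $(kG)^*\otimes kG\to k$ tensored with $X$ (so $\Omega_{kG}(X)\cong \Omega_{kG}(k)\otimes X$; it agrees with the usual Heller translate up to projective summands), and $\Omega_{kG}^n$ is its $n$-fold iterate. The transfer map $\mathrm{Tr}_W:\mathrm{Ext}^n_{kG}(M\otimes W,N\otimes W)\to\mathrm{Ext}^n_{kG}(M,N)$ is the composite of the adjunction isomorphism $\mathrm{Ext}^n_{kG}(M\otimes W,N\otimes W)\cong\mathrm{Ext}^n_{kG}(M,N\otimes W\otimes W^* )$ with the map to $\mathrm{Ext}^n_{kG}(M,N)$ induced by $1_N$ tensored with the evaluation $W\otimes W^*\to k$. A module $X$ is virtually $W$-projective if for every module $Y$ the map $\mathrm{Tr}_W:\mathrm{Ext}_{kG}^n(X\otimes W,Y\otimes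 W)\to\mathrm{Ext}_{kG}^n(X,Y)$ is surjective for all $n$ sufficiently large (the bound on $n$ may depend on $Y$). *)

theory Defs
  imports "HOL-Algebra.Coset" "Jordan_Normal_Form.Matrix_Kernel"
begin

text \<open>
  A finite-dimensional \<open>kG\<close>-module is given in coordinates: the space \<open>k^n\<close> of column vectors
  together with, for every group element, the matrix by which it acts.  Every finite-dimensional
  \<open>kG\<close>-module is isomorphic to one of this form, so quantifying over these quantifies over all of
  them.  The values of the action outside the carrier of the group are irrelevant.
\<close>

record ('g, 'k) kG_rep =
  mdim :: nat
  act :: "'g \<Rightarrow> 'k mat"

definition kG_module :: "('g, 'b) monoid_scheme \<Rightarrow> ('g, 'k::field) kG_rep \<Rightarrow> bool" where
  "kG_module G M \<longleftrightarrow>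
     (\<forall>g\<in>carrier G. act M g \<in> carrier_mat (mdim M) (mdim M)) \<and>
     act M \<one>\<^bsub>G\<^esub> = 1\<^sub>m (mdim M) \<and>
     (\<forall>g\<in>carrier G. \<forall>h\<in>carrier G. act M (g \<otimes>\<^bsub>G\<^esub> h) = act M g * act M h)"

definition Hom_kG ::
  "('g, 'b) monoid_scheme \<Rightarrow> ('g, 'k::field) kG_rep \<Rightarrow> ('g, 'k) kG_rep \<Rightarrow> 'k mat set" where
  "Hom_kG G M N =
     {f \<in> carrier_mat (mdim N) (mdim M). \<forall>g\<in>carrier G. f * act M g = act N g * f}"

definition iso_kG ::
  "('g, 'b) monoid_scheme \<Rightarrow> ('g, 'k::field) kG_rep \<Rightarrow> ('g, 'k) kG_rep \<Rightarrow> bool" where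
  "iso_kG G M N \<longleftrightarrow>
     (\<exists>f\<in>Hom_kG G M N. \<exists>h\<in>Hom_kG G N M. h * f = 1\<^sub>m (mdim M) \<and> f * h = 1\<^sub>m (mdim N))"

definition mat_range :: "'k::field mat \<Rightarrow> 'k vec set" where
  "mat_range f = {f *\<^sub>v v | v. v \<in> carrier_vec (dim_col f)}"


subsection \<open>Sums, tensor products, duals, the regular module\<close>

definition dsum :: "('g, 'k::field) kG_rep \<Rightarrow> ('g, 'k) kG_rep \<Rightarrow> ('g, 'k) kG_rep" where
  "dsum M N = \<lparr> mdim = mdim M + mdim N,
     act = (\<lambda>g. four_block_mat (act M g) (0\<^sub>m (mdim M) (mdim N))
                               (0\<^sub>m (mdim N) (mdim M)) (act N g)) \<rparr>"

text \<open>
  Kronecker product.  The basis of \<open>k^m \<otimes> k^n\<close> is ordered by letting \<open>e_i \<otimes> e_j\<close> be basis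
  vector number \<open>i * n + j\<close>; with this ordering the product is strictly associative.
\<close>

definition kron :: "'k::field mat \<Rightarrow> 'k mat \<Rightarrow> 'k mat" where
  "kron A B = mat (dim_row A * dim_row B) (dim_col A * dim_col B)
     (\<lambda>(i, j). A $$ (i div dim_row B, j div dim_col B) * B $$ (i mod dim_row B, j mod dim_col B))"

definition tensor :: "('g, 'k::field) kG_rep \<Rightarrow> ('g, 'k) kG_rep \<Rightarrow> ('g, 'k) kG_rep"
  (infixl "\<otimes>\<^sub>k" 70) where
  "M \<otimes>\<^sub>k N = \<lparr> mdim = mdim M * mdim N, act = (\<lambda>g. kron (act M g) (act N g)) \<rparr>"

text \<open>The dual, in the dual basis: \<open>g\<close> sends a functional \<open>\<phi>\<close> to \<open>\<phi> \<circ> g\<inverse>\<close>.\<close>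

definition dual :: "('g, 'b) monoid_scheme \<Rightarrow> ('g, 'k::field) kG_rep \<Rightarrow> ('g, 'k) kG_rep" where
  "dual G M = \<lparr> mdim = mdim M, act = (\<lambda>g. transpose_mat (act M (inv\<^bsub>G\<^esub> g))) \<rparr>"

definition group_enum :: "('g, 'b) monoid_scheme \<Rightarrow> nat \<Rightarrow> 'g" where
  "group_enum G = (SOME e. bij_betw e {0..<Coset.order G} (carrier G))"

definition regular :: "('g, 'b) monoid_scheme \<Rightarrow> ('g, 'k::field) kG_rep" where
  "regular G = \<lparr> mdim = Coset.order G,
     act = (\<lambda>g. mat (Coset.order G) (Coset.order G)
       (\<lambda>(i, j). if group_enum G i = g \<otimes>\<^bsub>G\<^esub> group_enum G j then 1 else 0)) \<rparr>"

text \<open>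
  For a module of dimension \<open>n\<close> with dual basis \<open>e_i\<^sup>*\<close>: evaluation sends both \<open>e_i \<otimes> e_j\<^sup>*\<close> and
  \<open>e_i\<^sup>* \<otimes> e_j\<close> to the Kronecker delta, so one row vector describes both \<open>W \<otimes> W\<^sup>* \<rightarrow> k\<close> and
  \<open>W\<^sup>* \<otimes> W \<rightarrow> k\<close>; its transpose is the coevaluation \<open>1 \<mapsto> \<Sum> e_i \<otimes> e_i\<^sup>*\<close>.
\<close>

definition ev_mat :: "nat \<Rightarrow> 'k::field mat" where
  "ev_mat n = mat 1 (n * n) (\<lambda>(_, j). if j div n = j mod n then 1 else 0)"

definition coev_mat :: "nat \<Rightarrow> 'k::field mat" where
  "coev_mat n = transpose_mat (ev_mat n)"


subsection \<open>Quotients\<close>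

text \<open>
  The quotient of an additive group \<open>A\<close> of matrices by a subgroup \<open>B\<close>, as the set of cosets, and
  the map of quotients induced by a map \<open>\<phi>\<close> of representatives (into a quotient with congruence
  \<open>R'\<close>).
\<close>

definition cong_rel :: "'k::field mat set \<Rightarrow> 'k mat set \<Rightarrow> ('k mat \<times> 'k mat) set" where
  "cong_rel A B = {(x, y). x \<in> A \<and> y \<in> A \<and> x - y \<in> B}"

definition induced ::
  "('k::field mat \<times> 'k mat) set \<Rightarrow> ('k mat \<Rightarrow> 'k mat) \<Rightarrow> 'k mat set \<Rightarrow> 'k mat set" where
  "induced R' \<phi> C = (\<Union>x\<in>C. R' `` {\<phi> x})"


subsection \<open>The \<open>W\<close>-stable category\<close>

definition W_projective ::
  "('g, 'b) monoid_scheme \<Rightarrow> ('g, 'k::field) kG_rep \<Rightarrow> ('g, 'k) kG_rep \<Rightarrow> bool" where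
  "W_projective G W M \<longleftrightarrow> kG_module G M \<and>
     (\<exists>Y Q. kG_module G Y \<and> kG_module G Q \<and> iso_kG G (dsum M Q) (dual G W \<otimes>\<^sub>k Y))"

definition W_null_Hom :: "('g, 'b) monoid_scheme \<Rightarrow> ('g, 'k::field) kG_rep \<Rightarrow>
    ('g, 'k) kG_rep \<Rightarrow> ('g, 'k) kG_rep \<Rightarrow> 'k mat set" where
  "W_null_Hom G W M N =
     {b * a | a b P. W_projective G W P \<and> a \<in> Hom_kG G M P \<and> b \<in> Hom_kG G P N}"

definition W_stable_rel :: "('g, 'b) monoid_scheme \<Rightarrow> ('g, 'k::field) kG_rep \<Rightarrow>
    ('g, 'k) kG_rep \<Rightarrow> ('g, 'k) kG_rep \<Rightarrow> ('k mat \<times> 'k mat) set" where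
  "W_stable_rel G W M N = cong_rel (Hom_kG G M N) (W_null_Hom G W M N)"

definition W_stable_Hom :: "('g, 'b) monoid_scheme \<Rightarrow> ('g, 'k::field) kG_rep \<Rightarrow>
    ('g, 'k) kG_rep \<Rightarrow> ('g, 'k) kG_rep \<Rightarrow> 'k mat set set" where
  "W_stable_Hom G W M N = Hom_kG G M N // W_stable_rel G W M N"

definition W_stable_zero :: "('g, 'b) monoid_scheme \<Rightarrow> ('g, 'k::field) kG_rep \<Rightarrow>
    ('g, 'k) kG_rep \<Rightarrow> ('g, 'k) kG_rep \<Rightarrow> 'k mat set" where
  "W_stable_zero G W M N = W_stable_rel G W M N `` {0\<^sub>m (mdim N) (mdim M)}"


subsection \<open>Heller translate\<close>

definition free_cover ::
  "('g, 'b) monoid_scheme \<Rightarrow> ('g, 'k::field) kG_rep \<Rightarrow> ('g, 'k) kG_rep" where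
  "free_cover G X = dual G (regular G) \<otimes>\<^sub>k regular G \<otimes>\<^sub>k X"

definition free_cover_map ::
  "('g, 'b) monoid_scheme \<Rightarrow> ('g, 'k::field) kG_rep \<Rightarrow> 'k mat" where
  "free_cover_map G X = kron (ev_mat (Coset.order G)) (1\<^sub>m (mdim X))"

definition is_kernel :: "('g, 'b) monoid_scheme \<Rightarrow> ('g, 'k::field) kG_rep \<Rightarrow> 'k mat \<Rightarrow>
    ('g, 'k) kG_rep \<Rightarrow> 'k mat \<Rightarrow> bool" where
  "is_kernel G M f K \<iota> \<longleftrightarrow> kG_module G K \<and> \<iota> \<in> Hom_kG G K M \<and>
     mat_kernel \<iota> = {0\<^sub>v (mdim K)} \<and> mat_range \<iota> = mat_kernel f"

text \<open>
  Choosing a basis of the kernel puts it in coordinates; a different choice gives an isomorphic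
  module.
\<close>

definition Omega :: "('g, 'b) monoid_scheme \<Rightarrow> ('g, 'k::field) kG_rep \<Rightarrow> ('g, 'k) kG_rep" where
  "Omega G X = (SOME K. \<exists>\<iota>. is_kernel G (free_cover G X) (free_cover_map G X) K \<iota>)"


subsection \<open>Projective resolutions and Ext\<close>

definition projective_kG :: "('g, 'b) monoid_scheme \<Rightarrow> ('g, 'k::field) kG_rep \<Rightarrow> bool" where
  "projective_kG G P \<longleftrightarrow> kG_module G P \<and>
     (\<forall>A B p f. kG_module G A \<and> kG_module G B \<and> p \<in> Hom_kG G A B \<and>
        mat_range p = carrier_vec (mdim B) \<and> f \<in> Hom_kG G P B \<longrightarrow>
        (\<exists>h\<in>Hom_kG G P A. p * h = f))"

text \<open>
  A resolution of \<open>X\<close> is indexed so that \<open>d 0\<close> is the augmentation \<open>P 0 \<rightarrow> X\<close> and \<open>d (Suc n)\<close> is the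
  differential \<open>P (Suc n) \<rightarrow> P n\<close>.
\<close>

definition projective_resolution :: "('g, 'b) monoid_scheme \<Rightarrow> (nat \<Rightarrow> ('g, 'k::field) kG_rep) \<Rightarrow>
    (nat \<Rightarrow> 'k mat) \<Rightarrow> ('g, 'k) kG_rep \<Rightarrow> bool" where
  "projective_resolution G P d X \<longleftrightarrow>
     (\<forall>n. projective_kG G (P n)) \<and>
     d 0 \<in> Hom_kG G (P 0) X \<and> (\<forall>n. d (Suc n) \<in> Hom_kG G (P (Suc n)) (P n)) \<and>
     mat_range (d 0) = carrier_vec (mdim X) \<and>
     (\<forall>n. mat_range (d (Suc n)) = mat_kernel (d n))"

definition cocycles :: "('g, 'b) monoid_scheme \<Rightarrow> (nat \<Rightarrow> ('g, 'k::field) kG_rep) \<Rightarrow>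
    (nat \<Rightarrow> 'k mat) \<Rightarrow> nat \<Rightarrow> ('g, 'k) kG_rep \<Rightarrow> 'k mat set" where
  "cocycles G P d n N =
     {f \<in> Hom_kG G (P n) N. f * d (Suc n) = 0\<^sub>m (mdim N) (mdim (P (Suc n)))}"

definition coboundaries :: "('g, 'b) monoid_scheme \<Rightarrow> (nat \<Rightarrow> ('g, 'k::field) kG_rep) \<Rightarrow>
    (nat \<Rightarrow> 'k mat) \<Rightarrow> nat \<Rightarrow> ('g, 'k) kG_rep \<Rightarrow> 'k mat set" where
  "coboundaries G P d n N =
     (case n of 0 \<Rightarrow> {0\<^sub>m (mdim N) (mdim (P 0))}
      | Suc m \<Rightarrow> {h * d (Suc m) | h. h \<in> Hom_kG G (P m) N})"

definition Ext_rel :: "('g, 'b) monoid_scheme \<Rightarrow> (nat \<Rightarrow> ('g, 'k::field) kG_rep) \<Rightarrow>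
    (nat \<Rightarrow> 'k mat) \<Rightarrow> nat \<Rightarrow> ('g, 'k) kG_rep \<Rightarrow> ('k mat \<times> 'k mat) set" where
  "Ext_rel G P d n N = cong_rel (cocycles G P d n N) (coboundaries G P d n N)"

text \<open>
  \<open>Ext\<^sup>n(M, N)\<close> computed from a projective resolution \<open>(P, d)\<close> of \<open>M\<close>.
\<close>

definition Ext_kG :: "('g, 'b) monoid_scheme \<Rightarrow> (nat \<Rightarrow> ('g, 'k::field) kG_rep) \<Rightarrow>
    (nat \<Rightarrow> 'k mat) \<Rightarrow> nat \<Rightarrow> ('g, 'k) kG_rep \<Rightarrow> 'k mat set set" where
  "Ext_kG G P d n N = cocycles G P d n N // Ext_rel G P d n N"


subsection \<open>The transfer map\<close>

text \<open>
  If \<open>(P, d)\<close> is a projective resolution of \<open>M\<close>, then \<open>(P \<otimes> W, d \<otimes> 1)\<close> is one of \<open>M \<otimes> W\<close>; it is the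
  one used to compute \<open>Ext\<^sup>n(M \<otimes> W, -)\<close>.
\<close>

definition tensor_cx :: "(nat \<Rightarrow> ('g, 'k::field) kG_rep) \<Rightarrow> ('g, 'k) kG_rep \<Rightarrow>
    nat \<Rightarrow> ('g, 'k) kG_rep" where
  "tensor_cx P W n = P n \<otimes>\<^sub>k W"

definition tensor_diff :: "(nat \<Rightarrow> 'k::field mat) \<Rightarrow> ('g, 'k) kG_rep \<Rightarrow> nat \<Rightarrow> 'k mat" where
  "tensor_diff d W n = kron (d n) (1\<^sub>m (mdim W))"

text \<open>
  The adjunction \<open>Hom(U \<otimes> W, V) \<cong> Hom(U, V \<otimes> W\<^sup>*)\<close>, \<open>f \<mapsto> (f \<otimes> 1) \<circ> (1 \<otimes> coev)\<close>.
\<close>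

definition adjoint_mat :: "('g, 'k::field) kG_rep \<Rightarrow> ('g, 'k) kG_rep \<Rightarrow> 'k mat \<Rightarrow> 'k mat" where
  "adjoint_mat U W f =
     kron f (1\<^sub>m (mdim W)) * kron (1\<^sub>m (mdim U)) (coev_mat (mdim W))"

text \<open>\<open>Ext\<^sup>n(M \<otimes> W, V) \<rightarrow> Ext\<^sup>n(M, V \<otimes> W\<^sup>*)\<close>\<close>

definition Ext_adjunction :: "('g, 'b) monoid_scheme \<Rightarrow> (nat \<Rightarrow> ('g, 'k::field) kG_rep) \<Rightarrow>
    (nat \<Rightarrow> 'k mat) \<Rightarrow> nat \<Rightarrow> ('g, 'k) kG_rep \<Rightarrow> ('g, 'k) kG_rep \<Rightarrow> 'k mat set \<Rightarrow> 'k mat set" where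
  "Ext_adjunction G P d n W V =
     induced (Ext_rel G P d n (V \<otimes>\<^sub>k dual G W)) (adjoint_mat (P n) W)"

text \<open>\<open>Ext\<^sup>n(M, N) \<rightarrow> Ext\<^sup>n(M, N')\<close> induced by \<open>u : N \<rightarrow> N'\<close>\<close>

definition Ext_map :: "('g, 'b) monoid_scheme \<Rightarrow> (nat \<Rightarrow> ('g, 'k::field) kG_rep) \<Rightarrow>
    (nat \<Rightarrow> 'k mat) \<Rightarrow> nat \<Rightarrow> ('g, 'k) kG_rep \<Rightarrow> 'k mat \<Rightarrow> 'k mat set \<Rightarrow> 'k mat set" where
  "Ext_map G P d n N' u = induced (Ext_rel G P d n N') (\<lambda>f. u * f)"

definition transfer_W :: "('g, 'b) monoid_scheme \<Rightarrow> (nat \<Rightarrow> ('g, 'k::field) kG_rep) \<Rightarrow>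
    (nat \<Rightarrow> 'k mat) \<Rightarrow> nat \<Rightarrow> ('g, 'k) kG_rep \<Rightarrow> ('g, 'k) kG_rep \<Rightarrow> 'k mat set \<Rightarrow> 'k mat set" where
  "transfer_W G P d n W N =
     Ext_map G P d n N (kron (1\<^sub>m (mdim N)) (ev_mat (mdim W))) \<circ>
     Ext_adjunction G P d n W (N \<otimes>\<^sub>k W)"

text \<open>
  Surjectivity of the transfer does not depend on the projective resolution of \<open>X\<close> from which Ext is
  computed, and resolutions exist (iterate \<^const>\<open>free_cover\<close>), so it is immaterial that
  all of them are considered.
\<close>

definition virtually_W_projective ::
  "('g, 'b) monoid_scheme \<Rightarrow> ('g, 'k::field) kG_rep \<Rightarrow> ('g, 'k) kG_rep \<Rightarrow> bool" where
  "virtually_W_projective G W X \<longleftrightarrow> kG_module G X \<and>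
     (\<forall>Y. kG_module G Y \<longrightarrow> (\<forall>\<^sub>F n in sequentially.
        \<forall>P d. projective_resolution G P d X \<longrightarrow>
          transfer_W G P d n W Y ` Ext_kG G (tensor_cx P W) (tensor_diff d W) n (Y \<otimes>\<^sub>k W)
            = Ext_kG G P d n Y))"

end

theory Submission
  imports Defs
begin

text \<open>
  The two conditions agree in every single degree \<open>n\<close> and for every \<open>Y\<close>, because both say that each
  homomorphism \<open>\<Omega>\<^sup>n X \<rightarrow> Y\<close> lifts along the counit \<open>u : Y \<otimes> W \<otimes> W\<^sup>* \<rightarrow> Y\<close>.

  For the stable category this is the identification of the maps factoring through a
  \<open>W\<close>-projective module with those factoring through \<open>u\<close> (\<open>W_null_Hom_iff\<close>): the source of \<open>u\<close> is
  \<open>W\<close>-projective, and on modules of the form \<open>V \<otimes> W\<^sup>*\<close> the counit splits by a triangle identity, so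
  that by naturality every map out of such a module lifts along \<open>u\<close>.

  For the transfer, a degree \<open>n\<close> cocycle on a projective resolution \<open>P\<close> of \<open>X\<close> is a homomorphism from
  the \<open>n\<close>-th syzygy \<open>K n\<close>, and the adjunction maps cocycles onto cocycles; hence the transfer
  is surjective in degree \<open>n\<close> iff every cocycle with values in \<open>Y\<close> differs by a coboundary from one
  that lifts along \<open>u\<close> to a cocycle.  Coboundaries lift in this way, since \<open>u\<close> is surjective (as \<open>W \<noteq> 0\<close>) and they
  factor through a projective.  So surjectivity means that all homomorphisms \<open>K n \<rightarrow> Y\<close> lift
  (\<open>transfer_surj_iff_lifts\<close>).

  It remains to compare \<open>K n\<close> with \<open>\<Omega>\<^sup>n X\<close>, the syzygy of the resolution by free covers
  (\<open>Omega_syzygies\<close>, which needs the projectivity of the free cover).  By a weak form of Schanuel's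
  lemma each is a retract of the other up to maps factoring through projectives
  (\<open>stable_retract_syzygies\<close>), and maps factoring through projectives lift along \<open>u\<close> anyway
  (\<open>lifts_stable_retract\<close>).

  With the basis ordering of the Kronecker product, the tensor product of coordinate modules is
  strictly associative and the trivial module is a strict unit for it, so that the usual diagrams
  become matrix identities without associativity isomorphisms.
\<close>

section \<open>Splitting of linear maps\<close>

lemma mat_assoc:
  "dim_col A = dim_row B \<Longrightarrow> dim_col B = dim_row C \<Longrightarrow> A * B * C = A * (B * C)"
  for A B C :: "'a::semiring_0 mat"
  by (rule assoc_mult_mat[of _ "dim_row A" "dim_col A" _ "dim_col B" _ "dim_col C"]) auto

lemma index_mult_mat_sum:
  assumes "i < dim_row A" "j < dim_col B" "dim_col A = dim_row B"
  shows "(A * B) $$ (i, j) = (\<Sum>k<dim_row B. A $$ (i, k) * B $$ (k, j))"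
  using assms by (auto simp: scalar_prod_def lessThan_atLeast0 intro!: sum.cong)

lemma mat_eq_if_mult_vec_eq:
  fixes A B :: "'a::semiring_1 mat"
  assumes "A \<in> carrier_mat m n" "B \<in> carrier_mat m n"
    and "\<And>v. v \<in> carrier_vec n \<Longrightarrow> A *\<^sub>v v = B *\<^sub>v v"
  shows "A = B"
proof (rule mat_col_eqI)
  fix j assume j: "j < dim_col B"
  have "col A j = A *\<^sub>v unit_vec n j" "col B j = B *\<^sub>v unit_vec n j"
    using assms(1,2) j by (auto simp: scalar_prod_right_unit)
  with assms(3)[of "unit_vec n j"] show "col A j = col B j" by simp
qed (use assms in auto)

text \<open>
  Every matrix \<open>f\<close> splits: its kernel is the image of a split injection \<open>\<iota>\<close> (with retraction \<open>l\<close>),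
  and the complementary idempotent is of the form \<open>h f\<close>.  In particular \<open>f h f = f\<close>.
\<close>

lemma kernel_splitting:
  fixes f :: "'k::field mat"
  assumes "f \<in> carrier_mat m n"
  shows "\<exists>r \<iota> l h. \<iota> \<in> carrier_mat n r \<and> l \<in> carrier_mat r n \<and> h \<in> carrier_mat n m \<and>
    f * \<iota> = 0\<^sub>m m r \<and> l * \<iota> = 1\<^sub>m r \<and> 1\<^sub>m n = \<iota> * l + h * f"
  using assms
proof (induction n arbitrary: f)
  case 0
  then show ?case
    by (intro exI[of _ 0] exI[of _ "1\<^sub>m 0"] exI[of _ "0\<^sub>m 0 m"]) auto
next
  case (Suc n)
  show ?case
  proof (cases "f = 0\<^sub>m m (Suc n)")
    case True
    then show ?thesis
      by (intro exI[of _ "Suc n"] exI[of _ "1\<^sub>m (Suc n)"] exI[of _ "0\<^sub>m (Suc n) m"]) auto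
  next
    case False
    then obtain i j where ij: "i < m" "j < Suc n" "f $$ (i, j) \<noteq> 0"
      using Suc.prems by (metis (no_types, lifting) carrier_matD eq_matI index_zero_mat)
    \<comment> \<open>Pivot at \<open>(i, j)\<close>: the kernel of row \<open>i\<close> has the basis \<open>e\<^sub>b - c\<^sub>b e\<^sub>j\<close> with \<open>b \<noteq> j\<close>, where \<open>s\<close>
      enumerates the indices \<open>b \<noteq> j\<close>.\<close>
    define c where "c b = f $$ (i, b) / f $$ (i, j)" for b
    define s where "s a = (if a < j then a else Suc a)" for a :: nat
    define \<iota>1 where "\<iota>1 = mat (Suc n) n
      (\<lambda>(b, a). (if b = s a then 1 else 0) - (if b = j then c (s a) else 0))"
    define l1 :: "'k mat" where "l1 = mat n (Suc n) (\<lambda>(a, b). if b = s a then 1 else 0)"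
    define q where "q = mat (Suc n) m (\<lambda>(b, a). if b = j \<and> a = i then 1 / f $$ (i, j) else 0)"
    have c1: "\<iota>1 \<in> carrier_mat (Suc n) n" "l1 \<in> carrier_mat n (Suc n)" "q \<in> carrier_mat (Suc n) m"
      by (auto simp: \<iota>1_def l1_def q_def)
    note f = Suc.prems
    have s: "s a \<noteq> j" "s a = s a' \<longleftrightarrow> a = a'" "a < n \<Longrightarrow> s a < Suc n" for a a'
      using ij(2) by (auto simp: s_def)
    have s_surj: "\<exists>a<n. b = s a" if "b < Suc n" "b \<noteq> j" for b
      using that ij(2) by (intro exI[of _ "if b < j then b else b - 1"]) (auto simp: s_def)
    have l1\<iota>1: "l1 * \<iota>1 = 1\<^sub>m n"
    proof (rule eq_matI)
      fix a a' assume a: "a < dim_row (1\<^sub>m n :: 'k mat)" "a' < dim_col (1\<^sub>m n :: 'k mat)"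
      have "(l1 * \<iota>1) $$ (a, a') = (\<Sum>b<Suc n. l1 $$ (a, b) * \<iota>1 $$ (b, a'))"
        using a c1 by (subst index_mult_mat_sum) auto
      also have "\<dots> = (\<Sum>b<Suc n. if b = s a then \<iota>1 $$ (b, a') else 0)"
        using a by (intro sum.cong) (auto simp: l1_def)
      also have "\<dots> = \<iota>1 $$ (s a, a')"
        using s(3) a by (subst sum.delta) auto
      also have "\<dots> = 1\<^sub>m n $$ (a, a')"
        using a s by (auto simp: \<iota>1_def)
      finally show "(l1 * \<iota>1) $$ (a, a') = 1\<^sub>m n $$ (a, a')" .
    qed (use c1 in auto)
    have split1: "1\<^sub>m (Suc n) = \<iota>1 * l1 + q * f"
    proof (rule eq_matI)
      fix b b' assume "b < dim_row (\<iota>1 * l1 + q * f)" "b' < dim_col (\<iota>1 * l1 + q * f)"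
      hence b: "b < Suc n" "b' < Suc n" using c1 f by auto
      have "(q * f) $$ (b, b') = (\<Sum>a<m. q $$ (b, a) * f $$ (a, b'))"
        using b c1 f by (subst index_mult_mat_sum) auto
      also have "\<dots> = (\<Sum>a<m. if a = i then (if b = j then c b' else 0) else 0)"
        using b by (intro sum.cong) (auto simp: q_def c_def)
      also have "\<dots> = (if b = j then c b' else 0)"
        using ij by (subst sum.delta) auto
      finally have 1: "(q * f) $$ (b, b') = (if b = j then c b' else 0)" .
      have 2: "(\<iota>1 * l1) $$ (b, b') = (if b = b' then 1 else 0) - (if b = j then c b' else 0)"
      proof (cases "b' = j")
        case True
        have "(\<iota>1 * l1) $$ (b, b') = (\<Sum>a<n. \<iota>1 $$ (b, a) * l1 $$ (a, b'))"
          using b c1 by (subst index_mult_mat_sum) auto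
        also have "\<dots> = (\<Sum>a<n. 0)"
          using b s(1)[symmetric] True by (intro sum.cong) (auto simp: l1_def)
        finally show ?thesis using True ij by (auto simp: c_def)
      next
        case False
        then obtain a0 where a0: "a0 < n" "b' = s a0" using s_surj b by blast
        have "(\<iota>1 * l1) $$ (b, b') = (\<Sum>a<n. \<iota>1 $$ (b, a) * l1 $$ (a, b'))"
          using b c1 by (subst index_mult_mat_sum) auto
        also have "\<dots> = (\<Sum>a<n. if a = a0 then \<iota>1 $$ (b, a0) else 0)"
          using b s a0 by (intro sum.cong) (auto simp: l1_def)
        also have "\<dots> = \<iota>1 $$ (b, a0)" using a0 by (subst sum.delta) auto
        finally show ?thesis using a0 b by (auto simp: \<iota>1_def)
      qed
      show "1\<^sub>m (Suc n) $$ (b, b') = (\<iota>1 * l1 + q * f) $$ (b, b')"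
        using 1 2 b c1 f by simp
    qed (use c1 f in auto)
    have "f * \<iota>1 \<in> carrier_mat m n" using f c1 by simp
    from Suc.IH[OF this] obtain r \<iota>2 l2 h2 where IH:
      "\<iota>2 \<in> carrier_mat n r" "l2 \<in> carrier_mat r n" "h2 \<in> carrier_mat n m"
      "f * \<iota>1 * \<iota>2 = 0\<^sub>m m r" "l2 * \<iota>2 = 1\<^sub>m r" "1\<^sub>m n = \<iota>2 * l2 + h2 * (f * \<iota>1)"
      by blast
    define h where "h = \<iota>1 * h2 - \<iota>1 * h2 * f * q + q"
    have dims: "dim_row f = m" "dim_col f = Suc n" "dim_row \<iota>1 = Suc n" "dim_col \<iota>1 = n"
      "dim_row l1 = n" "dim_col l1 = Suc n" "dim_row q = Suc n" "dim_col q = m"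
      "dim_row \<iota>2 = n" "dim_col \<iota>2 = r" "dim_row l2 = r" "dim_col l2 = n"
      "dim_row h2 = n" "dim_col h2 = m"
      using f c1 IH(1-3) by auto
    have l\<iota>: "l2 * l1 * (\<iota>1 * \<iota>2) = 1\<^sub>m r"
    proof -
      have "l2 * l1 * (\<iota>1 * \<iota>2) = l2 * (l1 * \<iota>1) * \<iota>2" by (simp add: mat_assoc dims)
      also have "\<dots> = l2 * \<iota>2" unfolding l1\<iota>1 by (simp add: dims right_mult_one_mat')
      finally show ?thesis using IH(5) by simp
    qed
    have comp: "\<iota>1 * l1 = 1\<^sub>m (Suc n) - q * f"
      unfolding split1 using c1 f by (intro eq_matI) auto
    have "\<iota>1 * l1 = \<iota>1 * 1\<^sub>m n * l1" using c1 by simp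
    also have "\<dots> = \<iota>1 * (\<iota>2 * l2) * l1 + \<iota>1 * (h2 * (f * \<iota>1)) * l1"
      unfolding IH(6) using c1 IH f
      by (simp add: mult_add_distrib_mat[of _ "Suc n" n _ n] add_mult_distrib_mat[of _ "Suc n" n])
    also have "\<iota>1 * (h2 * (f * \<iota>1)) * l1 = \<iota>1 * h2 * f * (\<iota>1 * l1)" by (simp add: mat_assoc dims)
    also have "\<dots> = \<iota>1 * h2 * f - \<iota>1 * h2 * f * (q * f)"
      unfolding comp using c1 IH f
      by (subst mult_minus_distrib_mat[of _ "Suc n" "Suc n" _ "Suc n"]) auto
    finally have e: "\<iota>1 * l1 = \<iota>1 * (\<iota>2 * l2) * l1 + (\<iota>1 * h2 * f - \<iota>1 * h2 * f * (q * f))" .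
    have hf: "h * f = (\<iota>1 * h2 * f - \<iota>1 * h2 * f * (q * f)) + q * f"
    proof -
      have c: "\<iota>1 * h2 \<in> carrier_mat (Suc n) m" "\<iota>1 * h2 * f * q \<in> carrier_mat (Suc n) m"
        by (auto simp: dims carrier_matI)
      have "h * f = (\<iota>1 * h2 - \<iota>1 * h2 * f * q) * f + q * f"
        unfolding h_def by (rule add_mult_distrib_mat[OF minus_carrier_mat[OF c(2)] c1(3) f])
      also have "(\<iota>1 * h2 - \<iota>1 * h2 * f * q) * f = \<iota>1 * h2 * f - \<iota>1 * h2 * f * q * f"
        by (rule minus_mult_distrib_mat[OF c f])
      finally show ?thesis by (simp add: mat_assoc dims)
    qed
    have "1\<^sub>m (Suc n) = \<iota>1 * (\<iota>2 * l2) * l1 + h * f"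
      unfolding split1 hf unfolding e
      by (rule assoc_add_mat[of _ "Suc n" "Suc n"]; rule carrier_matI; simp add: dims)
    hence "1\<^sub>m (Suc n) = \<iota>1 * \<iota>2 * (l2 * l1) + h * f"
      by (simp add: mat_assoc dims)
    moreover have "f * (\<iota>1 * \<iota>2) = 0\<^sub>m m r" using IH(4) by (simp add: mat_assoc dims)
    moreover have "h \<in> carrier_mat (Suc n) m" by (rule carrier_matI) (simp_all add: h_def dims)
    moreover have "\<iota>1 * \<iota>2 \<in> carrier_mat (Suc n) r" "l2 * l1 \<in> carrier_mat r (Suc n)"
      by (rule carrier_matI; simp add: dims)+
    ultimately show ?thesis using l\<iota> by blast
  qed
qed

lemma surjective_right_inverse:
  fixes p :: "'k::field mat"
  assumes p: "p \<in> carrier_mat m n" and surj: "mat_range p = carrier_vec m"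
  obtains \<sigma> where "\<sigma> \<in> carrier_mat n m" "p * \<sigma> = 1\<^sub>m m"
proof -
  obtain r \<iota> l h where h: "\<iota> \<in> carrier_mat n r" "l \<in> carrier_mat r n" "h \<in> carrier_mat n m"
    "p * \<iota> = 0\<^sub>m m r" "1\<^sub>m n = \<iota> * l + h * p"
    using kernel_splitting[OF p] by blast
  have "p = p * (\<iota> * l + h * p)" using h(5)[symmetric] p by simp
  also have "\<dots> = (p * \<iota>) * l + p * h * p"
    using p h(1-3) by (subst mult_add_distrib_mat[of _ m n]) (auto simp: mat_assoc)
  also have "\<dots> = p * h * p" using h(1-4) p by simp
  finally have php: "p * h * p = p" by simp
  have "p * h = 1\<^sub>m m"
  proof (rule mat_eq_if_mult_vec_eq)
    fix v :: "'k vec" assume v: "v \<in> carrier_vec m"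
    then obtain w where w: "w \<in> carrier_vec n" "v = p *\<^sub>v w"
      using surj p by (auto simp: mat_range_def)
    have "p * h *\<^sub>v v = p * h * p *\<^sub>v w"
      unfolding w(2) using p h(3) w(1) by (subst assoc_mult_mat_vec[of _ m m _ n]) auto
    thus "p * h *\<^sub>v v = 1\<^sub>m m *\<^sub>v v" using php w v by simp
  qed (use p h in auto)
  with h(3) show thesis by (rule that)
qed

lemma injective_left_inverse:
  fixes f :: "'k::field mat"
  assumes f: "f \<in> carrier_mat m n" and inj: "mat_kernel f = {0\<^sub>v n}"
  obtains l where "l \<in> carrier_mat n m" "l * f = 1\<^sub>m n"
proof -
  obtain r \<iota> l h where h: "\<iota> \<in> carrier_mat n r" "l \<in> carrier_mat r n" "h \<in> carrier_mat n m"
    "f * \<iota> = 0\<^sub>m m r" "1\<^sub>m n = \<iota> * l + h * f"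
    using kernel_splitting[OF f] by blast
  have "\<iota> = 0\<^sub>m n r"
  proof (rule mat_eq_if_mult_vec_eq)
    fix v :: "'k vec" assume v: "v \<in> carrier_vec r"
    have "f *\<^sub>v (\<iota> *\<^sub>v v) = 0\<^sub>v m"
      using f h(1,4) v by (subst assoc_mult_mat_vec[symmetric, of _ m n _ r]) auto
    hence "\<iota> *\<^sub>v v \<in> mat_kernel f" using f h(1) v by (intro mat_kernelI) auto
    thus "\<iota> *\<^sub>v v = 0\<^sub>m n r *\<^sub>v v" using inj v by (auto intro!: eq_vecI)
  qed (use h in auto)
  hence "h * f = 1\<^sub>m n" using h f by simp
  with h(3) show thesis by (rule that)
qed

section \<open>Kronecker products, evaluation and interchange\<close>

lemma dim_kron [simp]:
  "dim_row (kron A B) = dim_row A * dim_row B" "dim_col (kron A B) = dim_col A * dim_col B"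
  by (simp_all add: kron_def)

lemma index_kron:
  "i < dim_row A * dim_row B \<Longrightarrow> j < dim_col A * dim_col B \<Longrightarrow> kron A B $$ (i, j) =
    A $$ (i div dim_row B, j div dim_col B) * B $$ (i mod dim_row B, j mod dim_col B)"
  by (simp add: kron_def)

lemma mod_less_mult: "i < a * b \<Longrightarrow> i mod b < b" for i a b :: nat
  by (cases "b = 0") auto

lemma div_less_mult: "i < a * b \<Longrightarrow> i div b < a" for i a b :: nat
  by (simp add: less_mult_imp_div_less)

lemma pair_eq_iff: "i = j \<longleftrightarrow> i div b = j div b \<and> i mod b = j mod b" for i j b :: nat
  by (metis div_mult_mod_eq)

lemma sum_div_mod:
  fixes f :: "nat \<Rightarrow> nat \<Rightarrow> 'a::comm_monoid_add"
  shows "(\<Sum>k<a * b. f (k div b) (k mod b)) = (\<Sum>i<a. \<Sum>j<b. f i j)"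
proof -
  have "(\<Sum>k<a * b. f (k div b) (k mod b)) =
      (\<Sum>i<a. \<Sum>k\<in>{i * b..<i * b + b}. f (k div b) (k mod b))"
    by (rule sum.nat_group[symmetric])
  also have "\<dots> = (\<Sum>i<a. \<Sum>j<b. f i j)"
  proof (rule sum.cong[OF refl])
    fix i
    show "(\<Sum>k\<in>{i * b..<i * b + b}. f (k div b) (k mod b)) = (\<Sum>j<b. f i j)"
    proof (rule sum.reindex_bij_witness[of _ "\<lambda>j. i * b + j" "\<lambda>k. k - i * b"])
      fix k assume k: "k \<in> {i * b..<i * b + b}"
      hence "k = i * b + (k - i * b)" "k - i * b < b" by auto
      hence "k div b = i" "k mod b = k - i * b"
        by (metis add.commute div_mult_self1 div_less less_nat_zero_code add_0_right mult.commute
            gr0I, metis mod_mult_self3 mod_less)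
      thus "f i (k - i * b) = f (k div b) (k mod b)" by simp
    qed auto
  qed
  finally show ?thesis .
qed

lemma sum_sum_delta:
  fixes f :: "nat \<Rightarrow> nat \<Rightarrow> 'a::comm_monoid_add"
  assumes "a < m" "b < n"
  shows "(\<Sum>c<m. \<Sum>d<n. if c = a \<and> d = b then f c d else 0) = f a b"
proof -
  have "(\<Sum>d<n. if c = a \<and> d = b then f c d else 0) = (if c = a then f a b else 0)" for c
    using assms by (cases "c = a") auto
  thus ?thesis using assms by simp
qed

lemma kron_mult_kron:
  assumes "dim_col A = dim_row C" "dim_col B = dim_row D"
  shows "kron A B * kron C D = kron (A * C) (B * D)"
proof (rule eq_matI)
  fix i j assume "i < dim_row (kron (A * C) (B * D))" "j < dim_col (kron (A * C) (B * D))"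
  hence i: "i < dim_row A * dim_row B" and j: "j < dim_col C * dim_col D" by auto
  note b = div_less_mult[OF i] mod_less_mult[OF i] div_less_mult[OF j] mod_less_mult[OF j]
  let ?f = "\<lambda>k l. A $$ (i div dim_row B, k) * C $$ (k, j div dim_col D) *
    (B $$ (i mod dim_row B, l) * D $$ (l, j mod dim_col D))"
  have "(kron A B * kron C D) $$ (i, j) =
      (\<Sum>k<dim_row C * dim_row D. ?f (k div dim_row D) (k mod dim_row D))"
    using i j assms by (subst index_mult_mat_sum) (auto simp: index_kron mult_ac intro!: sum.cong)
  also have "\<dots> = (\<Sum>k<dim_row C. \<Sum>l<dim_row D. ?f k l)" by (rule sum_div_mod)
  also have "\<dots> = (A * C) $$ (i div dim_row B, j div dim_col D) *
      (B * D) $$ (i mod dim_row B, j mod dim_col D)"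
    using b assms by (simp only: index_mult_mat_sum sum_product)
  also have "\<dots> = kron (A * C) (B * D) $$ (i, j)"
    using i j by (simp add: index_kron)
  finally show "(kron A B * kron C D) $$ (i, j) = kron (A * C) (B * D) $$ (i, j)" .
qed auto

lemma kron_assoc: "kron (kron A B) C = kron A (kron B C)"
proof (rule eq_matI)
  fix i j assume "i < dim_row (kron A (kron B C))" "j < dim_col (kron A (kron B C))"
  hence i: "i < dim_row A * dim_row B * dim_row C" and j: "j < dim_col A * dim_col B * dim_col C"
    by auto
  have i': "i < dim_row A * (dim_row B * dim_row C)" and j': "j < dim_col A * (dim_col B * dim_col C)"
    using i j by (simp_all add: mult.assoc)
  have e: "m div c div b = m div (b * c)" "m div c mod b = m mod (b * c) div c"
    "m mod (b * c) mod c = m mod c" for m b c :: nat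
    by (cases "c = 0"; simp add: div_mult2_eq mod_mult2_eq mult.commute[of b c] mod_mod_cancel)+
  show "kron (kron A B) C $$ (i, j) = kron A (kron B C) $$ (i, j)"
    using i j i' j' div_less_mult[OF i] div_less_mult[OF j] mod_less_mult[OF i'] mod_less_mult[OF j']
    by (simp add: index_kron e)
qed auto

lemma kron_one_right [simp]: "kron A (1\<^sub>m (Suc 0)) = A"
  by (rule eq_matI) (auto simp: index_kron)

lemma kron_one_left [simp]: "kron (1\<^sub>m (Suc 0)) A = A"
  by (rule eq_matI) (auto simp: index_kron)

lemma kron_one_one: "kron (1\<^sub>m m) (1\<^sub>m n) = 1\<^sub>m (m * n)"
proof (rule eq_matI)
  fix i j assume "i < dim_row (1\<^sub>m (m * n) :: 'a mat)" "j < dim_col (1\<^sub>m (m * n) :: 'a mat)"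
  hence i: "i < m * n" and j: "j < m * n" by auto
  show "kron (1\<^sub>m m) (1\<^sub>m n) $$ (i, j) = (1\<^sub>m (m * n) :: 'a mat) $$ (i, j)"
    using i j div_less_mult[OF i] div_less_mult[OF j] mod_less_mult[OF i] mod_less_mult[OF j]
    by (simp add: index_kron pair_eq_iff[of i j n])
qed auto

lemma kron_zero_left: "kron (0\<^sub>m a b) C = 0\<^sub>m (a * dim_row C) (b * dim_col C)"
  by (rule eq_matI) (auto simp: index_kron div_less_mult)

lemma kron_minus_left:
  assumes "A \<in> carrier_mat a b" "B \<in> carrier_mat a b"
  shows "kron (A - B) C = kron A C - kron B C"
  using assms by (intro eq_matI) (auto simp: index_kron div_less_mult algebra_simps)

lemma dim_ev_mat [simp]: "dim_row (ev_mat n) = Suc 0" "dim_col (ev_mat n) = n * n"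
  by (simp_all add: ev_mat_def)

lemma dim_coev_mat [simp]: "dim_row (coev_mat n) = n * n" "dim_col (coev_mat n) = Suc 0"
  by (simp_all add: coev_mat_def)

lemma transpose_mult_dim:
  "dim_col A = dim_row B \<Longrightarrow> transpose_mat (A * B) = transpose_mat B * transpose_mat A"
  for A B :: "'a::comm_semiring_0 mat"
  by (rule transpose_mult[of _ "dim_row A" "dim_col A" _ "dim_col B"]) auto

text \<open>Invariance of the evaluation under \<open>a \<otimes> b\<close> with \<open>a\<^sup>T b = 1\<close>.\<close>

lemma ev_mat_mult_kron:
  assumes "A \<in> carrier_mat n n" "B \<in> carrier_mat n n" "transpose_mat A * B = 1\<^sub>m n"
  shows "ev_mat n * kron A B = ev_mat n"
proof (rule eq_matI)
  fix i j assume "i < dim_row (ev_mat n :: 'a mat)" "j < dim_col (ev_mat n :: 'a mat)"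
  hence i: "i = 0" and j: "j < n * n" by auto
  note b = div_less_mult[OF j] mod_less_mult[OF j]
  let ?f = "\<lambda>k l. (if k = l then 1 else 0) * (A $$ (k, j div n) * B $$ (l, j mod n))"
  have "(ev_mat n * kron A B) $$ (i, j) = (\<Sum>k<n * n. ?f (k div n) (k mod n))"
    using assms(1,2) i j
    by (subst index_mult_mat_sum) (auto simp: index_kron ev_mat_def intro!: sum.cong)
  also have "\<dots> = (\<Sum>k<n. \<Sum>l<n. ?f k l)" by (rule sum_div_mod)
  also have "\<dots> = (\<Sum>k<n. transpose_mat A $$ (j div n, k) * B $$ (k, j mod n))"
    using b assms(1) by (intro sum.cong) (auto simp: if_distrib[of "\<lambda>x. x * _"] cong: if_cong)
  also have "\<dots> = (transpose_mat A * B) $$ (j div n, j mod n)"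
    using b assms(1,2) by (subst index_mult_mat_sum) auto
  also have "\<dots> = ev_mat n $$ (i, j)"
    unfolding assms(3) using i j b by (auto simp: ev_mat_def)
  finally show "(ev_mat n * kron A B) $$ (i, j) = ev_mat n $$ (i, j)" .
qed (use assms in auto)

lemma transpose_kron: "transpose_mat (kron A B) = kron (transpose_mat A) (transpose_mat B)"
  by (rule eq_matI) (auto simp: index_kron div_less_mult mod_less_mult)

lemma kron_mult_coev_mat:
  assumes "A \<in> carrier_mat n n" "B \<in> carrier_mat n n" "A * transpose_mat B = 1\<^sub>m n"
  shows "kron A B * coev_mat n = coev_mat n"
proof -
  have "kron A B * coev_mat n = transpose_mat (ev_mat n * kron (transpose_mat A) (transpose_mat B))"
    using assms(1,2)
    by (subst transpose_mult_dim) (auto simp: transpose_kron coev_mat_def)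
  also have "ev_mat n * kron (transpose_mat A) (transpose_mat B) = ev_mat n"
    using assms by (intro ev_mat_mult_kron) auto
  finally show ?thesis by (simp add: coev_mat_def)
qed

text \<open>The two triangle identities for the duality between \<open>W\<close> and \<open>W\<^sup>*\<close>.\<close>

lemma triangle_left: "kron (1\<^sub>m n) (ev_mat n) * kron (coev_mat n) (1\<^sub>m n) = 1\<^sub>m n"
proof (rule eq_matI)
  fix i j assume "i < dim_row (1\<^sub>m n :: 'a mat)" "j < dim_col (1\<^sub>m n :: 'a mat)"
  hence i: "i < n" and j: "j < n" by auto
  have nn: "0 < n * n" using i by simp
  let ?f = "\<lambda>k l. (if i = k then 1 else 0) * (if l div n = l mod n then 1 else 0) *
      ((if k = l div n then 1 else 0) * (if l mod n = j then 1 else 0) :: 'a)"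
  have "(kron (1\<^sub>m n) (ev_mat n) * kron (coev_mat n) (1\<^sub>m n) :: 'a mat) $$ (i, j) =
      (\<Sum>k<n * (n * n). ?f (k div (n * n)) (k mod (n * n)))"
  proof (subst index_mult_mat_sum, goal_cases)
    case 4
    have "(kron (1\<^sub>m n) (ev_mat n)) $$ (i, k) * (kron (coev_mat n) (1\<^sub>m n)) $$ (k, j) =
        ?f (k div (n * n)) (k mod (n * n))" if k: "k < n * (n * n)" for k
    proof -
      have k': "k < n * n * n" using k by (simp add: mult.assoc)
      have e: "k div n div n = k div (n * n)" "k div n mod n = k mod (n * n) div n"
        "k mod n = k mod (n * n) mod n"
        by (cases "n = 0"; simp add: div_mult2_eq mod_mult2_eq)+
      have *: "k div n < n * n" "k mod n < n" "k div (n * n) < n" "k mod (n * n) < n * n"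
        using div_less_mult[OF k'] mod_less_mult[OF k'] div_less_mult[OF k] mod_less_mult[OF k] by auto
      have "(kron (1\<^sub>m n) (ev_mat n)) $$ (i, k) = (if i = k div (n * n) then 1 else 0) *
          (if k mod (n * n) div n = k mod (n * n) mod n then 1 else (0 :: 'a))"
        using i k * by (simp add: index_kron ev_mat_def)
      moreover have "(kron (coev_mat n) (1\<^sub>m n)) $$ (k, j) =
         (if k div n div n = k div n mod n then 1 else 0) * (if k mod n = j then 1 else (0 :: 'a))"
        using j k' * by (simp add: index_kron ev_mat_def coev_mat_def)
      ultimately show ?thesis unfolding e by simp
    qed
    thus ?case by (intro sum.cong) (auto simp: mult.assoc)
  qed (use i j in auto)
  also have "\<dots> = (\<Sum>k<n. \<Sum>l<n * n. ?f k l)" by (rule sum_div_mod)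
  also have "\<dots> = (\<Sum>l<n * n. (\<lambda>a b. (if a = b then 1 else 0) * ((if i = a then 1 else 0) *
      (if b = j then 1 else (0 :: 'a)))) (l div n) (l mod n))"
    using i by (subst sum.swap) (auto simp: if_distrib[of "\<lambda>x. x * _"] cong: if_cong intro!: sum.cong)
  also have "\<dots> = (\<Sum>a<n. \<Sum>b<n. (if a = b then 1 else 0) * ((if i = a then 1 else 0) *
      (if b = j then 1 else (0 :: 'a))))"
    by (rule sum_div_mod)
  also have "\<dots> = (if i = j then 1 else 0)"
    using i j by (auto simp: if_distrib[of "\<lambda>x. x * _"] cong: if_cong)
  finally show "(kron (1\<^sub>m n) (ev_mat n) * kron (coev_mat n) (1\<^sub>m n)) $$ (i, j) = (1\<^sub>m n :: 'a mat) $$ (i, j)"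
    using i j by simp
qed auto

lemma triangle_right: "kron (ev_mat n) (1\<^sub>m n) * kron (1\<^sub>m n) (coev_mat n) = 1\<^sub>m n"
proof -
  have "kron (ev_mat n) (1\<^sub>m n) * kron (1\<^sub>m n) (coev_mat n) =
      transpose_mat (kron (1\<^sub>m n) (ev_mat n) * kron (coev_mat n) (1\<^sub>m n))"
    by (subst transpose_mult_dim) (auto simp: transpose_kron coev_mat_def)
  thus ?thesis by (simp add: triangle_left)
qed

text \<open>The matrix of the interchange \<open>k\<^sup>m \<otimes> k\<^sup>n \<rightarrow> k\<^sup>n \<otimes> k\<^sup>m\<close>, \<open>x \<otimes> y \<mapsto> y \<otimes> x\<close>.\<close>

definition swap_mat :: "nat \<Rightarrow> nat \<Rightarrow> 'k::field mat" where
  "swap_mat m n = mat (n * m) (m * n)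
     (\<lambda>(i, j). if i div m = j mod n \<and> i mod m = j div n then 1 else 0)"

lemma dim_swap_mat [simp]: "dim_row (swap_mat m n) = n * m" "dim_col (swap_mat m n) = m * n"
  by (simp_all add: swap_mat_def)

lemma swap_mat_kron:
  assumes "A \<in> carrier_mat m m'" "B \<in> carrier_mat n n'"
  shows "swap_mat m n * kron A B = kron B A * swap_mat m' n'"
proof (rule eq_matI)
  fix i j assume "i < dim_row (kron B A * swap_mat m' n')" "j < dim_col (kron B A * swap_mat m' n')"
  hence i: "i < n * m" and j: "j < m' * n'" using assms by auto
  note b = div_less_mult[OF i] mod_less_mult[OF i] div_less_mult[OF j] mod_less_mult[OF j]
  let ?f = "\<lambda>c d. A $$ (c, j div n') * B $$ (d, j mod n')"
  let ?g = "\<lambda>d c. A $$ (i mod m, c) * B $$ (i div m, d)"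
  have "(swap_mat m n * kron A B) $$ (i, j) = (\<Sum>k<m * n. (\<lambda>c d.
      if c = i mod m \<and> d = i div m then ?f c d else 0) (k div n) (k mod n))"
    using assms i j
    by (subst index_mult_mat_sum) (auto simp: index_kron swap_mat_def intro!: sum.cong)
  also have "\<dots> = (\<Sum>c<m. \<Sum>d<n. if c = i mod m \<and> d = i div m then ?f c d else 0)"
    by (rule sum_div_mod)
  also have "\<dots> = ?f (i mod m) (i div m)" using b by (intro sum_sum_delta)
  finally have 1: "(swap_mat m n * kron A B) $$ (i, j) = ?f (i mod m) (i div m)" .
  have "(kron B A * swap_mat m' n') $$ (i, j) = (\<Sum>k<n' * m'. (\<lambda>d c.
      if d = j mod n' \<and> c = j div n' then ?g d c else 0) (k div m') (k mod m'))"
    using assms i j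
    by (subst index_mult_mat_sum) (auto simp: index_kron swap_mat_def intro!: sum.cong)
  also have "\<dots> = (\<Sum>d<n'. \<Sum>c<m'. if d = j mod n' \<and> c = j div n' then ?g d c else 0)"
    by (rule sum_div_mod)
  also have "\<dots> = ?g (j mod n') (j div n')" using b by (intro sum_sum_delta)
  finally show "(swap_mat m n * kron A B) $$ (i, j) = (kron B A * swap_mat m' n') $$ (i, j)"
    using 1 by simp
qed (use assms in auto)

lemma swap_mat_swap_mat: "swap_mat n m * swap_mat m n = 1\<^sub>m (m * n)"
proof (rule eq_matI)
  fix i j assume "i < dim_row (1\<^sub>m (m * n) :: 'a mat)" "j < dim_col (1\<^sub>m (m * n) :: 'a mat)"
  hence i: "i < m * n" and j: "j < m * n" by auto
  note b = div_less_mult[OF i] mod_less_mult[OF i] div_less_mult[OF j] mod_less_mult[OF j]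
  let ?f = "\<lambda>c d. if c = j mod n \<and> d = j div n then 1 else (0 :: 'a)"
  have "(swap_mat n m * swap_mat m n :: 'a mat) $$ (i, j) = (\<Sum>k<n * m. (\<lambda>c d.
      if c = i mod n \<and> d = i div n then ?f c d else 0) (k div m) (k mod m))"
    using i j by (subst index_mult_mat_sum) (auto simp: swap_mat_def intro!: sum.cong)
  also have "\<dots> = (\<Sum>c<n. \<Sum>d<m. if c = i mod n \<and> d = i div n then ?f c d else 0)"
    by (rule sum_div_mod)
  also have "\<dots> = ?f (i mod n) (i div n)" using b by (intro sum_sum_delta)
  also have "\<dots> = (if i = j then 1 else 0)"
    by (auto simp: pair_eq_iff[of i j n])
  finally show "(swap_mat n m * swap_mat m n) $$ (i, j) = (1\<^sub>m (m * n) :: 'a mat) $$ (i, j)"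
    using i j by simp
qed auto

section \<open>Homomorphisms\<close>

lemma mat_vec_assoc:
  "dim_col A = dim_row B \<Longrightarrow> dim_col B = dim_vec v \<Longrightarrow> A * B *\<^sub>v v = A *\<^sub>v (B *\<^sub>v v)"
  for A B :: "'a::semiring_0 mat"
  by (rule assoc_mult_mat_vec[of _ "dim_row A" "dim_col A" _ "dim_col B"])
    (auto intro!: carrier_vecI)

lemma mat_range_eq_carrier_if_right_inverse:
  assumes "p * s = 1\<^sub>m m" "p \<in> carrier_mat m n" "s \<in> carrier_mat n m"
  shows "mat_range p = carrier_vec m"
proof -
  have "v \<in> mat_range p" if "v \<in> carrier_vec m" for v
  proof -
    have "p *\<^sub>v (s *\<^sub>v v) = v"
      using assms that by (subst mat_vec_assoc[symmetric]) auto
    moreover have "s *\<^sub>v v \<in> carrier_vec (dim_col p)" using assms(2,3) by (auto simp: mult_mat_vec_def)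
    ultimately show ?thesis by (metis (mono_tags, lifting) mat_range_def mem_Collect_eq)
  qed
  thus ?thesis using assms(2) by (auto simp: mat_range_def mult_mat_vec_def)
qed

lemma Hom_dims:
  assumes "f \<in> Hom_kG G M N"
  shows "dim_row f = mdim N" "dim_col f = mdim M"
  using assms by (auto simp: Hom_kG_def)

lemma Hom_carrier: "f \<in> Hom_kG G M N \<Longrightarrow> f \<in> carrier_mat (mdim N) (mdim M)"
  by (simp add: Hom_kG_def)

lemma Hom_comm: "f \<in> Hom_kG G M N \<Longrightarrow> g \<in> carrier G \<Longrightarrow> f * act M g = act N g * f"
  by (simp add: Hom_kG_def)

lemma HomI:
  assumes "dim_row f = mdim N" "dim_col f = mdim M"
    and "\<And>g. g \<in> carrier G \<Longrightarrow> f * act M g = act N g * f"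
  shows "f \<in> Hom_kG G M N"
  using assms by (auto simp: Hom_kG_def)

lemma act_dims:
  assumes "kG_module G M" "g \<in> carrier G"
  shows "dim_row (act M g) = mdim M" "dim_col (act M g) = mdim M"
  using assms by (auto simp: kG_module_def)

lemma act_carrier: "kG_module G M \<Longrightarrow> g \<in> carrier G \<Longrightarrow> act M g \<in> carrier_mat (mdim M) (mdim M)"
  by (simp add: kG_module_def)

lemma act_mult:
  "kG_module G M \<Longrightarrow> g \<in> carrier G \<Longrightarrow> h \<in> carrier G \<Longrightarrow>
    act M (g \<otimes>\<^bsub>G\<^esub> h) = act M g * act M h"
  by (simp add: kG_module_def)

lemma act_one: "kG_module G M \<Longrightarrow> act M \<one>\<^bsub>G\<^esub> = 1\<^sub>m (mdim M)"
  by (simp add: kG_module_def)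

lemma Hom_comp:
  assumes M: "kG_module G M" and P: "kG_module G P" and N: "kG_module G N"
    and a: "a \<in> Hom_kG G M P" and b: "b \<in> Hom_kG G P N"
  shows "b * a \<in> Hom_kG G M N"
proof (rule HomI)
  fix g assume g: "g \<in> carrier G"
  note dims = Hom_dims[OF a] Hom_dims[OF b] act_dims[OF M g] act_dims[OF P g] act_dims[OF N g]
  have "b * a * act M g = b * (act P g * a)" by (simp add: mat_assoc dims Hom_comm[OF a g])
  also have "\<dots> = b * act P g * a" by (simp add: mat_assoc dims)
  also have "\<dots> = act N g * (b * a)" by (simp add: mat_assoc dims Hom_comm[OF b g])
  finally show "b * a * act M g = act N g * (b * a)" .
qed (simp_all add: Hom_dims[OF a] Hom_dims[OF b])

lemma Hom_one: "kG_module G M \<Longrightarrow> 1\<^sub>m (mdim M) \<in> Hom_kG G M M"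
  by (rule HomI) (simp_all add: act_dims)

lemma Hom_zero: "kG_module G M \<Longrightarrow> kG_module G N \<Longrightarrow> 0\<^sub>m (mdim N) (mdim M) \<in> Hom_kG G M N"
  by (rule HomI) (simp_all add: left_mult_zero_mat[OF act_carrier] right_mult_zero_mat[OF act_carrier])

lemma Hom_add:
  assumes M: "kG_module G M" and N: "kG_module G N" and f: "f \<in> Hom_kG G M N" and f': "f' \<in> Hom_kG G M N"
  shows "f + f' \<in> Hom_kG G M N"
proof (rule HomI)
  fix g assume g: "g \<in> carrier G"
  show "(f + f') * act M g = act N g * (f + f')"
    using add_mult_distrib_mat[OF Hom_carrier[OF f] Hom_carrier[OF f'] act_carrier[OF M g]]
      mult_add_distrib_mat[OF act_carrier[OF N g] Hom_carrier[OF f] Hom_carrier[OF f']]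
    by (simp add: Hom_comm[OF f g] Hom_comm[OF f' g])
qed (simp_all add: Hom_dims[OF f'])

lemma Hom_minus:
  assumes M: "kG_module G M" and N: "kG_module G N" and f: "f \<in> Hom_kG G M N" and f': "f' \<in> Hom_kG G M N"
  shows "f - f' \<in> Hom_kG G M N"
proof (rule HomI)
  fix g assume g: "g \<in> carrier G"
  show "(f - f') * act M g = act N g * (f - f')"
    using minus_mult_distrib_mat[OF Hom_carrier[OF f] Hom_carrier[OF f'] act_carrier[OF M g]]
      mult_minus_distrib_mat[OF act_carrier[OF N g] Hom_carrier[OF f] Hom_carrier[OF f']]
    by (simp add: Hom_comm[OF f g] Hom_comm[OF f' g])
qed (simp_all add: Hom_dims[OF f'])


section \<open>Tensor products and duals\<close>

lemma mdim_tensor [simp]: "mdim (M \<otimes>\<^sub>k N) = mdim M * mdim N"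
  by (simp add: tensor_def)

lemma mdim_dual [simp]: "mdim (dual G M) = mdim M"
  by (simp add: dual_def)

lemma act_tensor: "act (M \<otimes>\<^sub>k N) g = kron (act M g) (act N g)"
  by (simp add: tensor_def)

lemma kG_module_tensor:
  assumes M: "kG_module G M" and N: "kG_module G N"
  shows "kG_module G (M \<otimes>\<^sub>k N)"
  unfolding kG_module_def
proof (intro conjI ballI)
  fix g assume g: "g \<in> carrier G"
  show "act (M \<otimes>\<^sub>k N) g \<in> carrier_mat (mdim (M \<otimes>\<^sub>k N)) (mdim (M \<otimes>\<^sub>k N))"
    by (rule carrier_matI) (simp_all add: act_tensor act_dims[OF M g] act_dims[OF N g])
  fix h assume h: "h \<in> carrier G"
  show "act (M \<otimes>\<^sub>k N) (g \<otimes>\<^bsub>G\<^esub> h) = act (M \<otimes>\<^sub>k N) g * act (M \<otimes>\<^sub>k N) h"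
    using M N g h by (simp add: act_tensor act_mult kron_mult_kron act_dims)
qed (simp add: act_tensor act_one[OF M] act_one[OF N] kron_one_one)

lemma Hom_kron:
  assumes "kG_module G M" "kG_module G M'" "kG_module G N" "kG_module G N'"
    and f: "f \<in> Hom_kG G M M'" and h: "h \<in> Hom_kG G N N'"
  shows "kron f h \<in> Hom_kG G (M \<otimes>\<^sub>k N) (M' \<otimes>\<^sub>k N')"
proof (rule HomI)
  fix g assume g: "g \<in> carrier G"
  show "kron f h * act (M \<otimes>\<^sub>k N) g = act (M' \<otimes>\<^sub>k N') g * kron f h"
    by (simp add: act_tensor kron_mult_kron Hom_dims[OF f] Hom_dims[OF h] act_dims[OF assms(1) g]
        act_dims[OF assms(2) g] act_dims[OF assms(3) g] act_dims[OF assms(4) g]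
        Hom_comm[OF f g] Hom_comm[OF h g])
qed (simp_all add: Hom_dims[OF f] Hom_dims[OF h])

lemma tensor_assoc: "(L \<otimes>\<^sub>k M) \<otimes>\<^sub>k N = L \<otimes>\<^sub>k (M \<otimes>\<^sub>k N)"
  by (simp add: tensor_def kron_assoc mult.assoc)

text \<open>The trivial module \<open>k\<close>; in coordinates it is a strict unit for the tensor product.\<close>

definition triv :: "('g, 'k::field) kG_rep" where
  "triv = \<lparr> mdim = Suc 0, act = (\<lambda>g. 1\<^sub>m (Suc 0)) \<rparr>"

lemma mdim_triv [simp]: "mdim triv = Suc 0"
  by (simp add: triv_def)

lemma kG_module_triv: "kG_module G triv"
  by (simp add: triv_def kG_module_def)

lemma tensor_triv [simp]: "M \<otimes>\<^sub>k triv = M"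
  by (simp add: tensor_def triv_def)

lemma triv_tensor [simp]: "triv \<otimes>\<^sub>k M = M"
  by (simp add: tensor_def triv_def)

lemma swap_Hom:
  assumes M: "kG_module G M" and N: "kG_module G N"
  shows "swap_mat (mdim M) (mdim N) \<in> Hom_kG G (M \<otimes>\<^sub>k N) (N \<otimes>\<^sub>k M)"
  by (rule HomI) (simp_all add: act_tensor swap_mat_kron[OF act_carrier[OF M] act_carrier[OF N]])

context group
begin

lemma act_inv_mult:
  assumes M: "kG_module G M" and g: "g \<in> carrier G"
  shows "act M (inv g) * act M g = 1\<^sub>m (mdim M)" "act M g * act M (inv g) = 1\<^sub>m (mdim M)"
  using act_mult[OF M inv_closed[OF g] g] act_mult[OF M g inv_closed[OF g]] act_one[OF M] g
  by simp_all

lemma kG_module_dual: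
  assumes M: "kG_module G M"
  shows "kG_module G (dual G M)"
  unfolding kG_module_def
proof (intro conjI ballI)
  fix g assume g: "g \<in> carrier G"
  show "act (dual G M) g \<in> carrier_mat (mdim (dual G M)) (mdim (dual G M))"
    using act_carrier[OF M inv_closed[OF g]] by (simp add: dual_def)
  fix h assume h: "h \<in> carrier G"
  show "act (dual G M) (g \<otimes> h) = act (dual G M) g * act (dual G M) h"
    using M g h by (simp add: dual_def inv_mult_group act_mult transpose_mult_dim act_dims)
qed (simp add: dual_def act_one[OF M])

lemma act_dual_mult:
  assumes M: "kG_module G M" and g: "g \<in> carrier G"
  shows "transpose_mat (act (dual G M) g) * act M g = 1\<^sub>m (mdim M)"
    and "transpose_mat (act M g) * act (dual G M) g = 1\<^sub>m (mdim M)"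
    and "act (dual G M) g * transpose_mat (act M g) = 1\<^sub>m (mdim M)"
    and "act M g * transpose_mat (act (dual G M) g) = 1\<^sub>m (mdim M)"
  using M g
  by (simp_all add: dual_def act_inv_mult transpose_mult_dim[symmetric] act_dims)

lemma ev_Hom:
  assumes M: "kG_module G M"
  shows "ev_mat (mdim M) \<in> Hom_kG G (M \<otimes>\<^sub>k dual G M) triv"
    and "ev_mat (mdim M) \<in> Hom_kG G (dual G M \<otimes>\<^sub>k M) triv"
  using act_carrier[OF M] act_carrier[OF kG_module_dual[OF M]] act_dual_mult[OF M]
  by (auto intro!: HomI simp: act_tensor ev_mat_mult_kron triv_def)

lemma coev_Hom:
  assumes M: "kG_module G M"
  shows "coev_mat (mdim M) \<in> Hom_kG G triv (M \<otimes>\<^sub>k dual G M)"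
    and "coev_mat (mdim M) \<in> Hom_kG G triv (dual G M \<otimes>\<^sub>k M)"
  using act_carrier[OF M] act_carrier[OF kG_module_dual[OF M]] act_dual_mult[OF M]
  by (auto intro!: HomI simp: act_tensor kron_mult_coev_mat triv_def)

end


section \<open>Kernels and surjections\<close>

lemma is_kernelD:
  assumes "is_kernel G M f K \<iota>"
  shows "kG_module G K" "\<iota> \<in> Hom_kG G K M"
  using assms by (auto simp: is_kernel_def)

lemma kernel_comp_zero:
  fixes f :: "'k::field mat"
  assumes K: "is_kernel G M f K \<iota>" and f: "f \<in> Hom_kG G M N"
  shows "f * \<iota> = 0\<^sub>m (mdim N) (mdim K)"
proof (rule mat_eq_if_mult_vec_eq)
  fix v :: "'k vec" assume v: "v \<in> carrier_vec (mdim K)"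
  have \<iota>: "\<iota> \<in> Hom_kG G K M" using K by (rule is_kernelD)
  hence "\<iota> *\<^sub>v v \<in> mat_kernel f" using K v by (auto simp: is_kernel_def mat_range_def Hom_dims)
  hence "f *\<^sub>v (\<iota> *\<^sub>v v) = 0\<^sub>v (mdim N)" using mat_kernelD[OF Hom_carrier[OF f]] by blast
  thus "f * \<iota> *\<^sub>v v = 0\<^sub>m (mdim N) (mdim K) *\<^sub>v v"
    using v by (auto simp: mat_vec_assoc Hom_dims[OF f] Hom_dims[OF \<iota>] intro!: eq_vecI)
qed (use Hom_dims[OF f] Hom_dims[OF is_kernelD(2)[OF K]] in auto)

lemma kernel_cancel:
  assumes K: "is_kernel G M f K \<iota>"
    and "dim_row a = mdim K" "dim_row b = mdim K" and eq: "\<iota> * a = \<iota> * b"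
  shows "a = b"
proof -
  have \<iota>: "\<iota> \<in> Hom_kG G K M" using K by (rule is_kernelD)
  obtain l where l: "l \<in> carrier_mat (mdim K) (mdim M)" "l * \<iota> = 1\<^sub>m (mdim K)"
    using injective_left_inverse[OF Hom_carrier[OF \<iota>]] K by (auto simp: is_kernel_def)
  have "a = l * \<iota> * a" using l assms by simp
  also have "\<dots> = l * \<iota> * b" using l(1) assms(2,3) by (simp add: mat_assoc Hom_dims[OF \<iota>] eq)
  also have "\<dots> = b" using l assms by simp
  finally show ?thesis .
qed

lemma kernel_lift:
  fixes f :: "'k::field mat"
  assumes K: "is_kernel G M f K \<iota>" and f: "f \<in> Hom_kG G M N" and M: "kG_module G M"
    and L: "kG_module G L" and h: "h \<in> Hom_kG G L M" and z: "f * h = 0\<^sub>m (mdim N) (mdim L)"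
  obtains h' where "h' \<in> Hom_kG G L K" "\<iota> * h' = h"
proof -
  have \<iota>: "\<iota> \<in> Hom_kG G K M" and Km: "kG_module G K" using is_kernelD[OF K] by auto
  obtain l where l: "l \<in> carrier_mat (mdim K) (mdim M)" "l * \<iota> = 1\<^sub>m (mdim K)"
    using injective_left_inverse[OF Hom_carrier[OF \<iota>]] K by (auto simp: is_kernel_def)
  note dims = Hom_dims[OF \<iota>] Hom_dims[OF f] Hom_dims[OF h] carrier_matD[OF l(1)]
  have eq: "\<iota> * (l * h) = h"
  proof (rule mat_eq_if_mult_vec_eq[of _ "mdim M" "mdim L"])
    fix v :: "'k vec" assume v: "v \<in> carrier_vec (mdim L)"
    have hv: "h *\<^sub>v v \<in> carrier_vec (mdim M)" by (intro carrier_vecI) (simp add: dims)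
    have "f *\<^sub>v (h *\<^sub>v v) = 0\<^sub>m (mdim N) (mdim L) *\<^sub>v v"
      unfolding z[symmetric] using v by (simp add: mat_vec_assoc dims)
    hence "f *\<^sub>v (h *\<^sub>v v) = 0\<^sub>v (mdim N)" using v by (auto intro!: eq_vecI)
    hence "h *\<^sub>v v \<in> mat_range \<iota>"
      using K mat_kernelI[OF Hom_carrier[OF f] hv] by (simp add: is_kernel_def)
    then obtain w where w: "h *\<^sub>v v = \<iota> *\<^sub>v w" "w \<in> carrier_vec (mdim K)"
      by (auto simp: mat_range_def dims)
    have "\<iota> * (l * h) *\<^sub>v v = \<iota> *\<^sub>v (l *\<^sub>v (h *\<^sub>v v))" using v by (simp add: mat_vec_assoc dims)
    also have "\<dots> = \<iota> *\<^sub>v ((l * \<iota>) *\<^sub>v w)" unfolding w(1) using w(2) by (simp only: mat_vec_assoc dims carrier_vecD)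
    also have "\<dots> = h *\<^sub>v v" using w l(2) by simp
    finally show "\<iota> * (l * h) *\<^sub>v v = h *\<^sub>v v" .
  qed (simp_all add: dims carrier_matI)
  show thesis
  proof (rule that[OF _ eq], rule HomI)
    fix g assume g: "g \<in> carrier G"
    note d = dims act_dims[OF M g] act_dims[OF Km g] act_dims[OF L g]
    have "\<iota> * (l * h * act L g) = \<iota> * (l * h) * act L g" by (simp add: mat_assoc d)
    also have "\<dots> = act M g * (\<iota> * (l * h))" by (simp add: eq Hom_comm[OF h g])
    also have "\<dots> = act M g * \<iota> * (l * h)" by (simp add: mat_assoc d)
    also have "\<dots> = \<iota> * act K g * (l * h)" by (simp add: Hom_comm[OF \<iota> g])
    also have "\<dots> = \<iota> * (act K g * (l * h))" by (simp add: mat_assoc d)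
    finally show "l * h * act L g = act K g * (l * h)"
      by (rule kernel_cancel[OF K, rotated 2]) (simp_all add: d)
  qed (simp_all add: dims)
qed

lemma kernel_exists:
  assumes M: "kG_module G M" and N: "kG_module G N" and f: "f \<in> Hom_kG G M N" and "group G"
  obtains K \<iota> where "is_kernel G M f K \<iota>"
proof -
  interpret group G by fact
  let ?m = "mdim M" and ?n = "mdim N"
  obtain r \<iota> l h where \<iota>: "\<iota> \<in> carrier_mat ?m r" and l: "l \<in> carrier_mat r ?m"
    and h: "h \<in> carrier_mat ?m ?n" and f\<iota>: "f * \<iota> = 0\<^sub>m ?n r" and l\<iota>: "l * \<iota> = 1\<^sub>m r"
    and split: "1\<^sub>m ?m = \<iota> * l + h * f"
    using kernel_splitting[OF Hom_carrier[OF f]] by blast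
  note dims = carrier_matD[OF \<iota>] carrier_matD[OF l] carrier_matD[OF h] Hom_dims[OF f]
  \<comment> \<open>Whatever \<open>f\<close> kills is fixed by the projection \<open>\<iota> l\<close>.\<close>
  have fix_mat: "\<iota> * (l * a) = a" if a: "a \<in> carrier_mat ?m c" and "f * a = 0\<^sub>m ?n c" for a c
  proof -
    have "a = (\<iota> * l + h * f) * a" unfolding split[symmetric] using a by simp
    also have "\<dots> = \<iota> * l * a + h * f * a"
      by (rule add_mult_distrib_mat[OF _ _ a]; rule carrier_matI; simp add: dims)
    also have "h * f * a = h * (f * a)" using a by (simp add: mat_assoc dims)
    also have "\<dots> = 0\<^sub>m ?m c" using that h by simp
    also have "\<iota> * l * a + \<dots> = \<iota> * l * a"
      using a by (intro right_add_zero_mat carrier_matI) (simp_all add: dims)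
    finally show ?thesis using a by (simp add: mat_assoc dims)
  qed
  \<comment> \<open>The action on \<open>M\<close>, compressed to the kernel along \<open>\<iota>\<close> and its retraction \<open>l\<close>.\<close>
  define K where "K = \<lparr> mdim = r, act = (\<lambda>g. l * (act M g * \<iota>)) \<rparr>"
  have [simp]: "mdim K = r" by (simp add: K_def)
  have stable: "\<iota> * (l * (act M g * \<iota>)) = act M g * \<iota>" if g: "g \<in> carrier G" for g
  proof (rule fix_mat)
    have "f * (act M g * \<iota>) = act N g * (f * \<iota>)"
      using Hom_comm[OF f g]
      by (simp add: mat_assoc[symmetric] dims act_dims[OF M g] act_dims[OF N g])
    thus "f * (act M g * \<iota>) = 0\<^sub>m ?n r" using act_carrier[OF N g] by (simp add: f\<iota>)
  qed (rule carrier_matI; simp add: dims act_dims[OF M g])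
  have "kG_module G K" unfolding kG_module_def
  proof (intro conjI ballI)
    fix g assume g: "g \<in> carrier G"
    show "act K g \<in> carrier_mat (mdim K) (mdim K)"
      by (rule carrier_matI) (simp_all add: K_def dims)
    fix g' assume g': "g' \<in> carrier G"
    note d = dims act_dims[OF M g] act_dims[OF M g']
    have "act K g * act K g' = l * (act M g * (\<iota> * (l * (act M g' * \<iota>))))"
      by (simp add: K_def mat_assoc d)
    also have "\<dots> = act K (g \<otimes>\<^bsub>G\<^esub> g')"
      unfolding stable[OF g'] by (simp add: K_def act_mult[OF M g g'] mat_assoc d)
    finally show "act K (g \<otimes>\<^bsub>G\<^esub> g') = act K g * act K g'" by simp
  qed (use l\<iota> \<iota> in \<open>simp add: K_def act_one[OF M]\<close>)
  moreover have "\<iota> \<in> Hom_kG G K M"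
    by (rule HomI) (simp_all add: dims, simp add: K_def stable)
  moreover have "mat_kernel \<iota> = {0\<^sub>v (mdim K)}"
  proof -
    have "v = 0\<^sub>v r" if "v \<in> carrier_vec r" "\<iota> *\<^sub>v v = 0\<^sub>v ?m" for v
    proof -
      have "v = l * \<iota> *\<^sub>v v" using l\<iota> that by simp
      also have "\<dots> = l *\<^sub>v 0\<^sub>v ?m" using that by (simp only: mat_vec_assoc dims carrier_vecD)
      finally show ?thesis using l by (auto intro!: eq_vecI)
    qed
    moreover have "0\<^sub>v r \<in> mat_kernel \<iota>" using \<iota> by (intro mat_kernelI[OF \<iota>]) (auto intro!: eq_vecI)
    ultimately show ?thesis using mat_kernelD[OF \<iota>] by auto
  qed
  moreover have "mat_range \<iota> = mat_kernel f"
  proof (intro equalityI subsetI)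
    fix v assume "v \<in> mat_range \<iota>"
    then obtain w where w: "w \<in> carrier_vec r" "v = \<iota> *\<^sub>v w" by (auto simp: mat_range_def dims)
    have "f *\<^sub>v v = f * \<iota> *\<^sub>v w" using w by (simp only: mat_vec_assoc dims carrier_vecD)
    also have "\<dots> = 0\<^sub>v ?n" unfolding f\<iota> using w by (auto intro!: eq_vecI)
    finally show "v \<in> mat_kernel f"
      by (intro mat_kernelI[OF Hom_carrier[OF f]]) (auto simp: w dims intro!: carrier_vecI)
  next
    fix v assume "v \<in> mat_kernel f"
    hence v: "v \<in> carrier_vec ?m" "f *\<^sub>v v = 0\<^sub>v ?n" using mat_kernelD[OF Hom_carrier[OF f]] by auto
    have "v = (\<iota> * l + h * f) *\<^sub>v v" unfolding split[symmetric] using v by simp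
    also have "\<dots> = \<iota> * l *\<^sub>v v + h * f *\<^sub>v v"
      by (rule add_mult_distrib_mat_vec[OF _ _ v(1)]; rule carrier_matI; simp add: dims)
    also have "h * f *\<^sub>v v = h *\<^sub>v (f *\<^sub>v v)" using v by (simp only: mat_vec_assoc dims carrier_vecD)
    also have "\<dots> = 0\<^sub>v ?m" using v h by (auto intro!: eq_vecI)
    also have "\<iota> * l *\<^sub>v v = \<iota> *\<^sub>v (l *\<^sub>v v)" using v by (simp only: mat_vec_assoc dims carrier_vecD)
    also have "\<dots> + 0\<^sub>v ?m = \<iota> *\<^sub>v (l *\<^sub>v v)" by (rule right_zero_vec) (auto simp: dims intro!: carrier_vecI)
    finally show "v \<in> mat_range \<iota>"
      by (auto simp: mat_range_def dims intro!: exI[of _ "l *\<^sub>v v"] carrier_vecI)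
  qed
  ultimately have "is_kernel G M f K \<iota>" by (simp add: is_kernel_def)
  thus thesis by (rule that)
qed

lemma surjective_cancel:
  assumes surj: "mat_range p = carrier_vec m" and p: "p \<in> carrier_mat m n"
    and "dim_col a = m" "dim_col b = m" and eq: "a * p = b * p"
  shows "a = b"
proof -
  obtain s where s: "s \<in> carrier_mat n m" "p * s = 1\<^sub>m m"
    using surjective_right_inverse[OF p surj] by blast
  note dims = carrier_matD[OF p] carrier_matD[OF s(1)]
  have "a * p * s = b * p * s" by (simp add: eq)
  thus ?thesis using assms(3,4) by (simp add: mat_assoc dims s(2))
qed

lemma cokernel_factor:
  fixes f :: "'k::field mat"
  assumes K: "is_kernel G P p K \<iota>" and p: "p \<in> Hom_kG G P M"
    and surj: "mat_range p = carrier_vec (mdim M)"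
    and P: "kG_module G P" and M: "kG_module G M" and N: "kG_module G N"
    and f: "f \<in> Hom_kG G P N" and z: "f * \<iota> = 0\<^sub>m (mdim N) (mdim K)"
  obtains f' where "f' \<in> Hom_kG G M N" "f' * p = f"
proof -
  have \<iota>: "\<iota> \<in> Hom_kG G K P" using is_kernelD[OF K] by auto
  obtain s where s: "s \<in> carrier_mat (mdim P) (mdim M)" "p * s = 1\<^sub>m (mdim M)"
    using surjective_right_inverse[OF Hom_carrier[OF p] surj] by blast
  note dims = carrier_matD[OF s(1)] Hom_dims[OF p] Hom_dims[OF f] Hom_dims[OF \<iota>]
  have eq: "f * s * p = f"
  proof (rule mat_eq_if_mult_vec_eq[of _ "mdim N" "mdim P"])
    fix v :: "'k vec" assume v: "v \<in> carrier_vec (mdim P)"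
    let ?x = "s *\<^sub>v (p *\<^sub>v v)"
    have x: "?x \<in> carrier_vec (mdim P)" by (intro carrier_vecI) (simp add: dims)
    have pv: "p *\<^sub>v v \<in> carrier_vec (mdim M)" by (intro carrier_vecI) (simp add: dims)
    have "p *\<^sub>v (?x - v) = p *\<^sub>v ?x - p *\<^sub>v v"
      by (rule mult_minus_distrib_mat_vec[OF Hom_carrier[OF p] x v])
    also have "p *\<^sub>v ?x = p * s *\<^sub>v (p *\<^sub>v v)" by (simp add: mat_vec_assoc dims)
    also have "\<dots> = p *\<^sub>v v" using pv s(2) by simp
    finally have "p *\<^sub>v (?x - v) = 0\<^sub>v (mdim M)" using pv by simp
    hence "?x - v \<in> mat_range \<iota>"
      using K mat_kernelI[OF Hom_carrier[OF p], of "?x - v"] x v by (simp add: is_kernel_def)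
    then obtain w where w: "?x - v = \<iota> *\<^sub>v w" "w \<in> carrier_vec (mdim K)"
      by (auto simp: mat_range_def dims)
    have "f *\<^sub>v ?x - f *\<^sub>v v = f *\<^sub>v (?x - v)"
      by (rule mult_minus_distrib_mat_vec[OF Hom_carrier[OF f] x v, symmetric])
    also have "\<dots> = f * \<iota> *\<^sub>v w" unfolding w(1) using w(2) by (simp only: mat_vec_assoc dims carrier_vecD)
    also have "\<dots> = 0\<^sub>v (mdim N)" unfolding z using w(2) by (auto intro!: eq_vecI)
    finally have "f *\<^sub>v ?x - f *\<^sub>v v = 0\<^sub>v (mdim N)" .
    hence "(f *\<^sub>v ?x - f *\<^sub>v v) $ i = 0" if "i < mdim N" for i using that by simp
    hence "f *\<^sub>v ?x = f *\<^sub>v v" by (intro eq_vecI) (simp_all add: dims del: index_mult_mat_vec)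
    thus "f * s * p *\<^sub>v v = f *\<^sub>v v" using v by (simp add: mat_vec_assoc dims)
  qed (simp_all add: dims carrier_matI)
  show thesis
  proof (rule that[OF _ eq], rule HomI)
    fix g assume g: "g \<in> carrier G"
    note d = dims act_dims[OF M g] act_dims[OF P g] act_dims[OF N g]
    have "f * s * act M g * p = f * s * (p * act P g)"
      by (simp add: mat_assoc d Hom_comm[OF p g])
    also have "\<dots> = f * s * p * act P g" by (simp add: mat_assoc d)
    also have "\<dots> = act N g * (f * s * p)" unfolding eq by (rule Hom_comm[OF f g])
    also have "\<dots> = act N g * (f * s) * p" by (simp add: mat_assoc d)
    finally show "f * s * act M g = act N g * (f * s)"
      by (rule surjective_cancel[OF surj Hom_carrier[OF p], rotated 2]) (simp_all add: d)
  qed (simp_all add: dims)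
qed

section \<open>Projectivity of the free cover\<close>

text \<open>
  The sum of a family of \<open>r \<times> c\<close> matrices; the dimensions are arguments because matrices of all
  dimensions form one type, which has no zero.
\<close>

definition mat_sum :: "nat \<Rightarrow> nat \<Rightarrow> ('a \<Rightarrow> 'k::field mat) \<Rightarrow> 'a set \<Rightarrow> 'k mat" where
  "mat_sum r c F S = mat r c (\<lambda>(i, j). \<Sum>s\<in>S. F s $$ (i, j))"

lemma dim_mat_sum [simp]: "dim_row (mat_sum r c F S) = r" "dim_col (mat_sum r c F S) = c"
  by (simp_all add: mat_sum_def)

lemma mat_sum_cong: "(\<And>s. s \<in> S \<Longrightarrow> F s = F' s) \<Longrightarrow> mat_sum r c F S = mat_sum r c F' S"
  by (simp add: mat_sum_def cong: sum.cong)

lemma mat_sum_reindex_bij: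
  assumes "bij_betw t S S"
  shows "mat_sum r c (\<lambda>s. F (t s)) S = mat_sum r c F S"
proof -
  have "(\<Sum>s\<in>S. F (t s) $$ ij) = (\<Sum>s\<in>S. F s $$ ij)" for ij
    by (rule sum.reindex_bij_betw[OF assms])
  thus ?thesis by (simp add: mat_sum_def)
qed

lemma mult_mat_sum:
  assumes "A \<in> carrier_mat q r" "\<And>s. s \<in> S \<Longrightarrow> F s \<in> carrier_mat r c"
  shows "A * mat_sum r c F S = mat_sum q c (\<lambda>s. A * F s) S"
proof (rule eq_matI)
  fix i j assume "i < dim_row (mat_sum q c (\<lambda>s. A * F s) S)" "j < dim_col (mat_sum q c (\<lambda>s. A * F s) S)"
  hence i: "i < q" and j: "j < c" by auto
  have "(A * mat_sum r c F S) $$ (i, j) = (\<Sum>k<r. \<Sum>s\<in>S. A $$ (i, k) * F s $$ (k, j))"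
    using i j assms(1) by (subst index_mult_mat_sum) (auto simp: mat_sum_def sum_distrib_left)
  also have "\<dots> = (\<Sum>s\<in>S. \<Sum>k<r. A $$ (i, k) * F s $$ (k, j))" by (rule sum.swap)
  also have "\<dots> = (\<Sum>s\<in>S. (A * F s) $$ (i, j))"
  proof (rule sum.cong[OF refl])
    fix s assume "s \<in> S"
    thus "(\<Sum>k<r. A $$ (i, k) * F s $$ (k, j)) = (A * F s) $$ (i, j)"
      using i j assms(1) assms(2)[of s] by (subst index_mult_mat_sum) auto
  qed
  finally show "(A * mat_sum r c F S) $$ (i, j) = mat_sum q c (\<lambda>s. A * F s) S $$ (i, j)"
    using i j by (simp add: mat_sum_def)
qed (use assms in auto)

lemma mat_sum_mult:
  assumes "A \<in> carrier_mat c q" "\<And>s. s \<in> S \<Longrightarrow> F s \<in> carrier_mat r c"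
  shows "mat_sum r c F S * A = mat_sum r q (\<lambda>s. F s * A) S"
proof (rule eq_matI)
  fix i j assume "i < dim_row (mat_sum r q (\<lambda>s. F s * A) S)" "j < dim_col (mat_sum r q (\<lambda>s. F s * A) S)"
  hence i: "i < r" and j: "j < q" by auto
  have "(mat_sum r c F S * A) $$ (i, j) = (\<Sum>k<c. \<Sum>s\<in>S. F s $$ (i, k) * A $$ (k, j))"
    using i j assms(1) by (subst index_mult_mat_sum) (auto simp: mat_sum_def sum_distrib_right)
  also have "\<dots> = (\<Sum>s\<in>S. \<Sum>k<c. F s $$ (i, k) * A $$ (k, j))" by (rule sum.swap)
  also have "\<dots> = (\<Sum>s\<in>S. (F s * A) $$ (i, j))"
  proof (rule sum.cong[OF refl])
    fix s assume "s \<in> S"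
    thus "(\<Sum>k<c. F s $$ (i, k) * A $$ (k, j)) = (F s * A) $$ (i, j)"
      using i j assms(1) assms(2)[of s] by (subst index_mult_mat_sum) auto
  qed
  finally show "(mat_sum r c F S * A) $$ (i, j) = mat_sum r q (\<lambda>s. F s * A) S $$ (i, j)"
    using i j by (simp add: mat_sum_def)
qed (use assms in auto)

lemma (in group) mult_left_bij: "h \<in> carrier G \<Longrightarrow> bij_betw (\<lambda>g. h \<otimes> g) (carrier G) (carrier G)"
  by (rule bij_betw_byWitness[where f' = "\<lambda>g. inv h \<otimes> g"]) (auto simp: m_assoc[symmetric])

text \<open>
  Higman's criterion, in the direction needed here: if the identity of \<open>M\<close> is the sum of the
  conjugates \<open>\<theta>\<^sub>g\<close> of one linear map \<open>\<theta>\<^sub>1\<close>, then a linear lift \<open>\<sigma> f\<close> of a homomorphism \<open>f\<close> can be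
  made equivariant by averaging it against the \<open>\<theta>\<^sub>g\<close>.
\<close>

lemma (in group) projective_if_trace_one:
  assumes M: "kG_module G M"
    and \<theta>: "\<And>g. g \<in> carrier G \<Longrightarrow> \<theta> g \<in> carrier_mat (mdim M) (mdim M)"
    and conj: "\<And>g h. g \<in> carrier G \<Longrightarrow> h \<in> carrier G \<Longrightarrow> act M h * \<theta> g = \<theta> (h \<otimes> g) * act M h"
    and one: "mat_sum (mdim M) (mdim M) \<theta> (carrier G) = 1\<^sub>m (mdim M)"
  shows "projective_kG G M"
  unfolding projective_kG_def
proof (intro conjI M allI impI)
  fix A B p f
  assume "kG_module G A \<and> kG_module G B \<and> p \<in> Hom_kG G A B \<and>
    mat_range p = carrier_vec (mdim B) \<and> f \<in> Hom_kG G M B"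
  hence A: "kG_module G A" and B: "kG_module G B" and p: "p \<in> Hom_kG G A B"
    and surj: "mat_range p = carrier_vec (mdim B)" and f: "f \<in> Hom_kG G M B" by auto
  obtain \<sigma> where \<sigma>: "\<sigma> \<in> carrier_mat (mdim A) (mdim B)" "p * \<sigma> = 1\<^sub>m (mdim B)"
    using surjective_right_inverse[OF Hom_carrier[OF p] surj] by blast
  define F where "F g = act A g * \<sigma> * f * act M (inv g) * \<theta> g" for g
  define s where "s = mat_sum (mdim A) (mdim M) F (carrier G)"
  note dims = Hom_dims[OF p] Hom_dims[OF f] carrier_matD[OF \<sigma>(1)]
  have d: "dim_row (act A g) = mdim A" "dim_col (act A g) = mdim A"
      "dim_row (act B g) = mdim B" "dim_col (act B g) = mdim B"
      "dim_row (act M g) = mdim M" "dim_col (act M g) = mdim M"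
      "dim_row (\<theta> g) = mdim M" "dim_col (\<theta> g) = mdim M" if "g \<in> carrier G" for g
    using that A B M \<theta>[OF that] by (auto simp: act_dims)
  have F: "F g \<in> carrier_mat (mdim A) (mdim M)" if "g \<in> carrier G" for g
    using that by (intro carrier_matI) (simp_all add: F_def d)
  have "p * F g = f * \<theta> g" if g: "g \<in> carrier G" for g
  proof -
    have "p * F g = p * act A g * (\<sigma> * f * act M (inv g) * \<theta> g)"
      using g by (simp add: F_def mat_assoc d dims)
    also have "\<dots> = act B g * (p * \<sigma>) * f * act M (inv g) * \<theta> g"
      using g by (simp add: Hom_comm[OF p] mat_assoc d dims del: \<sigma>(2))
    also have "\<dots> = act B g * f * act M (inv g) * \<theta> g"
      unfolding \<sigma>(2) using g by (simp add: d)
    also have "\<dots> = f * (act M g * act M (inv g)) * \<theta> g"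
      using g by (simp add: Hom_comm[OF f, symmetric] mat_assoc d dims)
    also have "\<dots> = f * \<theta> g"
      using act_inv_mult(2)[OF M g] by (simp add: dims)
    finally show ?thesis .
  qed
  hence "p * s = mat_sum (mdim B) (mdim M) (\<lambda>g. f * \<theta> g) (carrier G)"
    unfolding s_def using F by (subst mult_mat_sum[OF Hom_carrier[OF p]]) (auto cong: mat_sum_cong)
  also have "\<dots> = f * mat_sum (mdim M) (mdim M) \<theta> (carrier G)"
    using \<theta> by (subst mult_mat_sum[OF Hom_carrier[OF f]]) auto
  finally have ps: "p * s = f" using one dims by simp
  have "s \<in> Hom_kG G M A"
  proof (rule HomI)
    fix h assume h: "h \<in> carrier G"
    have *: "act A h * F g = F (h \<otimes> g) * act M h" if g: "g \<in> carrier G" for g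
    proof -
      have inv: "act M (inv (h \<otimes> g)) = act M (inv g) * act M (inv h)"
        using g h M by (simp add: inv_mult_group act_mult)
      have "F (h \<otimes> g) * act M h = act A h * act A g * \<sigma> * f * (act M (inv g) * act M (inv h)) *
          (\<theta> (h \<otimes> g) * act M h)"
        using g h by (simp add: F_def inv act_mult[OF A] mat_assoc d dims)
      also have "\<dots> = act A h * act A g * \<sigma> * f * (act M (inv g) * act M (inv h)) *
          (act M h * \<theta> g)"
        using g h by (simp add: conj)
      also have "\<dots> = act A h * (act A g * \<sigma> * f * act M (inv g) * (act M (inv h) * act M h) * \<theta> g)"
        using g h by (simp add: mat_assoc d dims)
      also have "\<dots> = act A h * F g"
        unfolding act_inv_mult(1)[OF M h] using g h by (simp add: F_def d)
      finally show ?thesis by simp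
    qed
    have "act A h * s = mat_sum (mdim A) (mdim M) (\<lambda>g. act A h * F g) (carrier G)"
      unfolding s_def using F by (subst mult_mat_sum[OF act_carrier[OF A h]]) auto
    also have "\<dots> = mat_sum (mdim A) (mdim M) (\<lambda>g. F (h \<otimes> g) * act M h) (carrier G)"
      using * by (rule mat_sum_cong)
    also have "\<dots> = mat_sum (mdim A) (mdim M) (\<lambda>g. F g * act M h) (carrier G)"
      by (rule mat_sum_reindex_bij[OF mult_left_bij[OF h], of _ _ "\<lambda>g. F g * act M h"])
    also have "\<dots> = s * act M h"
      unfolding s_def using F by (subst mat_sum_mult[OF act_carrier[OF M h]]) auto
    finally show "s * act M h = act A h * s" by simp
  qed (simp_all add: s_def)
  thus "\<exists>h\<in>Hom_kG G M A. p * h = f" using ps by blast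
qed

text \<open>
  The regular module, and with it the free cover, satisfies this criterion: \<open>\<theta>\<^sub>g\<close> is the projection
  of the regular factor onto its basis vector \<open>g\<close>.
\<close>

locale fin_group = group +
  assumes fin: "finite (carrier G)"
begin

lemma group_enum_bij: "bij_betw (group_enum G) {0..<Coset.order G} (carrier G)"
  unfolding group_enum_def Coset.order_def
  by (rule someI_ex[OF ex_bij_betw_nat_finite[OF fin]])

lemma group_enum_closed: "i < Coset.order G \<Longrightarrow> group_enum G i \<in> carrier G"
  using group_enum_bij by (auto simp: bij_betw_def)

lemma group_enum_inj: "i < Coset.order G \<Longrightarrow> j < Coset.order G \<Longrightarrow> group_enum G i = group_enum G j \<longleftrightarrow> i = j"
  using group_enum_bij by (auto simp: bij_betw_def inj_on_def)

lemma order_pos: "0 < Coset.order G"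
  using fin one_closed by (auto simp: Coset.order_def card_gt_0_iff)

lemma mdim_regular [simp]: "mdim (regular G) = Coset.order G"
  by (simp add: regular_def)

lemma index_regular:
  "i < Coset.order G \<Longrightarrow> j < Coset.order G \<Longrightarrow>
    act (regular G) g $$ (i, j) = (if group_enum G i = g \<otimes> group_enum G j then 1 else 0)"
  by (simp add: regular_def)

lemma dim_regular [simp]:
  "dim_row (act (regular G) g) = Coset.order G" "dim_col (act (regular G) g) = Coset.order G"
  by (simp_all add: regular_def)

lemma kG_module_regular: "kG_module G (regular G :: ('a, 'k::field) kG_rep)"
  unfolding kG_module_def
proof (intro conjI ballI)
  let ?R = "regular G :: ('a, 'k) kG_rep"
  show "act ?R \<one> = 1\<^sub>m (mdim ?R)"
    by (rule eq_matI) (auto simp: index_regular group_enum_closed group_enum_inj)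
  fix g assume g: "g \<in> carrier G"
  show "act ?R g \<in> carrier_mat (mdim ?R) (mdim ?R)" by (rule carrier_matI) auto
  fix h assume h: "h \<in> carrier G"
  show "act ?R (g \<otimes> h) = act ?R g * act ?R h"
  proof (rule eq_matI)
    fix i j assume "i < dim_row (act ?R g * act ?R h)" "j < dim_col (act ?R g * act ?R h)"
    hence i: "i < Coset.order G" and j: "j < Coset.order G" by auto
    let ?x = "h \<otimes> group_enum G j"
    have x: "?x \<in> carrier G" using h j by (simp add: group_enum_closed)
    have "(act ?R g * act ?R h) $$ (i, j) =
        (\<Sum>k<Coset.order G. act ?R g $$ (i, k) * act ?R h $$ (k, j))"
      using i j by (subst index_mult_mat_sum) auto
    also have "\<dots> = (\<Sum>k\<in>{0..<Coset.order G}. (\<lambda>y. if y = ?x then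
        (if group_enum G i = g \<otimes> y then 1 else 0) else 0) (group_enum G k))"
      using i j by (intro sum.cong) (auto simp: index_regular)
    also have "\<dots> = (\<Sum>y\<in>carrier G. if y = ?x then (if group_enum G i = g \<otimes> y then 1 else 0) else 0)"
      by (rule sum.reindex_bij_betw[OF group_enum_bij])
    also have "\<dots> = act ?R (g \<otimes> h) $$ (i, j)"
      using x g h i j fin by (simp add: index_regular m_assoc group_enum_closed)
    finally show "act ?R (g \<otimes> h) $$ (i, j) = (act ?R g * act ?R h) $$ (i, j)" by simp
  qed auto
qed

text \<open>The projection of the regular module onto the line spanned by \<open>g\<close>.\<close>

definition regular_proj :: "'a \<Rightarrow> 'k::field mat" where
  "regular_proj g = mat (Coset.order G) (Coset.order G) (\<lambda>(i, j). if i = j \<and> group_enum G i = g then 1 else 0)"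

lemma dim_regular_proj [simp]:
  "dim_row (regular_proj g) = Coset.order G" "dim_col (regular_proj g) = Coset.order G"
  by (simp_all add: regular_proj_def)

lemma regular_proj_conj:
  assumes g: "g \<in> carrier G" and h: "h \<in> carrier G"
  shows "act (regular G) h * (regular_proj g :: 'k::field mat) = regular_proj (h \<otimes> g) * act (regular G) h"
proof (rule eq_matI)
  fix i j assume "i < dim_row (regular_proj (h \<otimes> g) * act (regular G) h :: 'k mat)"
    "j < dim_col (regular_proj (h \<otimes> g) * act (regular G) h :: 'k mat)"
  hence i: "i < Coset.order G" and j: "j < Coset.order G" by auto
  let ?a = "act (regular G) h :: 'k mat"
  have "(?a * regular_proj g) $$ (i, j) = (\<Sum>k<Coset.order G. ?a $$ (i, k) * regular_proj g $$ (k, j))"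
    using i j by (subst index_mult_mat_sum) auto
  also have "\<dots> = (\<Sum>k<Coset.order G. if k = j then ?a $$ (i, j) * (if group_enum G j = g then 1 else 0) else 0)"
    using j by (intro sum.cong) (auto simp: regular_proj_def)
  also have "\<dots> = ?a $$ (i, j) * (if group_enum G j = g then 1 else 0)" using j by simp
  finally have 1: "(?a * regular_proj g) $$ (i, j) = \<dots>" .
  have "(regular_proj (h \<otimes> g) * ?a) $$ (i, j) =
      (\<Sum>k<Coset.order G. regular_proj (h \<otimes> g) $$ (i, k) * ?a $$ (k, j))"
    using i j by (subst index_mult_mat_sum) auto
  also have "\<dots> = (\<Sum>k<Coset.order G. if k = i then (if group_enum G i = h \<otimes> g then 1 else 0) * ?a $$ (i, j) else 0)"
    using i by (intro sum.cong) (auto simp: regular_proj_def)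
  also have "\<dots> = (if group_enum G i = h \<otimes> g then 1 else 0) * ?a $$ (i, j)" using i by simp
  finally show "(?a * regular_proj g) $$ (i, j) = (regular_proj (h \<otimes> g) * ?a) $$ (i, j)"
    using 1 i j g h by (auto simp: index_regular group_enum_closed)
qed auto

lemma regular_proj_sum:
  assumes i: "i < Coset.order G" and j: "j < Coset.order G"
  shows "(\<Sum>g\<in>carrier G. regular_proj g $$ (i, j)) = (if i = j then 1 else 0 :: 'k::field)"
proof -
  have "(\<Sum>g\<in>carrier G. regular_proj g $$ (i, j)) =
      (\<Sum>g\<in>carrier G. if g = group_enum G i then (if i = j then 1 else 0) else (0 :: 'k))"
    using i j by (intro sum.cong) (auto simp: regular_proj_def)
  thus ?thesis using i fin by (simp add: group_enum_closed)
qed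

lemma kG_module_free_cover: "kG_module G X \<Longrightarrow> kG_module G (free_cover G X)"
  unfolding free_cover_def by (intro kG_module_tensor kG_module_dual kG_module_regular)

lemma mdim_free_cover: "mdim (free_cover G X) = Coset.order G * Coset.order G * mdim X"
  by (simp add: free_cover_def)

lemma projective_free_cover:
  fixes X :: "('a, 'k::field) kG_rep"
  assumes X: "kG_module G X"
  shows "projective_kG G (free_cover G X)"
proof (rule projective_if_trace_one)
  let ?n = "Coset.order G" and ?D = "dual G (regular G) :: ('a, 'k) kG_rep"
  define \<theta> where "\<theta> g = kron (kron (1\<^sub>m ?n) (regular_proj g)) (1\<^sub>m (mdim X) :: 'k mat)" for g
  show "\<theta> g \<in> carrier_mat (mdim (free_cover G X)) (mdim (free_cover G X))" for g
    by (rule carrier_matI) (simp_all add: \<theta>_def mdim_free_cover)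
  have D: "kG_module G ?D" by (intro kG_module_dual kG_module_regular)
  show "act (free_cover G X) h * \<theta> g = \<theta> (h \<otimes> g) * act (free_cover G X) h"
    if g: "g \<in> carrier G" and h: "h \<in> carrier G" for g h
    using act_dims[OF X h] act_dims[OF D h]
    by (simp add: \<theta>_def free_cover_def act_tensor kron_mult_kron regular_proj_conj[OF g h])
  show "mat_sum (mdim (free_cover G X)) (mdim (free_cover G X)) \<theta> (carrier G) =
      1\<^sub>m (mdim (free_cover G X))"
  proof (rule eq_matI)
    fix i j
    assume "i < dim_row (1\<^sub>m (mdim (free_cover G X)) :: 'k mat)"
      "j < dim_col (1\<^sub>m (mdim (free_cover G X)) :: 'k mat)"
    hence i: "i < ?n * ?n * mdim X" and j: "j < ?n * ?n * mdim X" by (auto simp: mdim_free_cover)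
    let ?x = "mdim X"
    note b = div_less_mult[OF i] div_less_mult[OF j] mod_less_mult[OF i] mod_less_mult[OF j]
    note b' = div_less_mult[OF b(1)] div_less_mult[OF b(2)] mod_less_mult[OF b(1)] mod_less_mult[OF b(2)]
    have "\<theta> g $$ (i, j) = (if i div ?x div ?n = j div ?x div ?n then 1 else 0) *
        regular_proj g $$ (i div ?x mod ?n, j div ?x mod ?n) *
        (if i mod ?x = j mod ?x then 1 else 0)" for g
      using i j b b' by (simp add: \<theta>_def index_kron)
    hence "(\<Sum>g\<in>carrier G. \<theta> g $$ (i, j)) = (if i div ?x div ?n = j div ?x div ?n then 1 else 0) *
        (\<Sum>g\<in>carrier G. regular_proj g $$ (i div ?x mod ?n, j div ?x mod ?n)) *
        (if i mod ?x = j mod ?x then 1 else 0)"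
      by (simp only: sum_distrib_left sum_distrib_right)
    also have "\<dots> = (if i = j then 1 else 0)"
      using b' by (simp add: regular_proj_sum pair_eq_iff[of i j ?x]
          pair_eq_iff[of "i div ?x" "j div ?x" ?n])
    finally show "mat_sum (mdim (free_cover G X)) (mdim (free_cover G X)) \<theta> (carrier G) $$ (i, j) =
        1\<^sub>m (mdim (free_cover G X)) $$ (i, j)"
      using i j by (simp add: mat_sum_def mdim_free_cover)
  qed simp_all
qed (rule kG_module_free_cover[OF X])

lemma free_cover_map_Hom:
  fixes X :: "('a, 'k::field) kG_rep"
  assumes X: "kG_module G X"
  shows "free_cover_map G X \<in> Hom_kG G (free_cover G X) X"
proof -
  let ?R = "regular G :: ('a, 'k) kG_rep"
  have R: "kG_module G ?R" by (rule kG_module_regular)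
  have "kron (ev_mat (mdim ?R)) (1\<^sub>m (mdim X)) \<in> Hom_kG G (dual G ?R \<otimes>\<^sub>k ?R \<otimes>\<^sub>k X) (triv \<otimes>\<^sub>k X)"
    by (intro Hom_kron kG_module_tensor kG_module_dual R X kG_module_triv ev_Hom(2)[OF R] Hom_one)
  thus ?thesis by (simp add: free_cover_def free_cover_map_def)
qed

end

lemma ev_mat_right_inverse:
  assumes "0 < n"
  shows "ev_mat n * mat (n * n) (Suc 0) (\<lambda>(i, j). if i = 0 then 1 else 0) = 1\<^sub>m (Suc 0)"
proof (rule eq_matI)
  let ?e = "mat (n * n) (Suc 0) (\<lambda>(i, j). if i = 0 then 1 else 0) :: 'a mat"
  fix i j assume "i < dim_row (1\<^sub>m (Suc 0) :: 'a mat)" "j < dim_col (1\<^sub>m (Suc 0) :: 'a mat)"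
  hence ij: "i = 0" "j = 0" by auto
  have "(ev_mat n * ?e) $$ (0, 0) = (\<Sum>k<n * n. ev_mat n $$ (0, k) * ?e $$ (k, 0))"
    by (subst index_mult_mat_sum) auto
  also have "\<dots> = (\<Sum>k<n * n. if k = 0 then 1 else 0)"
    by (intro sum.cong) (auto simp: ev_mat_def)
  finally show "(ev_mat n * ?e) $$ (i, j) = 1\<^sub>m (Suc 0) $$ (i, j)" using ij assms by simp
qed auto

lemma (in fin_group) free_cover_map_surj:
  "mat_range (free_cover_map G X) = carrier_vec (mdim X)"
proof (rule mat_range_eq_carrier_if_right_inverse)
  let ?e = "mat (Coset.order G * Coset.order G) (Suc 0) (\<lambda>(i, j). if i = 0 then 1 else 0)"
  show "free_cover_map G X * kron ?e (1\<^sub>m (mdim X)) = 1\<^sub>m (mdim X)"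
    unfolding free_cover_map_def
    by (subst kron_mult_kron) (auto simp: ev_mat_right_inverse[OF order_pos])
qed (rule carrier_matI; simp add: free_cover_map_def)+

section \<open>Maps factoring through a relatively projective module\<close>

lemma mdim_dsum [simp]: "mdim (dsum M N) = mdim M + mdim N"
  by (simp add: dsum_def)

lemma kG_module_dsum:
  assumes M: "kG_module G M" and N: "kG_module G N"
  shows "kG_module G (dsum M N)"
  unfolding kG_module_def
proof (intro conjI ballI)
  fix g assume g: "g \<in> carrier G"
  show "act (dsum M N) g \<in> carrier_mat (mdim (dsum M N)) (mdim (dsum M N))"
    using act_carrier[OF M g] act_carrier[OF N g] by (simp add: dsum_def)
  fix h assume h: "h \<in> carrier G"
  note c = act_carrier[OF M g] act_carrier[OF N g] act_carrier[OF M h] act_carrier[OF N h]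
  show "act (dsum M N) (g \<otimes>\<^bsub>G\<^esub> h) = act (dsum M N) g * act (dsum M N) h"
    unfolding dsum_def
    using c by (simp add: act_mult[OF M g h] act_mult[OF N g h]
        mult_four_block_mat[OF c(1) zero_carrier_mat zero_carrier_mat c(2) c(3) zero_carrier_mat
          zero_carrier_mat c(4)] right_add_zero_mat[OF mult_carrier_mat] left_add_zero_mat[OF mult_carrier_mat])
qed (simp add: dsum_def act_one[OF M] act_one[OF N])

lemma dsum_left_split:
  fixes M N :: "('g, 'k::field) kG_rep"
  assumes M: "kG_module G M" and N: "kG_module G N"
  obtains i p where "i \<in> Hom_kG G M (dsum M N)" "p \<in> Hom_kG G (dsum M N) M" "p * i = 1\<^sub>m (mdim M)"
proof -
  let ?m = "mdim M" and ?n = "mdim N"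
  define i :: "'k mat" where "i = mat (?m + ?n) ?m (\<lambda>(a, b). if a = b then 1 else 0)"
  define p :: "'k mat" where "p = mat ?m (?m + ?n) (\<lambda>(a, b). if a = b then 1 else 0)"
  have dim: "dim_row i = ?m + ?n" "dim_col i = ?m" "dim_row p = ?m" "dim_col p = ?m + ?n"
    by (simp_all add: i_def p_def)
  have mult_i: "(A * i) $$ (a, b) = A $$ (a, b)"
    if "a < dim_row A" "b < ?m" "dim_col A = ?m + ?n" for A a b
  proof -
    have "(A * i) $$ (a, b) = (\<Sum>k<dim_row i. A $$ (a, k) * i $$ (k, b))"
      using that by (intro index_mult_mat_sum) (simp_all add: dim)
    also have "\<dots> = (\<Sum>k<?m + ?n. if k = b then A $$ (a, b) else 0)"
      using that by (intro sum.cong) (auto simp: i_def)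
    finally have "(A * i) $$ (a, b) = \<dots>" .
    thus ?thesis using that by simp
  qed
  have i_mult: "(i * A) $$ (a, b) = (if a < ?m then A $$ (a, b) else 0)"
    if "a < ?m + ?n" "b < dim_col A" "dim_row A = ?m" for A a b
  proof -
    have "(i * A) $$ (a, b) = (\<Sum>k<dim_row A. i $$ (a, k) * A $$ (k, b))"
      using that by (intro index_mult_mat_sum) (simp_all add: dim)
    also have "\<dots> = (\<Sum>k<?m. if k = a then A $$ (a, b) else 0)"
      using that by (intro sum.cong) (auto simp: i_def)
    finally have "(i * A) $$ (a, b) = \<dots>" .
    thus ?thesis using that by simp
  qed
  have p_mult: "(p * A) $$ (a, b) = A $$ (a, b)"
    if "a < ?m" "b < dim_col A" "dim_row A = ?m + ?n" for A a b
  proof -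
    have "(p * A) $$ (a, b) = (\<Sum>k<dim_row A. p $$ (a, k) * A $$ (k, b))"
      using that by (intro index_mult_mat_sum) (simp_all add: dim)
    also have "\<dots> = (\<Sum>k<?m + ?n. if k = a then A $$ (a, b) else 0)"
      using that by (intro sum.cong) (auto simp: p_def)
    finally have "(p * A) $$ (a, b) = \<dots>" .
    thus ?thesis using that by simp
  qed
  have mult_p: "(A * p) $$ (a, b) = (if b < ?m then A $$ (a, b) else 0)"
    if "a < dim_row A" "b < ?m + ?n" "dim_col A = ?m" for A a b
  proof -
    have "(A * p) $$ (a, b) = (\<Sum>k<dim_row p. A $$ (a, k) * p $$ (k, b))"
      using that by (intro index_mult_mat_sum) (simp_all add: dim)
    also have "\<dots> = (\<Sum>k<?m. if k = b then A $$ (a, b) else 0)"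
      using that by (intro sum.cong) (auto simp: p_def)
    finally have "(A * p) $$ (a, b) = \<dots>" .
    thus ?thesis using that by simp
  qed
  have "i \<in> Hom_kG G M (dsum M N)"
  proof (rule HomI)
    fix g assume g: "g \<in> carrier G"
    note d = act_dims[OF M g] act_dims[OF N g]
      act_dims[OF kG_module_dsum[OF M N] g, unfolded mdim_dsum]
    have "act (dsum M N) g $$ (a, b) = (if a < ?m then act M g $$ (a, b) else 0)"
      if "a < ?m + ?n" "b < ?m" for a b
      using that d(1-4) by (simp add: dsum_def)
    thus "i * act M g = act (dsum M N) g * i"
      by (intro eq_matI) (simp_all add: d dim mult_i i_mult del: index_mult_mat(1))
  qed (simp_all add: dim)
  moreover have "p \<in> Hom_kG G (dsum M N) M"
  proof (rule HomI)
    fix g assume g: "g \<in> carrier G"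
    note d = act_dims[OF M g] act_dims[OF N g]
      act_dims[OF kG_module_dsum[OF M N] g, unfolded mdim_dsum]
    have "act (dsum M N) g $$ (a, b) = (if b < ?m then act M g $$ (a, b) else 0)"
      if "a < ?m" "b < ?m + ?n" for a b
      using that d(1-4) by (simp add: dsum_def)
    thus "p * act (dsum M N) g = act M g * p"
      by (intro eq_matI) (simp_all add: d dim mult_p p_mult del: index_mult_mat(1))
  qed (simp_all add: dim)
  moreover have "p * i = 1\<^sub>m ?m"
    by (rule eq_matI) (simp_all add: p_mult dim del: index_mult_mat(1), simp add: i_def)
  ultimately show thesis by (rule that)
qed

lemma dsum_zero_dim:
  assumes "mdim Q = 0" "\<And>g. act Q g = 0\<^sub>m 0 0" "kG_module G M"
  shows "act (dsum M Q) g = act M g" "mdim (dsum M Q) = mdim M"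
  using assms(1,2) by (auto simp: dsum_def intro!: eq_matI)

locale W_module = fin_group G for G :: "('a, 'b) monoid_scheme" (structure) +
  fixes W :: "('a, 'k::field) kG_rep"
  assumes W: "kG_module G W" and W_nonzero: "mdim W \<noteq> 0"
begin

text \<open>
  The map \<open>N \<otimes> W \<otimes> W\<^sup>* \<rightarrow> N\<close>, the counit of the adjunction, and the homomorphisms to \<open>N\<close> that
  factor through it.
\<close>

definition counit :: "('a, 'k) kG_rep \<Rightarrow> 'k mat" where
  "counit N = kron (1\<^sub>m (mdim N)) (ev_mat (mdim W))"

definition lifts :: "('a, 'k) kG_rep \<Rightarrow> ('a, 'k) kG_rep \<Rightarrow> 'k mat \<Rightarrow> bool" where
  "lifts M N f \<longleftrightarrow> (\<exists>g\<in>Hom_kG G M (N \<otimes>\<^sub>k W \<otimes>\<^sub>k dual G W). counit N * g = f)"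

lemma dual_W: "kG_module G (dual G W)"
  using W by (rule kG_module_dual)

lemma kG_module_NWW: "kG_module G N \<Longrightarrow> kG_module G (N \<otimes>\<^sub>k W \<otimes>\<^sub>k dual G W)"
  by (intro kG_module_tensor W dual_W)

lemma dim_counit [simp]:
  "dim_row (counit N) = mdim N" "dim_col (counit N) = mdim N * (mdim W * mdim W)"
  by (simp_all add: counit_def)

lemma counit_Hom:
  assumes N: "kG_module G N"
  shows "counit N \<in> Hom_kG G (N \<otimes>\<^sub>k W \<otimes>\<^sub>k dual G W) N"
proof -
  have "counit N \<in> Hom_kG G (N \<otimes>\<^sub>k (W \<otimes>\<^sub>k dual G W)) (N \<otimes>\<^sub>k triv)"
    unfolding counit_def
    by (intro Hom_kron kG_module_tensor N W dual_W kG_module_triv Hom_one ev_Hom(1))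
  thus ?thesis by (simp add: tensor_assoc)
qed

lemma counit_surj: "mat_range (counit N) = carrier_vec (mdim N)"
proof (rule mat_range_eq_carrier_if_right_inverse)
  let ?e = "mat (mdim W * mdim W) (Suc 0) (\<lambda>(i, j). if i = 0 then 1 else 0)"
  show "counit N * kron (1\<^sub>m (mdim N)) ?e = 1\<^sub>m (mdim N)"
    unfolding counit_def
    by (subst kron_mult_kron) (use W_nonzero in \<open>auto simp: ev_mat_right_inverse\<close>)
qed (rule carrier_matI; simp)+

lemma lifts_comp:
  assumes "kG_module G L" "kG_module G M" "kG_module G N"
    and a: "a \<in> Hom_kG G L M" and "lifts M N b"
  shows "lifts L N (b * a)"
proof -
  obtain g where g: "g \<in> Hom_kG G M (N \<otimes>\<^sub>k W \<otimes>\<^sub>k dual G W)" "counit N * g = b"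
    using assms by (auto simp: lifts_def)
  have "g * a \<in> Hom_kG G L (N \<otimes>\<^sub>k W \<otimes>\<^sub>k dual G W)"
    by (rule Hom_comp[OF assms(1,2) kG_module_NWW[OF assms(3)] a g(1)])
  moreover have "counit N * (g * a) = b * a"
    using Hom_dims[OF g(1)] Hom_dims[OF a] by (simp add: mat_assoc g(2)[symmetric])
  ultimately show ?thesis by (auto simp: lifts_def)
qed

lemma lifts_add:
  assumes "kG_module G M" "kG_module G N" and "lifts M N f" "lifts M N f'"
  shows "lifts M N (f + f')"
proof -
  obtain g g' where g: "g \<in> Hom_kG G M (N \<otimes>\<^sub>k W \<otimes>\<^sub>k dual G W)" "counit N * g = f"
    and g': "g' \<in> Hom_kG G M (N \<otimes>\<^sub>k W \<otimes>\<^sub>k dual G W)" "counit N * g' = f'"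
    using assms by (auto simp: lifts_def)
  have "counit N * (g + g') = f + f'"
    using mult_add_distrib_mat[OF Hom_carrier[OF counit_Hom[OF assms(2)]] Hom_carrier[OF g(1)]
        Hom_carrier[OF g'(1)]] by (simp add: g(2) g'(2))
  thus ?thesis
    using Hom_add[OF assms(1) kG_module_NWW[OF assms(2)] g(1) g'(1)] by (auto simp: lifts_def)
qed

text \<open>The counit is surjective because \<open>W \<noteq> 0\<close>, so maps out of projectives lift.\<close>

lemma lifts_projective:
  assumes "projective_kG G P" "kG_module G N" "f \<in> Hom_kG G P N"
  shows "lifts P N f"
  using assms kG_module_NWW[OF assms(2)] counit_Hom[OF assms(2)] counit_surj[of N]
  unfolding projective_kG_def lifts_def by blast

lemma counit_natural:
  assumes f: "f \<in> Hom_kG G M N"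
  shows "counit N * kron f (1\<^sub>m (mdim W * mdim W)) = f * counit M"
proof -
  have "f * counit M = kron f (1\<^sub>m (Suc 0)) * counit M" by simp
  also have "\<dots> = kron f (ev_mat (mdim W))"
    unfolding counit_def using Hom_dims[OF f]
    by (subst kron_mult_kron) auto
  also have "\<dots> = counit N * kron f (1\<^sub>m (mdim W * mdim W))"
    unfolding counit_def using Hom_dims[OF f] by (subst kron_mult_kron) auto
  finally show ?thesis by simp
qed

text \<open>
  On a module of the form \<open>Y \<otimes> W\<^sup>*\<close> the counit splits, by the coevaluation and a triangle identity.
\<close>

lemma lifts_tensor_dual:
  assumes Y: "kG_module G Y" and N: "kG_module G N" and f: "f \<in> Hom_kG G (Y \<otimes>\<^sub>k dual G W) N"
  shows "lifts (Y \<otimes>\<^sub>k dual G W) N f"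
proof -
  let ?V = "Y \<otimes>\<^sub>k dual G W" and ?w = "mdim W"
  define t :: "'k mat" where "t = kron (1\<^sub>m (mdim Y)) (kron (coev_mat ?w) (1\<^sub>m ?w))"
  have V: "kG_module G ?V" by (intro kG_module_tensor Y dual_W)
  have one: "1\<^sub>m ?w \<in> Hom_kG G (dual G W) (dual G W)" using Hom_one[OF dual_W] by simp
  have "t \<in> Hom_kG G (Y \<otimes>\<^sub>k (triv \<otimes>\<^sub>k dual G W)) (Y \<otimes>\<^sub>k (dual G W \<otimes>\<^sub>k W \<otimes>\<^sub>k dual G W))"
    unfolding t_def
    by (intro Hom_kron kG_module_tensor Y W dual_W kG_module_triv Hom_one coev_Hom(2) one)
  hence t: "t \<in> Hom_kG G ?V (?V \<otimes>\<^sub>k W \<otimes>\<^sub>k dual G W)" by (simp add: tensor_assoc)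
  have "counit ?V = kron (1\<^sub>m (mdim Y)) (kron (1\<^sub>m ?w) (ev_mat ?w))"
    by (simp add: counit_def kron_assoc[symmetric] kron_one_one)
  hence "counit ?V * t = kron (1\<^sub>m (mdim Y) * 1\<^sub>m (mdim Y))
      (kron (1\<^sub>m ?w) (ev_mat ?w) * kron (coev_mat ?w) (1\<^sub>m ?w))"
    unfolding t_def by (simp add: kron_mult_kron del: right_mult_one_mat right_mult_one_mat')
  hence ct: "counit ?V * t = 1\<^sub>m (mdim ?V)" by (simp add: triangle_left kron_one_one)
  have "counit N * (kron f (1\<^sub>m (?w * ?w)) * t) = f * (counit ?V * t)"
    using Hom_dims[OF t] Hom_dims[OF f]
    by (simp add: mat_assoc[symmetric] counit_natural[OF f, symmetric])
  also have "\<dots> = f" using Hom_dims[OF f] by (simp add: ct)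
  finally have eq: "counit N * (kron f (1\<^sub>m (?w * ?w)) * t) = f" .
  have "kron f (1\<^sub>m (mdim (W \<otimes>\<^sub>k dual G W))) \<in>
      Hom_kG G (?V \<otimes>\<^sub>k (W \<otimes>\<^sub>k dual G W)) (N \<otimes>\<^sub>k (W \<otimes>\<^sub>k dual G W))"
    by (intro Hom_kron kG_module_tensor V N W dual_W Hom_one f)
  hence "kron f (1\<^sub>m (?w * ?w)) \<in> Hom_kG G (?V \<otimes>\<^sub>k W \<otimes>\<^sub>k dual G W) (N \<otimes>\<^sub>k W \<otimes>\<^sub>k dual G W)"
    by (simp add: tensor_assoc)
  from Hom_comp[OF V kG_module_NWW[OF V] kG_module_NWW[OF N] t this] eq
  show ?thesis by (auto simp: lifts_def)
qed

lemma W_projective_tensor_dual: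
  assumes N: "kG_module G N"
  shows "W_projective G W (N \<otimes>\<^sub>k W \<otimes>\<^sub>k dual G W)"
  unfolding W_projective_def
proof (intro conjI exI)
  let ?M = "N \<otimes>\<^sub>k W \<otimes>\<^sub>k dual G W" and ?Y = "N \<otimes>\<^sub>k W"
  let ?Q = "\<lparr> mdim = 0, act = (\<lambda>g. 0\<^sub>m 0 0) \<rparr> :: ('a, 'k) kG_rep"
  show M: "kG_module G ?M" by (rule kG_module_NWW[OF N])
  show Y: "kG_module G ?Y" by (intro kG_module_tensor N W)
  show "kG_module G ?Q" by (auto simp: kG_module_def)
  have dsum: "dsum ?M ?Q = ?M"
    using dsum_zero_dim[OF _ _ M, of ?Q] by (intro kG_rep.equality ext) simp_all
  have "swap_mat (mdim ?Y) (mdim (dual G W)) \<in> Hom_kG G ?M (dual G W \<otimes>\<^sub>k ?Y)"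
    "swap_mat (mdim (dual G W)) (mdim ?Y) \<in> Hom_kG G (dual G W \<otimes>\<^sub>k ?Y) ?M"
    using swap_Hom[OF Y dual_W] swap_Hom[OF dual_W Y] by simp_all
  moreover have "swap_mat (mdim (dual G W)) (mdim ?Y) * swap_mat (mdim ?Y) (mdim (dual G W)) = 1\<^sub>m (mdim ?M)"
    "swap_mat (mdim ?Y) (mdim (dual G W)) * swap_mat (mdim (dual G W)) (mdim ?Y) = 1\<^sub>m (mdim (dual G W \<otimes>\<^sub>k ?Y))"
    by (simp_all add: swap_mat_swap_mat)
  ultimately show "iso_kG G (dsum ?M ?Q) (dual G W \<otimes>\<^sub>k ?Y)"
    unfolding dsum iso_kG_def by blast
qed

text \<open>
  A homomorphism to \<open>N\<close> factors through some \<open>W\<close>-projective module iff it factors through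
  \<open>N \<otimes> W \<otimes> W\<^sup>* \<rightarrow> N\<close>.
\<close>

lemma W_null_Hom_iff:
  assumes M: "kG_module G M" and N: "kG_module G N"
  shows "f \<in> W_null_Hom G W M N \<longleftrightarrow> lifts M N f"
proof
  assume "lifts M N f"
  thus "f \<in> W_null_Hom G W M N"
    using W_projective_tensor_dual[OF N] counit_Hom[OF N] unfolding lifts_def W_null_Hom_def by blast
next
  assume "f \<in> W_null_Hom G W M N"
  then obtain a b P where f: "f = b * a" and P: "W_projective G W P" and a: "a \<in> Hom_kG G M P"
    and b: "b \<in> Hom_kG G P N" by (auto simp: W_null_Hom_def)
  obtain Y Q where Pm: "kG_module G P" and Y: "kG_module G Y" and Q: "kG_module G Q"
    and iso: "iso_kG G (dsum P Q) (dual G W \<otimes>\<^sub>k Y)"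
    using P by (auto simp: W_projective_def)
  obtain u v where u: "u \<in> Hom_kG G (dsum P Q) (dual G W \<otimes>\<^sub>k Y)"
    and v: "v \<in> Hom_kG G (dual G W \<otimes>\<^sub>k Y) (dsum P Q)" and vu: "v * u = 1\<^sub>m (mdim (dsum P Q))"
    using iso by (auto simp: iso_kG_def)
  obtain i p where i: "i \<in> Hom_kG G P (dsum P Q)" and p: "p \<in> Hom_kG G (dsum P Q) P"
    and pi: "p * i = 1\<^sub>m (mdim P)" using dsum_left_split[OF Pm Q] by blast
  let ?D = "dual G W \<otimes>\<^sub>k Y" and ?E = "Y \<otimes>\<^sub>k dual G W"
  let ?s = "swap_mat (mdim (dual G W)) (mdim Y) :: 'k mat"
  let ?s' = "swap_mat (mdim Y) (mdim (dual G W)) :: 'k mat"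
  have D: "kG_module G ?D" and E: "kG_module G ?E" and S: "kG_module G (dsum P Q)"
    by (intro kG_module_tensor dual_W Y kG_module_dsum Pm Q)+
  \<comment> \<open>Between \<open>a\<close> and \<open>b\<close> insert the split injection \<open>P \<rightarrow> P \<oplus> Q \<cong> W\<^sup>* \<otimes> Y \<cong> Y \<otimes> W\<^sup>*\<close> and its
    retraction.\<close>
  have s: "?s \<in> Hom_kG G ?D ?E" and s': "?s' \<in> Hom_kG G ?E ?D"
    using swap_Hom[OF dual_W Y] swap_Hom[OF Y dual_W] by auto
  have "b * (p * v * ?s') \<in> Hom_kG G ?E N"
    by (rule Hom_comp[OF E Pm N Hom_comp[OF E D Pm s' Hom_comp[OF D S Pm v p]] b])
  hence "lifts ?E N (b * (p * v * ?s'))" by (rule lifts_tensor_dual[OF Y N])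
  moreover have "?s * (u * i * a) \<in> Hom_kG G M ?E"
    by (rule Hom_comp[OF M D E Hom_comp[OF M Pm D a Hom_comp[OF Pm S D i u]] s])
  ultimately have "lifts M N (b * (p * v * ?s') * (?s * (u * i * a)))"
    by (intro lifts_comp[OF M E N])
  also have "b * (p * v * ?s') * (?s * (u * i * a)) = f"
  proof -
    note d = Hom_dims[OF a] Hom_dims[OF b] Hom_dims[OF p] Hom_dims[OF i] Hom_dims[OF u] Hom_dims[OF v]
    have "b * (p * v * ?s') * (?s * (u * i * a)) = b * (p * (v * (?s' * ?s) * u) * i) * a"
      by (simp add: mat_assoc d)
    also have "v * (?s' * ?s) * u = 1\<^sub>m (mdim (dsum P Q))"
      using vu d by (simp add: swap_mat_swap_mat)
    also have "b * (p * \<dots> * i) * a = f"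
      using pi d by (simp add: f)
    finally show ?thesis .
  qed
  finally show "lifts M N f" .
qed

lemma W_stable_Hom_zero_iff:
  assumes M: "kG_module G M" and N: "kG_module G N"
  shows "W_stable_Hom G W M N = {W_stable_zero G W M N} \<longleftrightarrow> (\<forall>f\<in>Hom_kG G M N. lifts M N f)"
proof
  let ?R = "W_stable_rel G W M N" and ?z = "0\<^sub>m (mdim N) (mdim M) :: 'k mat"
  have z: "?z \<in> Hom_kG G M N" by (rule Hom_zero[OF M N])
  have R: "(x, y) \<in> ?R \<longleftrightarrow> x \<in> Hom_kG G M N \<and> y \<in> Hom_kG G M N \<and> lifts M N (x - y)" for x y
    by (simp add: W_stable_rel_def cong_rel_def W_null_Hom_iff[OF M N])
  have lz: "lifts M N ?z"
    unfolding lifts_def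
    by (rule bexI[of _ "0\<^sub>m (mdim N * (mdim W * mdim W)) (mdim M)"])
      (use Hom_zero[OF M kG_module_NWW[OF N]] in \<open>auto simp: mult.assoc\<close>)
  {
    assume eq: "W_stable_Hom G W M N = {W_stable_zero G W M N}"
    show "\<forall>f\<in>Hom_kG G M N. lifts M N f"
    proof
      fix f assume f: "f \<in> Hom_kG G M N"
      have "?R `` {f} \<in> W_stable_Hom G W M N"
        using f unfolding W_stable_Hom_def by (rule quotientI)
      hence "?R `` {f} = ?R `` {?z}" using eq by (simp add: W_stable_zero_def)
      moreover have zz: "?z - ?z = ?z" by auto
      have "(?z, ?z) \<in> ?R" unfolding R zz using z lz by blast
      ultimately have "(f, ?z) \<in> ?R" by auto
      hence "lifts M N (f - ?z)" by (simp add: R)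
      also have "f - ?z = f" using Hom_dims[OF f] by (intro eq_matI) auto
      finally show "lifts M N f" .
    qed
  next
    assume all: "\<forall>f\<in>Hom_kG G M N. lifts M N f"
    hence "(x, y) \<in> ?R" if "x \<in> Hom_kG G M N" "y \<in> Hom_kG G M N" for x y
      using that Hom_minus[OF M N that] by (simp add: R)
    hence "?R `` {f} = Hom_kG G M N" if "f \<in> Hom_kG G M N" for f
      using that by (auto simp: R)
    thus "W_stable_Hom G W M N = {W_stable_zero G W M N}"
      using z unfolding W_stable_Hom_def W_stable_zero_def quotient_def by auto
  }
qed

end

section \<open>Syzygies\<close>

lemma projective_kG_module: "projective_kG G P \<Longrightarrow> kG_module G P"
  by (simp add: projective_kG_def)

lemma projective_lift:
  assumes "projective_kG G P" "kG_module G A" "kG_module G B" "p \<in> Hom_kG G A B"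
    and "mat_range p = carrier_vec (mdim B)" "f \<in> Hom_kG G P B"
  obtains h where "h \<in> Hom_kG G P A" "p * h = f"
  using assms unfolding projective_kG_def by blast

text \<open>
  \<open>M\<close> is a retract of \<open>M'\<close> up to maps that factor through a projective module.  This half of a
  stable isomorphism is all that the comparison of syzygies needs.
\<close>

definition stable_retract ::
  "('g, 'b) monoid_scheme \<Rightarrow> ('g, 'k::field) kG_rep \<Rightarrow> ('g, 'k) kG_rep \<Rightarrow> bool" where
  "stable_retract G M M' \<longleftrightarrow> (\<exists>a b Q s t. a \<in> Hom_kG G M M' \<and> b \<in> Hom_kG G M' M \<and>
     projective_kG G Q \<and> s \<in> Hom_kG G M Q \<and> t \<in> Hom_kG G Q M \<and> b * a + t * s = 1\<^sub>m (mdim M))"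

lemma stable_retract_refl:
  fixes M Q :: "('g, 'k::field) kG_rep"
  assumes M: "kG_module G M" and Q: "projective_kG G Q"
  shows "stable_retract G M M"
  unfolding stable_retract_def
proof (intro exI conjI)
  show "1\<^sub>m (mdim M) \<in> Hom_kG G M M" "1\<^sub>m (mdim M) \<in> Hom_kG G M M" using Hom_one[OF M] by auto
  show "0\<^sub>m (mdim Q) (mdim M) \<in> Hom_kG G M Q" "0\<^sub>m (mdim M) (mdim Q) \<in> Hom_kG G Q M"
    using Hom_zero M projective_kG_module[OF Q] by auto
  show "1\<^sub>m (mdim M) * 1\<^sub>m (mdim M) + 0\<^sub>m (mdim M) (mdim Q) * 0\<^sub>m (mdim Q) (mdim M) = (1\<^sub>m (mdim M) :: 'k mat)"
    by simp
qed (rule Q)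

text \<open>
  Schanuel's lemma in this weak form: lift the maps \<open>a, b\<close> between \<open>M\<close> and \<open>M'\<close> to \<open>P\<close> and \<open>P'\<close> and
  restrict them to the kernels; the defect \<open>1 - b a\<close> on the kernel \<open>K\<close> then factors through \<open>P\<close>.
\<close>

lemma stable_retract_kernel:
  assumes M: "kG_module G M" and M': "kG_module G M'"
    and P: "projective_kG G P" and P': "projective_kG G P'"
    and p: "p \<in> Hom_kG G P M" and p': "p' \<in> Hom_kG G P' M'"
    and surj: "mat_range p = carrier_vec (mdim M)" and surj': "mat_range p' = carrier_vec (mdim M')"
    and K: "is_kernel G P p K \<iota>" and K': "is_kernel G P' p' K' \<iota>'"
    and retr: "stable_retract G M M'"
  shows "stable_retract G K K'"
proof -
  obtain a b Q s t where a: "a \<in> Hom_kG G M M'" and b: "b \<in> Hom_kG G M' M"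
    and Q: "projective_kG G Q" and s: "s \<in> Hom_kG G M Q" and t: "t \<in> Hom_kG G Q M"
    and one: "b * a + t * s = 1\<^sub>m (mdim M)" using retr by (auto simp: stable_retract_def)
  note Pm = projective_kG_module[OF P] and P'm = projective_kG_module[OF P']
    and Qm = projective_kG_module[OF Q]
  have Km: "kG_module G K" and \<iota>: "\<iota> \<in> Hom_kG G K P" using is_kernelD[OF K] by auto
  have K'm: "kG_module G K'" and \<iota>': "\<iota>' \<in> Hom_kG G K' P'" using is_kernelD[OF K'] by auto
  obtain a1 where a1: "a1 \<in> Hom_kG G P P'" "p' * a1 = a * p"
    using projective_lift[OF P P'm M' p' surj' Hom_comp[OF Pm M M' p a]] by blast
  obtain b1 where b1: "b1 \<in> Hom_kG G P' P" "p * b1 = b * p'"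
    using projective_lift[OF P' Pm M p surj Hom_comp[OF P'm M' M p' b]] by blast
  obtain t1 where t1: "t1 \<in> Hom_kG G Q P" "p * t1 = t"
    using projective_lift[OF Q Pm M p surj t] by blast
  note d = Hom_dims[OF a] Hom_dims[OF b] Hom_dims[OF s] Hom_dims[OF t] Hom_dims[OF p] Hom_dims[OF p']
    Hom_dims[OF \<iota>] Hom_dims[OF \<iota>'] Hom_dims[OF a1(1)] Hom_dims[OF b1(1)] Hom_dims[OF t1(1)]
  note p\<iota> = kernel_comp_zero[OF K p] and p\<iota>' = kernel_comp_zero[OF K' p']
  have "p' * (a1 * \<iota>) = a * (p * \<iota>)" using a1(2) by (simp add: mat_assoc[symmetric] d)
  also have "\<dots> = 0\<^sub>m (mdim M') (mdim K)"
    unfolding p\<iota> using Hom_carrier[OF a] by (simp add: right_mult_zero_mat)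
  finally obtain a2 where a2: "a2 \<in> Hom_kG G K K'" "\<iota>' * a2 = a1 * \<iota>"
    using kernel_lift[OF K' p' P'm Km Hom_comp[OF Km Pm P'm \<iota> a1(1)]] by blast
  have "p * (b1 * \<iota>') = b * (p' * \<iota>')" using b1(2) by (simp add: mat_assoc[symmetric] d)
  also have "\<dots> = 0\<^sub>m (mdim M) (mdim K')"
    unfolding p\<iota>' using Hom_carrier[OF b] by (simp add: right_mult_zero_mat)
  finally obtain b2 where b2: "b2 \<in> Hom_kG G K' K" "\<iota> * b2 = b1 * \<iota>'"
    using kernel_lift[OF K p Pm K'm Hom_comp[OF K'm P'm Pm \<iota>' b1(1)]] by blast
  \<comment> \<open>\<open>1 - X\<close> is killed by \<open>p\<close>, hence equals \<open>\<iota> w\<close>; on \<open>K\<close> the summand through \<open>Q\<close> vanishes.\<close>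
  define X where "X = b1 * a1 + t1 * (s * p)"
  have c1: "b1 * a1 \<in> Hom_kG G P P" by (rule Hom_comp[OF Pm P'm Pm a1(1) b1(1)])
  have c2: "t1 * (s * p) \<in> Hom_kG G P P"
    by (rule Hom_comp[OF Pm Qm Pm Hom_comp[OF Pm M Qm p s] t1(1)])
  have X: "X \<in> Hom_kG G P P" unfolding X_def by (rule Hom_add[OF Pm Pm c1 c2])
  have D: "1\<^sub>m (mdim P) - X \<in> Hom_kG G P P" by (rule Hom_minus[OF Pm Pm Hom_one[OF Pm] X])
  have "p * X = p * (b1 * a1) + p * (t1 * (s * p))"
    unfolding X_def by (rule mult_add_distrib_mat[OF Hom_carrier[OF p] Hom_carrier[OF c1] Hom_carrier[OF c2]])
  also have "p * (b1 * a1) = b * (p' * a1)"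
    using b1(2) by (simp add: mat_assoc[symmetric] d)
  also have "\<dots> = b * a * p" using a1(2) by (simp add: mat_assoc d)
  also have "p * (t1 * (s * p)) = t * s * p"
    using t1(2) by (simp add: mat_assoc[symmetric] d)
  also have "b * a * p + t * s * p = (b * a + t * s) * p"
    by (rule add_mult_distrib_mat[OF _ _ Hom_carrier[OF p], symmetric]; rule carrier_matI; simp add: d)
  also have "\<dots> = p" using Hom_carrier[OF p] by (simp add: one)
  finally have pX: "p * X = p" .
  have "p * (1\<^sub>m (mdim P) - X) = p * 1\<^sub>m (mdim P) - p * X"
    by (rule mult_minus_distrib_mat[OF Hom_carrier[OF p] _ Hom_carrier[OF X]]) simp
  also have "\<dots> = 0\<^sub>m (mdim M) (mdim P)" using Hom_carrier[OF p] by (simp add: pX)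
  finally obtain w where w: "w \<in> Hom_kG G P K" "\<iota> * w = 1\<^sub>m (mdim P) - X"
    using kernel_lift[OF K p Pm Pm D] by blast
  note d' = d Hom_dims[OF a2(1)] Hom_dims[OF b2(1)] Hom_dims[OF w(1)]
  have "X * \<iota> = b1 * a1 * \<iota> + t1 * (s * p) * \<iota>"
    unfolding X_def by (rule add_mult_distrib_mat[OF Hom_carrier[OF c1] Hom_carrier[OF c2] Hom_carrier[OF \<iota>]])
  also have "b1 * a1 * \<iota> = b1 * (\<iota>' * a2)" by (simp add: mat_assoc d a2(2))
  also have "\<dots> = \<iota> * (b2 * a2)" using b2(2) by (simp add: mat_assoc[symmetric] d')
  also have "t1 * (s * p) * \<iota> = t1 * (s * (p * \<iota>))" by (simp add: mat_assoc d)
  also have "\<dots> = 0\<^sub>m (mdim P) (mdim K)"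
    unfolding p\<iota> using Hom_carrier[OF s] Hom_carrier[OF t1(1)] by (simp add: right_mult_zero_mat)
  also have "\<iota> * (b2 * a2) + \<dots> = \<iota> * (b2 * a2)"
    by (rule right_add_zero_mat) (rule carrier_matI; simp add: d')
  finally have X\<iota>: "X * \<iota> = \<iota> * (b2 * a2)" .
  have "\<iota> * (b2 * a2 + w * \<iota>) = \<iota> * (b2 * a2) + \<iota> * (w * \<iota>)"
    by (rule mult_add_distrib_mat[OF Hom_carrier[OF \<iota>]]; rule carrier_matI; simp add: d')
  also have "\<iota> * (w * \<iota>) = (1\<^sub>m (mdim P) - X) * \<iota>" unfolding w(2)[symmetric] by (simp add: mat_assoc d')
  also have "\<dots> = 1\<^sub>m (mdim P) * \<iota> - X * \<iota>"
    by (rule minus_mult_distrib_mat[OF _ Hom_carrier[OF X] Hom_carrier[OF \<iota>]]) simp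
  also have "\<dots> = \<iota> - \<iota> * (b2 * a2)" using Hom_carrier[OF \<iota>] by (simp add: X\<iota>)
  also have "\<iota> * (b2 * a2) + (\<iota> - \<iota> * (b2 * a2)) = \<iota> * 1\<^sub>m (mdim K)"
    using Hom_carrier[OF \<iota>] by (intro eq_matI) (simp_all add: d' del: index_mult_mat(1))
  finally have "b2 * a2 + w * \<iota> = 1\<^sub>m (mdim K)"
    by (rule kernel_cancel[OF K, rotated 2]) (simp_all add: d')
  thus ?thesis
    unfolding stable_retract_def using a2(1) b2(1) P \<iota> w(1) by blast
qed

text \<open>
  A projective resolution cut into short exact sequences \<open>K (n + 1) \<rightarrow> P n \<rightarrow> K n\<close> with maps
  \<open>\<iota> n\<close> and \<open>\<pi> n\<close>, starting from \<open>K 0 = X\<close>.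
\<close>

definition syzygies ::
  "('g, 'b) monoid_scheme \<Rightarrow> (nat \<Rightarrow> ('g, 'k::field) kG_rep) \<Rightarrow> (nat \<Rightarrow> 'k mat) \<Rightarrow>
    ('g, 'k) kG_rep \<Rightarrow> (nat \<Rightarrow> ('g, 'k) kG_rep) \<Rightarrow> (nat \<Rightarrow> 'k mat) \<Rightarrow> (nat \<Rightarrow> 'k mat) \<Rightarrow> bool" where
  "syzygies G P d X K \<pi> \<iota> \<longleftrightarrow> K 0 = X \<and> d 0 = \<pi> 0 \<and>
     (\<forall>n. projective_kG G (P n) \<and> kG_module G (K n) \<and> \<pi> n \<in> Hom_kG G (P n) (K n) \<and>
        mat_range (\<pi> n) = carrier_vec (mdim (K n)) \<and>
        is_kernel G (P n) (\<pi> n) (K (Suc n)) (\<iota> n) \<and> d (Suc n) = \<iota> n * \<pi> (Suc n))"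

lemma syzygiesD:
  assumes "syzygies G P d X K \<pi> \<iota>"
  shows "K 0 = X" "d 0 = \<pi> 0" "projective_kG G (P n)" "kG_module G (P n)" "kG_module G (K n)"
    "\<pi> n \<in> Hom_kG G (P n) (K n)" "mat_range (\<pi> n) = carrier_vec (mdim (K n))"
    "is_kernel G (P n) (\<pi> n) (K (Suc n)) (\<iota> n)" "d (Suc n) = \<iota> n * \<pi> (Suc n)"
    "\<iota> n \<in> Hom_kG G (K (Suc n)) (P n)" "d (Suc n) \<in> Hom_kG G (P (Suc n)) (P n)"
  using assms is_kernelD(2)[of G "P n" "\<pi> n" "K (Suc n)" "\<iota> n"]
    Hom_comp[of G "P (Suc n)" "K (Suc n)" "P n" "\<pi> (Suc n)" "\<iota> n"]
  by (simp_all add: syzygies_def projective_kG_module)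

lemma stable_retract_syzygies:
  assumes S: "syzygies G P d X K \<pi> \<iota>" and S': "syzygies G P' d' X K' \<pi>' \<iota>'"
  shows "stable_retract G (K n) (K' n)"
proof (induction n)
  case 0
  show ?case
    using stable_retract_refl[OF syzygiesD(5)[OF S, of 0] syzygiesD(3)[OF S, of 0]]
    by (simp add: syzygiesD(1)[OF S] syzygiesD(1)[OF S'])
next
  case (Suc n)
  show ?case
    by (rule stable_retract_kernel[OF syzygiesD(5)[OF S] syzygiesD(5)[OF S'] syzygiesD(3)[OF S]
          syzygiesD(3)[OF S'] syzygiesD(6)[OF S] syzygiesD(6)[OF S'] syzygiesD(7)[OF S]
          syzygiesD(7)[OF S'] syzygiesD(8)[OF S] syzygiesD(8)[OF S'] Suc.IH])
qed

lemma kernel_cancel_vec: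
  assumes K: "is_kernel G M f K \<iota>" and a: "a \<in> carrier_vec (mdim K)" and b: "b \<in> carrier_vec (mdim K)"
    and eq: "\<iota> *\<^sub>v a = \<iota> *\<^sub>v b"
  shows "a = b"
proof -
  have \<iota>: "\<iota> \<in> Hom_kG G K M" using K by (rule is_kernelD)
  obtain l where l: "l \<in> carrier_mat (mdim K) (mdim M)" "l * \<iota> = 1\<^sub>m (mdim K)"
    using injective_left_inverse[OF Hom_carrier[OF \<iota>]] K by (auto simp: is_kernel_def)
  note dims = Hom_dims[OF \<iota>] carrier_matD[OF l(1)]
  have "l * \<iota> *\<^sub>v a = l * \<iota> *\<^sub>v b" using a b by (simp only: mat_vec_assoc dims carrier_vecD eq)
  thus ?thesis using l a b by simp
qed

lemma resolution_syzygies: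
  fixes X :: "('g, 'k::field) kG_rep"
  assumes "group G" and X: "kG_module G X" and res: "projective_resolution G P d X"
  obtains K \<pi> \<iota> where "syzygies G P d X K \<pi> \<iota>"
proof -
  define T where "T n = (case n of 0 \<Rightarrow> X | Suc m \<Rightarrow> P m)" for n
  have P: "projective_kG G (P n)" "kG_module G (P n)" for n
    using res projective_kG_module by (auto simp: projective_resolution_def)
  have T: "kG_module G (T n)" for n by (cases n) (simp_all add: T_def X P)
  have d: "d n \<in> Hom_kG G (P n) (T n)" for n
    using res by (cases n) (simp_all add: T_def projective_resolution_def)
  have exact: "mat_range (d (Suc n)) = mat_kernel (d n)" for n
    using res by (simp add: projective_resolution_def)
  have "\<forall>n. \<exists>K' \<iota>. is_kernel G (P n) (d n) K' \<iota>"
    using kernel_exists[OF P(2) T d \<open>group G\<close>] by blast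
  then obtain K' \<iota> where K': "is_kernel G (P n) (d n) (K' n) (\<iota> n)" for n by metis
  have dd: "d n * d (Suc n) = 0\<^sub>m (mdim (T n)) (mdim (P (Suc n)))" for n
  proof (rule mat_eq_if_mult_vec_eq[of _ "mdim (T n)" "mdim (P (Suc n))"])
    fix v :: "'k vec" assume v: "v \<in> carrier_vec (mdim (P (Suc n)))"
    have dS: "d (Suc n) \<in> Hom_kG G (P (Suc n)) (P n)" using d[of "Suc n"] by (simp add: T_def)
    have "d (Suc n) *\<^sub>v v \<in> mat_kernel (d n)"
      using v exact[of n] by (auto simp: mat_range_def Hom_dims[OF dS])
    hence "d n *\<^sub>v (d (Suc n) *\<^sub>v v) = 0\<^sub>v (mdim (T n))" using mat_kernelD[OF Hom_carrier[OF d]] by blast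
    hence "d n * d (Suc n) *\<^sub>v v = 0\<^sub>v (mdim (T n))"
      using v Hom_dims[OF d[of n]] Hom_dims[OF dS] by (simp add: mat_vec_assoc)
    also have "\<dots> = 0\<^sub>m (mdim (T n)) (mdim (P (Suc n))) *\<^sub>v v" using v by (intro eq_vecI) auto
    finally show "d n * d (Suc n) *\<^sub>v v = \<dots>" .
  qed (use Hom_dims[OF d[of n]] Hom_dims[OF d[of "Suc n"]] in \<open>auto simp: T_def\<close>)
  have "\<exists>q. q \<in> Hom_kG G (P (Suc n)) (K' n) \<and> \<iota> n * q = d (Suc n)" for n
  proof -
    have "d (Suc n) \<in> Hom_kG G (P (Suc n)) (P n)" using d[of "Suc n"] by (simp add: T_def)
    from kernel_lift[OF K' d P(2) P(2) this dd] show ?thesis by blast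
  qed
  then obtain q where q: "q n \<in> Hom_kG G (P (Suc n)) (K' n)" "\<iota> n * q n = d (Suc n)" for n by metis
  have q_surj: "mat_range (q n) = carrier_vec (mdim (K' n))" for n
  proof -
    have \<iota>: "\<iota> n \<in> Hom_kG G (K' n) (P n)" using is_kernelD[OF K'] by auto
    have "v \<in> mat_range (q n)" if v: "v \<in> carrier_vec (mdim (K' n))" for v
    proof -
      have "\<iota> n *\<^sub>v v \<in> mat_range (\<iota> n)" using v Hom_dims[OF \<iota>] by (auto simp: mat_range_def)
      hence "\<iota> n *\<^sub>v v \<in> mat_range (d (Suc n))" using K'[of n] exact[of n] by (simp add: is_kernel_def)
      then obtain w where w: "w \<in> carrier_vec (mdim (P (Suc n)))" "\<iota> n *\<^sub>v v = d (Suc n) *\<^sub>v w"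
        using Hom_dims[OF d[of "Suc n"]] by (auto simp: mat_range_def)
      have "\<iota> n *\<^sub>v (q n *\<^sub>v w) = \<iota> n *\<^sub>v v"
        unfolding w(2) q(2)[symmetric] using w(1) Hom_dims[OF \<iota>] Hom_dims[OF q(1)]
        by (simp add: mat_vec_assoc)
      hence "v = q n *\<^sub>v w"
        using kernel_cancel_vec[OF K' v _ , of "q n *\<^sub>v w"] Hom_dims[OF q(1)]
        by (metis carrier_vecI dim_mult_mat_vec)
      thus ?thesis using w(1) Hom_dims[OF q(1)] by (auto simp: mat_range_def)
    qed
    thus ?thesis using Hom_dims[OF q(1)[of n]] by (auto simp: mat_range_def intro!: carrier_vecI)
  qed
  define K where "K n = (case n of 0 \<Rightarrow> X | Suc m \<Rightarrow> K' m)" for n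
  define \<pi> where "\<pi> n = (case n of 0 \<Rightarrow> d 0 | Suc m \<Rightarrow> q m)" for n
  have \<pi>: "\<pi> n \<in> Hom_kG G (P n) (K n)" for n
    using d[of 0] q(1) by (cases n) (simp_all add: K_def \<pi>_def T_def)
  have ker: "mat_kernel (\<pi> n) = mat_kernel (d n)" for n
  proof (cases n)
    case (Suc m)
    have \<iota>: "\<iota> m \<in> Hom_kG G (K' m) (P m)" using is_kernelD[OF K'] by auto
    have dS: "d (Suc m) \<in> Hom_kG G (P (Suc m)) (P m)" using d[of "Suc m"] by (simp add: T_def)
    have eq: "d (Suc m) *\<^sub>v v = \<iota> m *\<^sub>v (q m *\<^sub>v v)" if "v \<in> carrier_vec (mdim (P (Suc m)))" for v
      unfolding q(2)[symmetric] using that Hom_dims[OF \<iota>] Hom_dims[OF q(1)] by (simp add: mat_vec_assoc)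
    have \<iota>0: "\<iota> m *\<^sub>v 0\<^sub>v (mdim (K' m)) = 0\<^sub>v (mdim (P m))"
      using Hom_carrier[OF \<iota>] by (auto intro!: eq_vecI)
    have "q m *\<^sub>v v = 0\<^sub>v (mdim (K' m)) \<longleftrightarrow> d (Suc m) *\<^sub>v v = 0\<^sub>v (mdim (P m))"
      if v: "v \<in> carrier_vec (mdim (P (Suc m)))" for v
      unfolding eq[OF v] using \<iota>0 kernel_cancel_vec[OF K', of "q m *\<^sub>v v" m "0\<^sub>v (mdim (K' m))"]
        Hom_dims[OF q(1)[of m]] by (metis carrier_vecI dim_mult_mat_vec zero_carrier_vec)
    thus ?thesis
      using Suc mat_kernel[OF Hom_carrier[OF q(1)]] mat_kernel[OF Hom_carrier[OF dS]]
      by (auto simp: \<pi>_def)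
  qed (simp add: \<pi>_def)
  have "syzygies G P d X K \<pi> \<iota>"
    unfolding syzygies_def
  proof (intro conjI allI)
    fix n
    show "kG_module G (K n)" using X is_kernelD(1)[OF K'] by (cases n) (simp_all add: K_def)
    show "mat_range (\<pi> n) = carrier_vec (mdim (K n))"
      using q_surj res by (cases n) (simp_all add: \<pi>_def K_def projective_resolution_def)
    show "is_kernel G (P n) (\<pi> n) (K (Suc n)) (\<iota> n)"
      using K'[of n] by (simp add: is_kernel_def ker K_def)
    show "d (Suc n) = \<iota> n * \<pi> (Suc n)" by (simp add: \<pi>_def q)
  qed (simp_all add: K_def \<pi>_def P \<pi>[unfolded \<pi>_def K_def])
  thus thesis by (rule that)
qed

lemma mat_range_image: "mat_range f = (\<lambda>v. f *\<^sub>v v) ` carrier_vec (dim_col f)"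
  by (auto simp: mat_range_def)

lemma mat_range_mult:
  assumes "dim_col A = dim_row B"
  shows "mat_range (A * B) = (\<lambda>v. A *\<^sub>v v) ` mat_range B"
  unfolding mat_range_image image_image
  using assms by (intro image_cong) (auto simp: mat_vec_assoc)

lemma syzygies_resolution:
  assumes S: "syzygies G P d X K \<pi> \<iota>"
  shows "projective_resolution G P d X"
  unfolding projective_resolution_def
proof (intro conjI allI)
  show "d 0 \<in> Hom_kG G (P 0) X" "mat_range (d 0) = carrier_vec (mdim X)"
    using syzygiesD(1,2)[OF S] syzygiesD(6,7)[OF S, of 0] by auto
  have range: "mat_range (d (Suc n)) = mat_range (\<iota> n)" for n
  proof -
    note dims = Hom_dims[OF syzygiesD(10)[OF S, of n]] Hom_dims[OF syzygiesD(6)[OF S, of "Suc n"]]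
    have "mat_range (d (Suc n)) = (\<lambda>v. \<iota> n *\<^sub>v v) ` mat_range (\<pi> (Suc n))"
      unfolding syzygiesD(9)[OF S] by (rule mat_range_mult) (simp add: dims)
    also have "\<dots> = mat_range (\<iota> n)"
      unfolding syzygiesD(7)[OF S] by (simp add: mat_range_image dims)
    finally show ?thesis .
  qed
  have "mat_kernel (d (Suc n)) = mat_kernel (\<pi> (Suc n))" for n
  proof -
    note \<iota> = syzygiesD(10)[OF S, of n] and \<pi> = syzygiesD(6)[OF S, of "Suc n"]
    have "\<iota> n *\<^sub>v 0\<^sub>v (mdim (K (Suc n))) = 0\<^sub>v (mdim (P n))"
      using Hom_carrier[OF \<iota>] by (auto intro!: eq_vecI)
    hence "\<pi> (Suc n) *\<^sub>v v = 0\<^sub>v (mdim (K (Suc n))) \<longleftrightarrow> d (Suc n) *\<^sub>v v = 0\<^sub>v (mdim (P n))"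
      if v: "v \<in> carrier_vec (mdim (P (Suc n)))" for v
      unfolding syzygiesD(9)[OF S]
      using v Hom_dims[OF \<iota>] Hom_dims[OF \<pi>]
        kernel_cancel_vec[OF syzygiesD(8)[OF S], of "\<pi> (Suc n) *\<^sub>v v" n "0\<^sub>v (mdim (K (Suc n)))"]
      by (metis carrier_vecD carrier_vecI dim_mult_mat_vec mat_vec_assoc zero_carrier_vec)
    thus ?thesis
      using mat_kernel[OF Hom_carrier[OF \<pi>]] mat_kernel[OF Hom_carrier[OF syzygiesD(11)[OF S, of n]]]
      by auto
  qed
  hence "mat_kernel (d n) = mat_kernel (\<pi> n)" for n
    using syzygiesD(2)[OF S] by (cases n) auto
  thus "mat_range (d (Suc n)) = mat_kernel (d n)" for n
    using range syzygiesD(8)[OF S, of n] by (simp add: is_kernel_def)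
qed (use syzygiesD(3,11)[OF S] in auto)

lemma (in fin_group) Omega_kernel:
  assumes X: "kG_module G X"
  shows "\<exists>\<iota>. is_kernel G (free_cover G X) (free_cover_map G X) (Omega G X) \<iota>"
proof -
  have "\<exists>K \<iota>. is_kernel G (free_cover G X) (free_cover_map G X) K \<iota>"
    using kernel_exists[OF kG_module_free_cover[OF X] X free_cover_map_Hom[OF X] is_group] by blast
  thus ?thesis unfolding Omega_def by (rule someI_ex)
qed

text \<open>The iterated Heller translates are the syzygies of the resolution by free covers.\<close>

lemma (in fin_group) Omega_syzygies:
  assumes X: "kG_module G X"
  obtains P d \<pi> \<iota> where "syzygies G P d X (\<lambda>n. (Omega G ^^ n) X) \<pi> \<iota>"
proof -
  let ?K = "\<lambda>n. (Omega G ^^ n) X"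
  have K: "kG_module G (?K n)" for n
  proof (induction n)
    case (Suc n)
    obtain \<iota> where "is_kernel G (free_cover G (?K n)) (free_cover_map G (?K n)) (Omega G (?K n)) \<iota>"
      using Omega_kernel[OF Suc.IH] by blast
    thus ?case using is_kernelD(1) by simp
  qed (simp add: X)
  obtain \<iota> where \<iota>: "is_kernel G (free_cover G (?K n)) (free_cover_map G (?K n)) (?K (Suc n)) (\<iota> n)" for n
    using Omega_kernel[OF K] by simp metis
  let ?\<pi> = "\<lambda>n. free_cover_map G (?K n)"
  have "syzygies G (\<lambda>n. free_cover G (?K n))
      (\<lambda>n. case n of 0 \<Rightarrow> ?\<pi> 0 | Suc m \<Rightarrow> \<iota> m * ?\<pi> (Suc m)) X ?K ?\<pi> \<iota>"
    unfolding syzygies_def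
    using K \<iota> by (auto intro!: projective_free_cover free_cover_map_Hom free_cover_map_surj)
  thus thesis by (rule that)
qed

section \<open>Classes in Ext\<close>

lemma equiv_cong_rel:
  assumes A: "A \<subseteq> carrier_mat r c" and B: "B \<subseteq> carrier_mat r c"
    and zero: "0\<^sub>m r c \<in> B" and minus: "\<And>x y. x \<in> B \<Longrightarrow> y \<in> B \<Longrightarrow> x - y \<in> B"
  shows "equiv A (cong_rel A B)"
proof (rule equivI)
  show "cong_rel A B \<subseteq> A \<times> A" by (auto simp: cong_rel_def)
  have "x - x = 0\<^sub>m r c" if "x \<in> A" for x using that A by auto
  thus "refl_on A (cong_rel A B)" using zero by (auto simp: refl_on_def cong_rel_def)
  show "sym (cong_rel A B)"
  proof (rule symI)
    fix x y assume xy: "(x, y) \<in> cong_rel A B"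
    hence "x \<in> carrier_mat r c" "y \<in> carrier_mat r c" using A by (auto simp: cong_rel_def)
    hence "y - x = 0\<^sub>m r c - (x - y)" by (intro eq_matI) auto
    thus "(y, x) \<in> cong_rel A B" using xy minus[OF zero, of "x - y"] by (simp add: cong_rel_def)
  qed
  show "trans (cong_rel A B)"
  proof (rule transI)
    fix x y z assume xyz: "(x, y) \<in> cong_rel A B" "(y, z) \<in> cong_rel A B"
    hence "x \<in> carrier_mat r c" "y \<in> carrier_mat r c" "z \<in> carrier_mat r c"
      using A by (auto simp: cong_rel_def)
    hence "x - z = (x - y) - (0\<^sub>m r c - (y - z))" by (intro eq_matI) auto
    thus "(x, z) \<in> cong_rel A B"
      using xyz minus[OF _ minus[OF zero], of "x - y" "y - z"] by (simp add: cong_rel_def)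
  qed
qed

lemma induced_class:
  assumes R: "equiv A R" and R': "equiv A' R'" and x: "x \<in> A"
    and resp: "\<And>y. (x, y) \<in> R \<Longrightarrow> (\<phi> x, \<phi> y) \<in> R'"
  shows "induced R' \<phi> (R `` {x}) = R' `` {\<phi> x}"
proof -
  have "R' `` {\<phi> y} = R' `` {\<phi> x}" if "y \<in> R `` {x}" for y
    using that resp equiv_class_eq[OF R'] by blast
  moreover have "x \<in> R `` {x}" using equiv_class_self[OF R x] .
  ultimately show ?thesis unfolding induced_def by blast
qed

text \<open>
  Modules \<open>P n\<close> and homomorphisms \<open>d (n + 1) : P (n + 1) \<rightarrow> P n\<close>.  Cocycles modulo coboundaries make
  sense without \<open>d d = 0\<close>, because congruence modulo coboundaries is imposed on cocycles only.
\<close>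

definition module_sequence ::
  "('g, 'b) monoid_scheme \<Rightarrow> (nat \<Rightarrow> ('g, 'k::field) kG_rep) \<Rightarrow> (nat \<Rightarrow> 'k mat) \<Rightarrow> bool" where
  "module_sequence G P d \<longleftrightarrow> (\<forall>n. kG_module G (P n) \<and> d (Suc n) \<in> Hom_kG G (P (Suc n)) (P n))"

lemma module_sequenceD:
  assumes "module_sequence G P d"
  shows "kG_module G (P n)" "d (Suc n) \<in> Hom_kG G (P (Suc n)) (P n)"
  using assms by (auto simp: module_sequence_def)

lemma cocyclesD:
  assumes "f \<in> cocycles G P d n N"
  shows "f \<in> Hom_kG G (P n) N" "f * d (Suc n) = 0\<^sub>m (mdim N) (mdim (P (Suc n)))"
  using assms by (auto simp: cocycles_def)

lemma coboundaries_carrier: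
  assumes "module_sequence G P d"
  shows "coboundaries G P d n N \<subseteq> carrier_mat (mdim N) (mdim (P n))"
proof (cases n)
  case (Suc m)
  have "h * d n \<in> carrier_mat (mdim N) (mdim (P n))" if h: "h \<in> Hom_kG G (P m) N" for h
    using mult_carrier_mat[OF Hom_carrier[OF h] Hom_carrier[OF module_sequenceD(2)[OF assms]]] Suc
    by simp
  thus ?thesis using Suc by (auto simp: coboundaries_def)
qed (auto simp: coboundaries_def)

lemma equiv_Ext_rel:
  assumes P: "module_sequence G P d" and N: "kG_module G N"
  shows "equiv (cocycles G P d n N) (Ext_rel G P d n N)"
  unfolding Ext_rel_def
proof (rule equiv_cong_rel[of _ "mdim N" "mdim (P n)"])
  show "cocycles G P d n N \<subseteq> carrier_mat (mdim N) (mdim (P n))"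
    by (auto simp: cocycles_def Hom_dims)
  show "coboundaries G P d n N \<subseteq> carrier_mat (mdim N) (mdim (P n))"
    by (rule coboundaries_carrier[OF P])
  show "0\<^sub>m (mdim N) (mdim (P n)) \<in> coboundaries G P d n N"
  proof (cases n)
    case (Suc m)
    have "0\<^sub>m (mdim N) (mdim (P m)) * d n = 0\<^sub>m (mdim N) (mdim (P n))"
      using left_mult_zero_mat[OF Hom_carrier[OF module_sequenceD(2)[OF P]]] Suc by simp
    hence "\<exists>h. 0\<^sub>m (mdim N) (mdim (P n)) = h * d n \<and> h \<in> Hom_kG G (P m) N"
      using Hom_zero[OF module_sequenceD(1)[OF P] N, of m] by metis
    thus ?thesis using Suc by (simp add: coboundaries_def)
  qed (simp add: coboundaries_def)
  show "x - y \<in> coboundaries G P d n N"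
    if xy: "x \<in> coboundaries G P d n N" "y \<in> coboundaries G P d n N" for x y
  proof (cases n)
    case (Suc m)
    then obtain h h' where h: "h \<in> Hom_kG G (P m) N" "x = h * d n"
      and h': "h' \<in> Hom_kG G (P m) N" "y = h' * d n"
      using xy by (auto simp: coboundaries_def)
    have "x - y = (h - h') * d n"
      using minus_mult_distrib_mat[OF Hom_carrier[OF h(1)] Hom_carrier[OF h'(1)]
          Hom_carrier[OF module_sequenceD(2)[OF P]]] Suc h(2) h'(2) by simp
    thus ?thesis
      using Hom_minus[OF module_sequenceD(1)[OF P] N h(1) h'(1)] Suc by (auto simp: coboundaries_def)
  qed (use xy in \<open>auto simp: coboundaries_def\<close>)
qed

lemma syzygies_module_sequence: "syzygies G P d X K \<pi> \<iota> \<Longrightarrow> module_sequence G P d"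
  by (simp add: module_sequence_def syzygiesD(4,11))

text \<open>A cocycle in degree \<open>n\<close> is a homomorphism from the \<open>n\<close>-th syzygy.\<close>

lemma cocycles_syzygy:
  assumes S: "syzygies G P d X K \<pi> \<iota>" and N: "kG_module G N"
  shows "cocycles G P d n N = (\<lambda>\<phi>. \<phi> * \<pi> n) ` Hom_kG G (K n) N"
proof (intro equalityI subsetI)
  note \<pi> = syzygiesD(6)[OF S] and \<iota> = syzygiesD(10)[OF S]
  note dims = Hom_dims[OF \<pi>[of n]] Hom_dims[OF \<pi>[of "Suc n"]] Hom_dims[OF \<iota>[of n]]
  fix f
  {
    assume "f \<in> cocycles G P d n N"
    hence f: "f \<in> Hom_kG G (P n) N" and z: "f * d (Suc n) = 0\<^sub>m (mdim N) (mdim (P (Suc n)))"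
      by (simp_all add: cocycles_def)
    have "f * \<iota> n * \<pi> (Suc n) = 0\<^sub>m (mdim N) (mdim (K (Suc n))) * \<pi> (Suc n)"
      using z left_mult_zero_mat[OF Hom_carrier[OF \<pi>]]
      by (simp add: syzygiesD(9)[OF S] mat_assoc dims Hom_dims[OF f])
    hence "f * \<iota> n = 0\<^sub>m (mdim N) (mdim (K (Suc n)))"
      by (rule surjective_cancel[OF syzygiesD(7)[OF S] Hom_carrier[OF \<pi>], rotated 2])
        (simp_all add: dims)
    from cokernel_factor[OF syzygiesD(8)[OF S] \<pi> syzygiesD(7)[OF S] syzygiesD(4)[OF S]
        syzygiesD(5)[OF S] N f this]
    show "f \<in> (\<lambda>\<phi>. \<phi> * \<pi> n) ` Hom_kG G (K n) N" by (metis image_eqI)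
  next
    assume "f \<in> (\<lambda>\<phi>. \<phi> * \<pi> n) ` Hom_kG G (K n) N"
    then obtain \<phi> where \<phi>: "\<phi> \<in> Hom_kG G (K n) N" and f: "f = \<phi> * \<pi> n" by blast
    have "f * d (Suc n) = \<phi> * (\<pi> n * \<iota> n * \<pi> (Suc n))"
      by (simp add: f syzygiesD(9)[OF S] mat_assoc dims Hom_dims[OF \<phi>])
    also have "\<pi> n * \<iota> n = 0\<^sub>m (mdim (K n)) (mdim (K (Suc n)))"
      by (rule kernel_comp_zero[OF syzygiesD(8)[OF S] \<pi>])
    also have "\<phi> * (\<dots> * \<pi> (Suc n)) = 0\<^sub>m (mdim N) (mdim (P (Suc n)))"
      using left_mult_zero_mat[OF Hom_carrier[OF \<pi>]] right_mult_zero_mat[OF Hom_carrier[OF \<phi>]] by simp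
    finally show "f \<in> cocycles G P d n N"
      using Hom_comp[OF syzygiesD(4)[OF S] syzygiesD(5)[OF S] N \<pi> \<phi>]
      by (simp add: cocycles_def f)
  }
qed


section \<open>The transfer map\<close>

lemma dim_adjoint_mat [simp]:
  "dim_row (adjoint_mat M W f) = dim_row f * mdim W" "dim_col (adjoint_mat M W f) = mdim M"
  by (simp_all add: adjoint_mat_def)

lemma adjoint_mat_natural:
  assumes "dim_col h = mdim M' * mdim W" "dim_row e = mdim M'" "dim_col e = mdim M"
  shows "adjoint_mat M W (h * kron e (1\<^sub>m (mdim W))) = adjoint_mat M' W h * e"
proof -
  let ?w = "mdim W"
  have "adjoint_mat M W (h * kron e (1\<^sub>m ?w)) =
      kron (h * kron e (1\<^sub>m ?w)) (1\<^sub>m ?w * 1\<^sub>m ?w) * kron (1\<^sub>m (mdim M)) (coev_mat ?w)"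
    by (simp add: adjoint_mat_def)
  also have "kron (h * kron e (1\<^sub>m ?w)) (1\<^sub>m ?w * 1\<^sub>m ?w) = kron h (1\<^sub>m ?w) * kron (kron e (1\<^sub>m ?w)) (1\<^sub>m ?w)"
    by (rule kron_mult_kron[symmetric]) (use assms in auto)
  also have "kron (kron e (1\<^sub>m ?w)) (1\<^sub>m ?w) = kron e (1\<^sub>m (?w * ?w))"
    by (simp add: kron_assoc kron_one_one)
  also have "kron h (1\<^sub>m ?w) * kron e (1\<^sub>m (?w * ?w)) * kron (1\<^sub>m (mdim M)) (coev_mat ?w) =
      kron h (1\<^sub>m ?w) * (kron e (1\<^sub>m (?w * ?w)) * kron (1\<^sub>m (mdim M)) (coev_mat ?w))"
    by (rule mat_assoc) (use assms in auto)
  also have "kron e (1\<^sub>m (?w * ?w)) * kron (1\<^sub>m (mdim M)) (coev_mat ?w) = kron e (coev_mat ?w)"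
    using assms by (subst kron_mult_kron) auto
  also have "\<dots> = kron (1\<^sub>m (mdim M')) (coev_mat ?w) * kron e (1\<^sub>m (Suc 0))"
    using assms by (subst kron_mult_kron) auto
  finally show ?thesis
    using assms by (simp add: adjoint_mat_def mat_assoc)
qed

lemma adjoint_mat_minus:
  assumes "f \<in> carrier_mat r (mdim M * mdim W)" "f' \<in> carrier_mat r (mdim M * mdim W)"
  shows "adjoint_mat M W (f - f') = adjoint_mat M W f - adjoint_mat M W f'"
  unfolding adjoint_mat_def kron_minus_left[OF assms]
  by (rule minus_mult_distrib_mat[of _ "r * mdim W" "mdim M * mdim W * mdim W"];
      rule carrier_matI) (use assms in auto)

lemma adjoint_mat_zero:
  "adjoint_mat M W (0\<^sub>m r (mdim M * mdim W)) = 0\<^sub>m (r * mdim W) (mdim M)"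
  unfolding adjoint_mat_def kron_zero_left
  by (subst left_mult_zero_mat[of _ _ "mdim M"]) (auto intro!: carrier_matI)

context W_module
begin

lemma adjoint_mat_Hom:
  assumes M: "kG_module G M" and V: "kG_module G V" and f: "f \<in> Hom_kG G (M \<otimes>\<^sub>k W) V"
  shows "adjoint_mat M W f \<in> Hom_kG G M (V \<otimes>\<^sub>k dual G W)"
proof -
  have one: "1\<^sub>m (mdim W) \<in> Hom_kG G (dual G W) (dual G W)" using Hom_one[OF dual_W] by simp
  have MW: "kG_module G (M \<otimes>\<^sub>k W)" and VW: "kG_module G (V \<otimes>\<^sub>k dual G W)"
    and MWW: "kG_module G (M \<otimes>\<^sub>k W \<otimes>\<^sub>k dual G W)"
    by (intro kG_module_tensor M V W dual_W)+
  have "kron (1\<^sub>m (mdim M)) (coev_mat (mdim W)) \<in> Hom_kG G (M \<otimes>\<^sub>k triv) (M \<otimes>\<^sub>k (W \<otimes>\<^sub>k dual G W))"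
    by (intro Hom_kron kG_module_tensor M W dual_W kG_module_triv Hom_one coev_Hom(1))
  hence "kron (1\<^sub>m (mdim M)) (coev_mat (mdim W)) \<in> Hom_kG G M (M \<otimes>\<^sub>k W \<otimes>\<^sub>k dual G W)"
    by (simp add: tensor_assoc)
  moreover have "kron f (1\<^sub>m (mdim W)) \<in> Hom_kG G (M \<otimes>\<^sub>k W \<otimes>\<^sub>k dual G W) (V \<otimes>\<^sub>k dual G W)"
    by (rule Hom_kron[OF MW V dual_W dual_W f one])
  ultimately show ?thesis
    unfolding adjoint_mat_def by (rule Hom_comp[OF M MWW VW])
qed

text \<open>The inverse of the adjunction: \<open>g\<close> corresponds to \<open>(1 \<otimes> ev) \<circ> (g \<otimes> 1)\<close>.\<close>

lemma adjoint_mat_inverse: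
  assumes M: "kG_module G M" and V: "kG_module G V" and g: "g \<in> Hom_kG G M (V \<otimes>\<^sub>k dual G W)"
  defines "f \<equiv> kron (1\<^sub>m (mdim V)) (ev_mat (mdim W)) * kron g (1\<^sub>m (mdim W))"
  shows "f \<in> Hom_kG G (M \<otimes>\<^sub>k W) V" "adjoint_mat M W f = g"
proof -
  let ?w = "mdim W" and ?v = "mdim V"
  have MW: "kG_module G (M \<otimes>\<^sub>k W)" and VD: "kG_module G (V \<otimes>\<^sub>k dual G W)"
    and VDW: "kG_module G (V \<otimes>\<^sub>k dual G W \<otimes>\<^sub>k W)"
    by (intro kG_module_tensor M V W dual_W)+
  have "kron (1\<^sub>m ?v) (ev_mat ?w) \<in> Hom_kG G (V \<otimes>\<^sub>k (dual G W \<otimes>\<^sub>k W)) (V \<otimes>\<^sub>k triv)"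
    by (intro Hom_kron kG_module_tensor V W dual_W kG_module_triv Hom_one ev_Hom(2))
  hence e: "kron (1\<^sub>m ?v) (ev_mat ?w) \<in> Hom_kG G (V \<otimes>\<^sub>k dual G W \<otimes>\<^sub>k W) V"
    by (simp add: tensor_assoc)
  show "f \<in> Hom_kG G (M \<otimes>\<^sub>k W) V"
    unfolding f_def by (rule Hom_comp[OF MW VDW V Hom_kron[OF M VD W W g Hom_one[OF W]] e])
  have "adjoint_mat M W f = adjoint_mat (V \<otimes>\<^sub>k dual G W) W (kron (1\<^sub>m ?v) (ev_mat ?w)) * g"
    unfolding f_def by (rule adjoint_mat_natural) (use Hom_dims[OF g] in \<open>auto simp: mult.assoc\<close>)
  also have "adjoint_mat (V \<otimes>\<^sub>k dual G W) W (kron (1\<^sub>m ?v) (ev_mat ?w)) =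
      kron (1\<^sub>m ?v) (kron (ev_mat ?w) (1\<^sub>m ?w)) * kron (1\<^sub>m ?v) (kron (1\<^sub>m ?w) (coev_mat ?w))"
    by (simp add: adjoint_mat_def kron_assoc[symmetric] kron_one_one)
  also have "\<dots> = 1\<^sub>m (?v * ?w)"
    by (subst kron_mult_kron) (auto simp: triangle_right kron_one_one)
  finally show "adjoint_mat M W f = g" using Hom_dims[OF g] by simp
qed

lemma module_sequence_tensor:
  assumes P: "module_sequence G P d"
  shows "module_sequence G (tensor_cx P W) (tensor_diff d W)"
  using module_sequenceD[OF P] W
  by (auto simp: module_sequence_def tensor_cx_def tensor_diff_def
      intro!: kG_module_tensor Hom_kron Hom_one)

lemma adjoint_mat_cocycle:
  assumes P: "module_sequence G P d" and V: "kG_module G V"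
    and f: "f \<in> cocycles G (tensor_cx P W) (tensor_diff d W) n V"
  shows "adjoint_mat (P n) W f \<in> cocycles G P d n (V \<otimes>\<^sub>k dual G W)"
proof -
  note d = Hom_dims[OF module_sequenceD(2)[OF P, of n]]
  have fH: "f \<in> Hom_kG G (P n \<otimes>\<^sub>k W) V"
    and z: "f * kron (d (Suc n)) (1\<^sub>m (mdim W)) = 0\<^sub>m (mdim V) (mdim (P (Suc n)) * mdim W)"
    using cocyclesD[OF f] by (auto simp: tensor_cx_def tensor_diff_def)
  have "adjoint_mat (P n) W f * d (Suc n) =
      adjoint_mat (P (Suc n)) W (f * kron (d (Suc n)) (1\<^sub>m (mdim W)))"
    by (rule adjoint_mat_natural[symmetric]) (use Hom_dims[OF fH] d in auto)
  also have "\<dots> = 0\<^sub>m (mdim V * mdim W) (mdim (P (Suc n)))" unfolding z by (rule adjoint_mat_zero)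
  finally show ?thesis
    using adjoint_mat_Hom[OF module_sequenceD(1)[OF P] V fH] by (simp add: cocycles_def)
qed

lemma adjoint_mat_cocycle_surj:
  assumes P: "module_sequence G P d" and V: "kG_module G V"
    and g: "g \<in> cocycles G P d n (V \<otimes>\<^sub>k dual G W)"
  obtains f where "f \<in> cocycles G (tensor_cx P W) (tensor_diff d W) n V" "adjoint_mat (P n) W f = g"
proof -
  let ?e = "kron (1\<^sub>m (mdim V)) (ev_mat (mdim W))" and ?w = "mdim W"
  note d = Hom_dims[OF module_sequenceD(2)[OF P, of n]]
  have gH: "g \<in> Hom_kG G (P n) (V \<otimes>\<^sub>k dual G W)"
    and z: "g * d (Suc n) = 0\<^sub>m (mdim V * ?w) (mdim (P (Suc n)))"
    using cocyclesD[OF g] by auto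
  note gd = Hom_dims[OF gH]
  have "?e * kron g (1\<^sub>m ?w) * kron (d (Suc n)) (1\<^sub>m ?w) =
      ?e * (kron g (1\<^sub>m ?w) * kron (d (Suc n)) (1\<^sub>m ?w))"
    by (rule mat_assoc) (use gd d in \<open>auto simp: mult.assoc\<close>)
  also have "kron g (1\<^sub>m ?w) * kron (d (Suc n)) (1\<^sub>m ?w) = kron (g * d (Suc n)) (1\<^sub>m ?w)"
    using gd d by (subst kron_mult_kron) auto
  also have "?e * \<dots> = 0\<^sub>m (mdim V) (mdim (P (Suc n)) * ?w)"
    unfolding z kron_zero_left
    by (subst right_mult_zero_mat[of _ "mdim V"]) (auto intro!: carrier_matI simp: mult.assoc)
  finally have "?e * kron g (1\<^sub>m ?w) \<in> cocycles G (tensor_cx P W) (tensor_diff d W) n V"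
    using adjoint_mat_inverse(1)[OF module_sequenceD(1)[OF P] V gH]
    by (simp add: cocycles_def tensor_cx_def tensor_diff_def)
  thus thesis using adjoint_mat_inverse(2)[OF module_sequenceD(1)[OF P] V gH] by (rule that)
qed

lemma counit_cocycle:
  assumes P: "module_sequence G P d" and N: "kG_module G N"
    and g: "g \<in> cocycles G P d n (N \<otimes>\<^sub>k W \<otimes>\<^sub>k dual G W)"
  shows "counit N * g \<in> cocycles G P d n N"
proof -
  note d = Hom_dims[OF module_sequenceD(2)[OF P, of n]] and c = cocyclesD[OF g]
  have "counit N * g * d (Suc n) = counit N * (g * d (Suc n))"
    using Hom_dims[OF c(1)] d by (simp add: mat_assoc)
  also have "\<dots> = 0\<^sub>m (mdim N) (mdim (P (Suc n)))"
    unfolding c(2) by (rule right_mult_zero_mat[OF Hom_carrier[OF counit_Hom[OF N]]])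
  finally show ?thesis
    using Hom_comp[OF module_sequenceD(1)[OF P] kG_module_NWW[OF N] N c(1) counit_Hom[OF N]]
    by (simp add: cocycles_def)
qed

text \<open>On representing cocycles the transfer is the adjunction followed by the counit.\<close>

lemma transfer_class:
  assumes P: "module_sequence G P d" and Y: "kG_module G Y"
    and f: "f \<in> cocycles G (tensor_cx P W) (tensor_diff d W) n (Y \<otimes>\<^sub>k W)"
  shows "transfer_W G P d n W Y (Ext_rel G (tensor_cx P W) (tensor_diff d W) n (Y \<otimes>\<^sub>k W) `` {f}) =
    Ext_rel G P d n Y `` {counit Y * adjoint_mat (P n) W f}"
proof -
  let ?V = "Y \<otimes>\<^sub>k W" and ?T = "tensor_cx P W" and ?t = "tensor_diff d W"
  have V: "kG_module G ?V" by (intro kG_module_tensor Y W)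
  note PW = module_sequence_tensor[OF P] and YWW = kG_module_NWW[OF Y]
  note adj = adjoint_mat_cocycle[OF P V]
  have 1: "Ext_adjunction G P d n W ?V (Ext_rel G ?T ?t n ?V `` {f}) =
      Ext_rel G P d n (?V \<otimes>\<^sub>k dual G W) `` {adjoint_mat (P n) W f}"
    unfolding Ext_adjunction_def
  proof (rule induced_class[OF equiv_Ext_rel[OF PW V] equiv_Ext_rel[OF P YWW] f])
    fix y assume "(f, y) \<in> Ext_rel G ?T ?t n ?V"
    hence y: "y \<in> cocycles G ?T ?t n ?V" and cob: "f - y \<in> coboundaries G ?T ?t n ?V"
      by (auto simp: Ext_rel_def cong_rel_def)
    have c: "f \<in> carrier_mat (mdim ?V) (mdim (P n) * mdim W)"
      "y \<in> carrier_mat (mdim ?V) (mdim (P n) * mdim W)"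
      using cocyclesD(1)[OF f] cocyclesD(1)[OF y] Hom_carrier by (force simp: tensor_cx_def)+
    have "adjoint_mat (P n) W (f - y) \<in> coboundaries G P d n (?V \<otimes>\<^sub>k dual G W)"
    proof (cases n)
      case 0
      thus ?thesis using cob adjoint_mat_zero[of "P 0" W "mdim ?V"]
        by (simp add: coboundaries_def tensor_cx_def)
    next
      case (Suc m)
      then obtain h where h: "h \<in> Hom_kG G (P m \<otimes>\<^sub>k W) ?V"
        "f - y = h * kron (d (Suc m)) (1\<^sub>m (mdim W))"
        using cob by (auto simp: coboundaries_def tensor_cx_def tensor_diff_def)
      have "adjoint_mat (P (Suc m)) W (f - y) = adjoint_mat (P m) W h * d (Suc m)"
        unfolding h(2) by (rule adjoint_mat_natural)
          (use Hom_dims[OF h(1)] Hom_dims[OF module_sequenceD(2)[OF P, of m]] in auto)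
      thus ?thesis
        using adjoint_mat_Hom[OF module_sequenceD(1)[OF P] V h(1)] Suc
        by (auto simp: coboundaries_def)
    qed
    thus "(adjoint_mat (P n) W f, adjoint_mat (P n) W y) \<in> Ext_rel G P d n (?V \<otimes>\<^sub>k dual G W)"
      using adj[OF f] adj[OF y] by (simp add: Ext_rel_def cong_rel_def adjoint_mat_minus[OF c])
  qed
  have 2: "Ext_map G P d n Y (counit Y) (Ext_rel G P d n (?V \<otimes>\<^sub>k dual G W) `` {adjoint_mat (P n) W f}) =
      Ext_rel G P d n Y `` {counit Y * adjoint_mat (P n) W f}"
    unfolding Ext_map_def
  proof (rule induced_class[OF equiv_Ext_rel[OF P YWW] equiv_Ext_rel[OF P Y] adj[OF f]])
    let ?x = "adjoint_mat (P n) W f"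
    fix y assume "(?x, y) \<in> Ext_rel G P d n (?V \<otimes>\<^sub>k dual G W)"
    hence y: "y \<in> cocycles G P d n (?V \<otimes>\<^sub>k dual G W)"
      and cob: "?x - y \<in> coboundaries G P d n (?V \<otimes>\<^sub>k dual G W)"
      by (auto simp: Ext_rel_def cong_rel_def)
    have eq: "counit Y * (?x - y) = counit Y * ?x - counit Y * y"
      by (rule mult_minus_distrib_mat[OF Hom_carrier[OF counit_Hom[OF Y]]
            Hom_carrier[OF cocyclesD(1)[OF adj[OF f]]] Hom_carrier[OF cocyclesD(1)[OF y]]])
    have "counit Y * (?x - y) \<in> coboundaries G P d n Y"
    proof (cases n)
      case 0
      thus ?thesis using cob right_mult_zero_mat[OF Hom_carrier[OF counit_Hom[OF Y]]]
        by (simp add: coboundaries_def)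
    next
      case (Suc m)
      then obtain h where h: "h \<in> Hom_kG G (P m) (?V \<otimes>\<^sub>k dual G W)" "?x - y = h * d (Suc m)"
        using cob by (auto simp: coboundaries_def)
      have "counit Y * (?x - y) = counit Y * h * d (Suc m)"
        unfolding h(2) using Hom_dims[OF h(1)] Hom_dims[OF module_sequenceD(2)[OF P, of m]]
        by (simp add: mat_assoc)
      thus ?thesis
        using Hom_comp[OF module_sequenceD(1)[OF P] YWW Y h(1) counit_Hom[OF Y]] Suc
        by (auto simp: coboundaries_def)
    qed
    thus "(counit Y * ?x, counit Y * y) \<in> Ext_rel G P d n Y"
      using counit_cocycle[OF P Y adj[OF f]] counit_cocycle[OF P Y y]
      by (simp add: Ext_rel_def cong_rel_def eq)
  qed
  show ?thesis
    unfolding transfer_W_def o_apply 1 using 2 by (simp add: counit_def)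
qed

text \<open>
  Coboundaries always lift along the counit, so surjectivity of the transfer may be tested on
  cocycles instead of on their classes.
\<close>

lemma coboundary_lifts:
  assumes S: "syzygies G P d X K \<pi> \<iota>" and Y: "kG_module G Y"
    and c: "c \<in> coboundaries G P d n Y"
  obtains c' where "c' \<in> cocycles G P d n (Y \<otimes>\<^sub>k W \<otimes>\<^sub>k dual G W)" "counit Y * c' = c"
proof (cases n)
  case 0
  have z: "0\<^sub>m (mdim (Y \<otimes>\<^sub>k W \<otimes>\<^sub>k dual G W)) (mdim (P 0)) \<in> Hom_kG G (P 0) (Y \<otimes>\<^sub>k W \<otimes>\<^sub>k dual G W)"
    by (rule Hom_zero[OF syzygiesD(4)[OF S] kG_module_NWW[OF Y]])
  show thesis
  proof (rule that)
    show "0\<^sub>m (mdim (Y \<otimes>\<^sub>k W \<otimes>\<^sub>k dual G W)) (mdim (P 0)) \<in> cocycles G P d n (Y \<otimes>\<^sub>k W \<otimes>\<^sub>k dual G W)"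
      using z left_mult_zero_mat[OF Hom_carrier[OF syzygiesD(11)[OF S, of 0]]] 0
      by (simp add: cocycles_def)
    show "counit Y * 0\<^sub>m (mdim (Y \<otimes>\<^sub>k W \<otimes>\<^sub>k dual G W)) (mdim (P 0)) = c"
      using c 0 right_mult_zero_mat[OF Hom_carrier[OF counit_Hom[OF Y]]]
      by (simp add: coboundaries_def)
  qed
next
  case (Suc m)
  then obtain h where h: "h \<in> Hom_kG G (P m) Y" "c = h * d n"
    using c by (auto simp: coboundaries_def)
  obtain h' where h': "h' \<in> Hom_kG G (P m) (Y \<otimes>\<^sub>k W \<otimes>\<^sub>k dual G W)" "counit Y * h' = h"
    using lifts_projective[OF syzygiesD(3)[OF S] Y h(1)] by (auto simp: lifts_def)
  note YWW = kG_module_NWW[OF Y] and \<iota> = syzygiesD(10)[OF S, of m]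
  note dims = Hom_dims[OF h'(1)] Hom_dims[OF \<iota>] Hom_dims[OF syzygiesD(6)[OF S, of n]]
    Hom_dims[OF syzygiesD(11)[OF S, of m]]
  have "h' * d n = h' * \<iota> m * \<pi> n"
    using dims Suc by (simp add: syzygiesD(9)[OF S] mat_assoc)
  moreover have "h' * \<iota> m \<in> Hom_kG G (K n) (Y \<otimes>\<^sub>k W \<otimes>\<^sub>k dual G W)"
    using Hom_comp[OF syzygiesD(5)[OF S] syzygiesD(4)[OF S] YWW \<iota> h'(1)] Suc by simp
  ultimately have "h' * d n \<in> cocycles G P d n (Y \<otimes>\<^sub>k W \<otimes>\<^sub>k dual G W)"
    unfolding cocycles_syzygy[OF S YWW] by blast
  moreover have "counit Y * (h' * d n) = c"
    using dims Suc h(2) h'(2)[symmetric] by (simp add: mat_assoc)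
  ultimately show thesis by (rule that)
qed

lemma transfer_surj_iff_cocycles_lift:
  assumes S: "syzygies G P d X K \<pi> \<iota>" and Y: "kG_module G Y"
  shows "transfer_W G P d n W Y ` Ext_kG G (tensor_cx P W) (tensor_diff d W) n (Y \<otimes>\<^sub>k W) = Ext_kG G P d n Y
    \<longleftrightarrow> (\<forall>f\<in>cocycles G P d n Y. \<exists>g\<in>cocycles G P d n (Y \<otimes>\<^sub>k W \<otimes>\<^sub>k dual G W). counit Y * g = f)"
    (is "?surj \<longleftrightarrow> ?lift")
proof
  note P = syzygies_module_sequence[OF S] and YWW = kG_module_NWW[OF Y]
  have V: "kG_module G (Y \<otimes>\<^sub>k W)" by (intro kG_module_tensor Y W)
  let ?T = "cocycles G (tensor_cx P W) (tensor_diff d W) n (Y \<otimes>\<^sub>k W)"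
  let ?C = "cocycles G P d n Y" and ?R = "Ext_rel G P d n Y"
  let ?tr = "\<lambda>f. counit Y * adjoint_mat (P n) W f"
  note adj = adjoint_mat_cocycle[OF P V, of _ n]
  have image: "transfer_W G P d n W Y ` Ext_kG G (tensor_cx P W) (tensor_diff d W) n (Y \<otimes>\<^sub>k W) =
      (\<lambda>f. ?R `` {?tr f}) ` ?T"
    unfolding Ext_kG_def quotient_def using transfer_class[OF P Y] by auto
  have eq: "equiv ?C ?R" by (rule equiv_Ext_rel[OF P Y])
  {
    assume lift: ?lift
    have "\<exists>f'\<in>?T. ?tr f' = f" if "f \<in> ?C" for f
      using that lift adjoint_mat_cocycle_surj[OF P V, of _ n] by metis
    moreover have "?tr f' \<in> ?C" if "f' \<in> ?T" for f'
      using counit_cocycle[OF P Y adj[OF that]] .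
    ultimately have "?tr ` ?T = ?C" by blast
    hence "(\<lambda>f. ?R `` {f}) ` (?tr ` ?T) = Ext_kG G P d n Y"
      unfolding Ext_kG_def quotient_def by auto
    thus ?surj unfolding image by (simp add: image_image)
  next
    assume surj: ?surj
    show ?lift
    proof
      fix f assume f: "f \<in> ?C"
      have "?R `` {f} \<in> Ext_kG G P d n Y" unfolding Ext_kG_def using f by (rule quotientI)
      hence "?R `` {f} \<in> (\<lambda>f. ?R `` {?tr f}) ` ?T" using surj image by simp
      then obtain f' where f': "f' \<in> ?T" "?R `` {f} = ?R `` {?tr f'}" by blast
      hence "(f, ?tr f') \<in> ?R"
        using eq_equiv_class[OF _ eq] counit_cocycle[OF P Y adj[OF f'(1)]] by blast
      hence "f - ?tr f' \<in> coboundaries G P d n Y" by (auto simp: Ext_rel_def cong_rel_def)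
      then obtain c where c: "c \<in> cocycles G P d n (Y \<otimes>\<^sub>k W \<otimes>\<^sub>k dual G W)" "counit Y * c = f - ?tr f'"
        using coboundary_lifts[OF S Y] by blast
      let ?g = "adjoint_mat (P n) W f'"
      note g = cocyclesD[OF adj[OF f'(1)]] and cc = cocyclesD[OF c(1)]
      have "counit Y * (?g + c) = counit Y * ?g + counit Y * c"
        by (rule mult_add_distrib_mat[OF Hom_carrier[OF counit_Hom[OF Y]] Hom_carrier[OF g(1)] Hom_carrier[OF cc(1)]])
      also have "\<dots> = f"
        unfolding c(2) using Hom_dims[OF cocyclesD(1)[OF f]] Hom_dims[OF g(1)]
        by (intro eq_matI) (simp_all del: index_mult_mat(1))
      finally have "counit Y * (?g + c) = f" .
      moreover have "(?g + c) * d (Suc n) = 0\<^sub>m (mdim (Y \<otimes>\<^sub>k W \<otimes>\<^sub>k dual G W)) (mdim (P (Suc n)))"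
        using add_mult_distrib_mat[OF Hom_carrier[OF g(1)] Hom_carrier[OF cc(1)]
            Hom_carrier[OF module_sequenceD(2)[OF P]]] g(2) cc(2) by simp
      ultimately show "\<exists>g\<in>cocycles G P d n (Y \<otimes>\<^sub>k W \<otimes>\<^sub>k dual G W). counit Y * g = f"
        using Hom_add[OF module_sequenceD(1)[OF P] YWW g(1) cc(1)] by (auto simp: cocycles_def)
    qed
  }
qed

lemma transfer_surj_iff_lifts:
  assumes S: "syzygies G P d X K \<pi> \<iota>" and Y: "kG_module G Y"
  shows "transfer_W G P d n W Y ` Ext_kG G (tensor_cx P W) (tensor_diff d W) n (Y \<otimes>\<^sub>k W) = Ext_kG G P d n Y
    \<longleftrightarrow> (\<forall>f\<in>Hom_kG G (K n) Y. lifts (K n) Y f)"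
proof -
  note YWW = kG_module_NWW[OF Y] and \<pi> = syzygiesD(6)[OF S, of n]
  have cancel: "counit Y * (g * \<pi> n) = f * \<pi> n \<longleftrightarrow> counit Y * g = f"
    if "f \<in> Hom_kG G (K n) Y" "g \<in> Hom_kG G (K n) (Y \<otimes>\<^sub>k W \<otimes>\<^sub>k dual G W)" for f g
  proof -
    note dims = Hom_dims[OF that(1)] Hom_dims[OF that(2)] Hom_dims[OF \<pi>]
    have "counit Y * (g * \<pi> n) = counit Y * g * \<pi> n" by (simp add: mat_assoc dims)
    thus ?thesis
      using surjective_cancel[OF syzygiesD(7)[OF S] Hom_carrier[OF \<pi>], of "counit Y * g" f] dims
      by auto
  qed
  show ?thesis
    unfolding transfer_surj_iff_cocycles_lift[OF S Y] cocycles_syzygy[OF S Y] cocycles_syzygy[OF S YWW]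
      lifts_def
    by (simp add: cancel cong: ball_cong bex_cong)
qed

lemma lifts_stable_retract:
  assumes M: "kG_module G M" and M': "kG_module G M'" and N: "kG_module G N"
    and retr: "stable_retract G M M'" and all: "\<forall>f\<in>Hom_kG G M' N. lifts M' N f"
    and f: "f \<in> Hom_kG G M N"
  shows "lifts M N f"
proof -
  obtain a b Q s t where a: "a \<in> Hom_kG G M M'" and b: "b \<in> Hom_kG G M' M"
    and Q: "projective_kG G Q" and s: "s \<in> Hom_kG G M Q" and t: "t \<in> Hom_kG G Q M"
    and one: "b * a + t * s = 1\<^sub>m (mdim M)" using retr by (auto simp: stable_retract_def)
  note Qm = projective_kG_module[OF Q]
  note dims = Hom_dims[OF a] Hom_dims[OF b] Hom_dims[OF s] Hom_dims[OF t] Hom_dims[OF f]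
  have "lifts M N (f * b * a)"
    using lifts_comp[OF M M' N a] Hom_comp[OF M' M N b f] all by blast
  moreover have "lifts M N (f * t * s)"
    by (rule lifts_comp[OF M Qm N s lifts_projective[OF Q N Hom_comp[OF Qm M N t f]]])
  ultimately have "lifts M N (f * b * a + f * t * s)" by (rule lifts_add[OF M N])
  also have "f * b * a + f * t * s = f * (b * a) + f * (t * s)" by (simp add: mat_assoc dims)
  also have "\<dots> = f * (b * a + t * s)"
    by (rule mult_add_distrib_mat[OF Hom_carrier[OF f], symmetric]; rule carrier_matI; simp add: dims)
  also have "\<dots> = f" using Hom_carrier[OF f] by (simp add: one)
  finally show ?thesis .
qed

text \<open>The equivalence holds in every single degree, not only for large \<open>n\<close>.\<close>

lemma transfer_surj_iff_stable_Hom_zero: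
  assumes X: "kG_module G X" and Y: "kG_module G Y"
  shows "(\<forall>P d. projective_resolution G P d X \<longrightarrow>
      transfer_W G P d n W Y ` Ext_kG G (tensor_cx P W) (tensor_diff d W) n (Y \<otimes>\<^sub>k W) = Ext_kG G P d n Y)
    \<longleftrightarrow> W_stable_Hom G W ((Omega G ^^ n) X) Y = {W_stable_zero G W ((Omega G ^^ n) X) Y}"
proof -
  let ?K = "\<lambda>n. (Omega G ^^ n) X"
  obtain P d \<pi> \<iota> where S: "syzygies G P d X ?K \<pi> \<iota>" using Omega_syzygies[OF X] by blast
  have K: "kG_module G (?K n)" by (rule syzygiesD(5)[OF S])
  have iff: "transfer_W G P d n W Y ` Ext_kG G (tensor_cx P W) (tensor_diff d W) n (Y \<otimes>\<^sub>k W) =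
      Ext_kG G P d n Y \<longleftrightarrow> (\<forall>f\<in>Hom_kG G (?K n) Y. lifts (?K n) Y f)"
    by (rule transfer_surj_iff_lifts[OF S Y])
  show ?thesis unfolding W_stable_Hom_zero_iff[OF K Y]
  proof
    assume "\<forall>P d. projective_resolution G P d X \<longrightarrow>
      transfer_W G P d n W Y ` Ext_kG G (tensor_cx P W) (tensor_diff d W) n (Y \<otimes>\<^sub>k W) = Ext_kG G P d n Y"
    thus "\<forall>f\<in>Hom_kG G (?K n) Y. lifts (?K n) Y f"
      using syzygies_resolution[OF S] iff by blast
  next
    assume lift: "\<forall>f\<in>Hom_kG G (?K n) Y. lifts (?K n) Y f"
    show "\<forall>P d. projective_resolution G P d X \<longrightarrow>
      transfer_W G P d n W Y ` Ext_kG G (tensor_cx P W) (tensor_diff d W) n (Y \<otimes>\<^sub>k W) = Ext_kG G P d n Y"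
    proof (intro allI impI)
      fix P' d' assume "projective_resolution G P' d' X"
      then obtain K' \<pi>' \<iota>' where S': "syzygies G P' d' X K' \<pi>' \<iota>'"
        using resolution_syzygies[OF is_group X] by blast
      have "stable_retract G (K' n) (?K n)" by (rule stable_retract_syzygies[OF S' S])
      from lifts_stable_retract[OF syzygiesD(5)[OF S'] K Y this lift]
      have "\<forall>f\<in>Hom_kG G (K' n) Y. lifts (K' n) Y f" by blast
      thus "transfer_W G P' d' n W Y ` Ext_kG G (tensor_cx P' W) (tensor_diff d' W) n (Y \<otimes>\<^sub>k W) =
          Ext_kG G P' d' n Y"
        using transfer_surj_iff_lifts[OF S' Y, of n] by blast
    qed
  qed
qed

end

theorem lemma4p2:
  fixes G :: "('g, 'b) monoid_scheme"
    and W X :: "('g, 'k::field) kG_rep"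
  assumes "group G" and "finite (carrier G)"
    and "CHAR('k) dvd Coset.order G"
    and "kG_module G W" and "mdim W \<noteq> 0"
    and "kG_module G X"
  shows "virtually_W_projective G W X \<longleftrightarrow>
    (\<forall>Y. kG_module G Y \<longrightarrow>
      (\<forall>\<^sub>F n in sequentially.
        W_stable_Hom G W ((Omega G ^^ n) X) Y = {W_stable_zero G W ((Omega G ^^ n) X) Y}))"
proof -
  interpret W_module G W
    using assms by (simp add: W_module_def W_module_axioms_def fin_group_def fin_group_axioms_def)
  show ?thesis
    using assms(6) transfer_surj_iff_stable_Hom_zero[OF assms(6)]
    by (simp add: virtually_W_projective_def)
qed

end
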